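(* Let $N$ be a prime number, and let $F_N(a,b,A,B)=\sum_{i,j\ge 0}A^iB^j\,T_N(a^ib^j)\in \mathbf{C}[a,b][[A,B]]$ be the generating function of the Hecke operator $T_N$ acting on modular forms for $SL(2,\mathbf{Z})$ (where each $T_N(a^ib^j)$ is written as a polynomial in $a,b$). Then $F_N$ is a rational function in $\mathbf{Q}(a,b,A,B)$, i.e. there exist polynomials $P,Q\in\mathbf{Q}[a,b,A,B]$ with $Q\neq 0$ such that $Q\cdot F_N=P$ in $\mathbf{C}[a,b][[A,B]]$. Moreover, $F_N$ can be explicitly computed for any specific value of $N$: there is an algorithm which, given a prime $N$, outputs such $P$ and $Q$.
   Context: $\mathcal{H}$ is the upper half plane, $q=e^{2\pi i\tau}$, $\mathcal{M}_\kappa(\Gamma)$ is the space of (holomorphic) weight $\kappa$ modular forms for $\Gamma$. The graded ring $\mathcal{R}=\bigoplus_{\kappa\ge0}\mathcal{M}_\kappa(SL(2,\mathbf{Z}))$ equals the polynomial ring $\mathbf{C}[a,b]$ in the algebraically independent forms $$a(\tau)=-\tfrac13\Bigl(1+240\sum_{n\ge1}\sigma_3(n)q^n\Bigr)\ (\text{weight }4),\qquad b(\tau)=\tfrac{2}{27}\Bigl(1-504\sum_{n\ge1}\sigma_5(n)q^n\Bigr)\ (\text{weight }6).$$ For $N$ prime and $f\in\mathcal{M}_\kappa(SL(2,\mathbf{Z}))$, $$T_Nf(\tau)=\frac1N\Bigl(N^\kappa f(N\tau)+\sum_{t=0}^{N-1}f((\tau+t)/N)\Bigr),$$ extended additively to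 a $\mathbf{C}$-linear map $T_N:\mathcal{R}\to\mathcal{R}$. Here $A,B$ are formal variables, and $a,b$ are regarded as independent transcendental variables. *)

theory Defs
  imports
    Complex_Main
    "HOL-Computational_Algebra.Computational_Algebra"
    "HOL-Library.Nat_Bijection"
begin

section \<open>The forms \<open>a\<close> and \<open>b\<close>, and the Hecke operator\<close>

definition upper_half_plane :: "complex set" where
  "upper_half_plane = {\<tau>. Im \<tau> > 0}"

definition nome :: "complex \<Rightarrow> complex" where
  "nome \<tau> = exp (2 * of_real pi * \<i> * \<tau>)"

definition divisor_sum :: "nat \<Rightarrow> nat \<Rightarrow> nat" where
  "divisor_sum k n = (\<Sum>d | d dvd n. d ^ k)"

text \<open>The series are summed over \<open>n \<ge> 1\<close>, hence the shift by \<open>Suc\<close>.\<close>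

definition form_a :: "complex \<Rightarrow> complex" where
  "form_a \<tau> = - (1/3) * (1 + 240 * (\<Sum>n. of_nat (divisor_sum 3 (Suc n)) * nome \<tau> ^ Suc n))"

definition form_b :: "complex \<Rightarrow> complex" where
  "form_b \<tau> = (2/27) * (1 - 504 * (\<Sum>n. of_nat (divisor_sum 5 (Suc n)) * nome \<tau> ^ Suc n))"

text \<open>The action of \<open>T\<^sub>N\<close> (\<open>N\<close> prime) on forms of weight \<open>\<kappa>\<close>.\<close>

definition hecke :: "nat \<Rightarrow> nat \<Rightarrow> (complex \<Rightarrow> complex) \<Rightarrow> complex \<Rightarrow> complex" where
  "hecke N \<kappa> f \<tau> =
     1 / of_nat N * (of_nat N ^ \<kappa> * f (of_nat N * \<tau>) + (\<Sum>t<N. f ((\<tau> + of_nat t) / of_nat N)))"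

text \<open>
  The graded ring of modular forms is \<open>\<complex>[a, b]\<close>, represented as \<open>\<complex>[a][b]\<close>: the inner variable is
  \<open>a\<close>, the outer one \<open>b\<close>.  A polynomial is identified with the function on the upper half plane
  obtained by substituting the forms for the variables; since the forms are algebraically
  independent, it is determined by that function.
\<close>

definition var_a :: "complex poly poly" where
  "var_a = [:[:0, 1:]:]"

definition var_b :: "complex poly poly" where
  "var_b = [:0, 1:]"

definition form_of :: "complex poly poly \<Rightarrow> complex \<Rightarrow> complex" where
  "form_of p \<tau> = poly (poly p [:form_b \<tau>:]) (form_a \<tau>)"

text \<open>
  The linear extension of \<open>T\<^sub>N\<close> to the graded ring: \<open>a\<^sup>i b\<^sup>j\<close> has weight \<open>4 i + 6 j\<close>, and the value
  is the polynomial in \<open>a\<close> and \<open>b\<close> that expresses the resulting sum of modular forms.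
\<close>

definition hecke_ring :: "nat \<Rightarrow> complex poly poly \<Rightarrow> complex poly poly" where
  "hecke_ring N p = (THE r. \<forall>\<tau>\<in>upper_half_plane.
     form_of r \<tau> =
       (\<Sum>j\<le>degree p. \<Sum>i\<le>degree (coeff p j).
          coeff (coeff p j) i * hecke N (4 * i + 6 * j) (form_of (var_a ^ i * var_b ^ j)) \<tau>))"

section \<open>The generating function\<close>

text \<open>\<open>\<complex>[a, b][[A, B]]\<close> is represented as \<open>\<complex>[a][b][[A]][[B]]\<close>, with \<open>B\<close> the outermost variable.\<close>

definition hecke_gf :: "nat \<Rightarrow> complex poly poly fps fps" where
  "hecke_gf N = Abs_fps (\<lambda>j. Abs_fps (\<lambda>i. hecke_ring N (var_a ^ i * var_b ^ j)))"

text \<open>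
  \<open>\<rat>[a, b, A, B]\<close> is represented as \<open>\<rat>[a][b][A][B]\<close>; the following is its inclusion into
  \<open>\<complex>[a, b][[A, B]]\<close>.
\<close>

type_synonym rat_poly4 = "rat poly poly poly poly"

definition embed_poly4 :: "rat_poly4 \<Rightarrow> complex poly poly fps fps" where
  "embed_poly4 P =
     fps_of_poly (map_poly (\<lambda>p. fps_of_poly (map_poly (map_poly (map_poly of_rat)) p)) P)"

section \<open>Computability\<close>

text \<open>
  Kleene's general recursive functions.  A \<open>k\<close>-ary function takes its arguments as a list; its
  values on lists of any length other than \<open>k\<close> carry no meaning and are never used.  Minimisation
  is only applied to regular functions, so every function is total.
\<close>

inductive recursive_fn :: "nat \<Rightarrow> (nat list \<Rightarrow> nat) \<Rightarrow> bool" where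
  zero: "recursive_fn k (\<lambda>xs. 0)"
| succ: "recursive_fn 1 (\<lambda>xs. Suc (xs ! 0))"
| proj: "i < k \<Longrightarrow> recursive_fn k (\<lambda>xs. xs ! i)"
| comp: "recursive_fn (length gs) f \<Longrightarrow> (\<And>g. g \<in> set gs \<Longrightarrow> recursive_fn k g) \<Longrightarrow>
           recursive_fn k (\<lambda>xs. f (map (\<lambda>g. g xs) gs))"
| prec: "recursive_fn k f \<Longrightarrow> recursive_fn (Suc (Suc k)) h \<Longrightarrow>
           recursive_fn (Suc k)
             (\<lambda>xs. rec_nat (f (tl xs)) (\<lambda>n r. h (n # r # tl xs)) (hd xs))"
| mini: "recursive_fn (Suc k) f \<Longrightarrow> (\<And>xs. length xs = k \<Longrightarrow> \<exists>n. f (n # xs) = 0) \<Longrightarrow>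
           recursive_fn k (\<lambda>xs. LEAST n. f (n # xs) = 0)"

definition computable :: "(nat \<Rightarrow> nat) \<Rightarrow> bool" where
  "computable g \<longleftrightarrow> (\<exists>f. recursive_fn 1 f \<and> (\<forall>n. g n = f [n]))"

text \<open>
  Natural numbers as codes for rationals, for polynomials (by their coefficient lists, constant
  coefficient first, trailing zeros allowed) and for pairs of polynomials in \<open>a, b, A, B\<close>.
\<close>

definition decode_rat :: "nat \<Rightarrow> rat" where
  "decode_rat n = (case prod_decode n of (x, y) \<Rightarrow> of_int (int_decode x) / of_nat (Suc y))"

definition decode_poly :: "(nat \<Rightarrow> 'a::zero) \<Rightarrow> nat \<Rightarrow> 'a poly" where
  "decode_poly dec n = Poly (map dec (list_decode n))"

definition decode_poly4 :: "nat \<Rightarrow> rat_poly4" where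
  "decode_poly4 = decode_poly (decode_poly (decode_poly (decode_poly decode_rat)))"

definition decode_poly4_pair :: "nat \<Rightarrow> rat_poly4 \<times> rat_poly4" where
  "decode_poly4_pair n = map_prod decode_poly4 decode_poly4 (prod_decode n)"

end

theory Submission
  imports
    Defs
    "HOL-Complex_Analysis.Complex_Analysis"
    "HOL-Number_Theory.Cong"
begin

text \<open>
  Let \<open>a\<^sub>t\<close>, \<open>b\<^sub>t\<close> (\<open>0 \<le> t \<le> N\<close>) be the functions \<open>a((\<tau> + t)/N)\<close>, \<open>b((\<tau> + t)/N)\<close> for \<open>t < N\<close> and
  \<open>N\<^sup>4 a(N \<tau>)\<close>, \<open>N\<^sup>6 b(N \<tau>)\<close> for \<open>t = N\<close>. Then \<open>N T\<^sub>N(a\<^sup>i b\<^sup>j) = \<Sum>\<^sub>t a\<^sub>t\<^sup>i b\<^sub>t\<^sup>j\<close>, so the generating function is a sum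
  of \<open>N + 1\<close> products of geometric series with common denominator \<open>\<Prod>\<^sub>t (1 - a\<^sub>t A) (1 - b\<^sub>t B)\<close>.
  The modular group permutes the pairs \<open>(a\<^sub>t, b\<^sub>t)\<close>, hence the coefficients of the denominator and of the numerator
  are modular forms, i.e. polynomials in \<open>a\<close> and \<open>b\<close>.

  For forms of a given weight, a relation \<open>Q F = P\<close> amounts to linear equations with rational coefficients between
  Fourier coefficients. A \<open>\<rat>\<close>-linear projection of \<open>\<complex>\<close> onto \<open>\<rat>\<close> turns the complex solution into a rational
  one. Since finitely many of these equations imply all the others, the relation is decidable, and \<open>P\<close>, \<open>Q\<close> are found
  by unbounded search.
\<close>

section \<open>Eisenstein series\<close>

text \<open>The definitions give \<open>a\<close> and \<open>b\<close> as q-series only, which says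
  nothing about \<tau> -> -1/\<tau>. Modularity comes from identifying them with lattice sums, whose
  q-expansions follow from the reflection formula of the Gamma function. Expressing modular forms as
  polynomials in \<open>a\<close> and \<open>b\<close> then needs a vanishing criterion. A supremum
  argument gives it for weight at most 10 times the order at the cusp, where the valence formula
  would allow any weight below 12 times the order. The loss is harmless: an even weight below 12 is
  at most 10, odd weights are excluded by symmetry, and the one higher weight needed for the
  structure theorem is 28, with order 3. It occurs in an identity between derivatives of the
  discriminant, which shows without a product formula that the discriminant has no zero. The same
  criterion bounds the number of Fourier coefficients to be compared in a relation. The search
  itself never computes the complex denominator or the projection; they only serve to prove that it
  ends and that its finite test is sound.\<close>

abbreviation \<open>\<H> \<equiv> upper_half_plane\<close>

text \<open>The polylogarithm of order \<open>- j\<close>. For \<open>j = 0\<close> the term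
  \<open>n = 0\<close> counts as 1, so the value is 1/(1 - q) rather than q/(1 - q).\<close>

definition power_series_q :: "nat \<Rightarrow> complex \<Rightarrow> complex" where
  "power_series_q j q = eval_fps (Abs_fps (\<lambda>n. of_nat n ^ j)) q"

lemma norm_nome: "norm (nome \<tau>) = exp (- 2 * pi * Im \<tau>)"
  by (simp add: nome_def)

lemma norm_nome_less_1: "\<tau> \<in> \<H> \<Longrightarrow> norm (nome \<tau>) < 1"
  by (simp add: norm_nome upper_half_plane_def)

lemma open_upper_half_plane: "open \<H>"
  unfolding upper_half_plane_def by (rule open_halfspace_Im_gt)

lemma upper_half_plane_not_Int: "\<tau> \<in> \<H> \<Longrightarrow> \<tau> \<notin> \<int>"
  by (auto simp: upper_half_plane_def elim!: Ints_cases)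

lemma nome_derivative: "(nome has_field_derivative 2 * of_real pi * \<i> * nome z) (at z within A)"
  unfolding nome_def by (rule derivative_eq_intros refl | simp)+

lemma conv_radius_power: "conv_radius (\<lambda>n. of_nat n ^ j :: complex) = 1"
proof (rule conv_radius_ratio_limit_ereal_nonzero)
  have "(\<lambda>n. (real n / real (Suc n)) ^ j) \<longlonglongrightarrow> 1 ^ j"
    by (intro tendsto_power LIMSEQ_n_over_Suc_n)
  then show "(\<lambda>n. ereal (norm (of_nat n ^ j :: complex) / norm (of_nat (Suc n) ^ j :: complex))) \<longlonglongrightarrow> 1"
    by (simp add: norm_power power_divide one_ereal_def del: of_nat_Suc)
qed (auto simp: eventually_at_top_linorder intro: exI[of _ 1])

lemma power_series_q_sums: "norm q < 1 \<Longrightarrow> (\<lambda>n. of_nat n ^ j * q ^ n) sums power_series_q j q"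
  unfolding power_series_q_def
  using sums_eval_fps[of q "Abs_fps (\<lambda>n. of_nat n ^ j)"] by (simp add: fps_conv_radius_def conv_radius_power)

text \<open>In terms of q, d/d\<tau> is 2 pi i q d/dq, and q d/dq multiplies the n-th coefficient by
  n.\<close>

lemma power_series_q_derivative:
  assumes "z \<in> \<H>"
  shows "((\<lambda>z. power_series_q j (nome z)) has_field_derivative 2 * of_real pi * \<i> * power_series_q (Suc j) (nome z)) (at z)"
proof -
  let ?f = "Abs_fps (\<lambda>n. of_nat n ^ j) :: complex fps"
  have q: "norm (nome z) < 1" using assms by (rule norm_nome_less_1)
  have "((\<lambda>z. eval_fps ?f (nome z)) has_field_derivative eval_fps (fps_deriv ?f) (nome z) * (2 * of_real pi * \<i> * nome z)) (at z)"
    by (rule DERIV_chain2[OF has_field_derivative_eval_fps nome_derivative])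
      (use q in \<open>simp add: fps_conv_radius_def conv_radius_power\<close>)
  moreover have "eval_fps (fps_deriv ?f) (nome z) * nome z = power_series_q (Suc j) (nome z)"
  proof -
    have "fps_conv_radius (fps_deriv ?f) \<ge> 1"
      using fps_conv_radius_deriv[of ?f] by (simp add: fps_conv_radius_def conv_radius_power)
    then have "eval_fps (fps_X * fps_deriv ?f) (nome z) = nome z * eval_fps (fps_deriv ?f) (nome z)"
      using q by (subst eval_fps_mult) (auto intro: less_le_trans[of "ereal (norm (nome z))" 1])
    moreover have "fps_X * fps_deriv ?f = Abs_fps (\<lambda>n. of_nat n ^ Suc j)"
      by (rule fps_ext) (auto simp: fps_X_mult_nth)
    ultimately show ?thesis by (simp add: power_series_q_def mult_ac)
  qed
  then have "eval_fps (fps_deriv ?f) (nome z) * (2 * of_real pi * \<i> * nome z) = 2 * of_real pi * \<i> * power_series_q (Suc j) (nome z)"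
    by (metis mult.left_commute mult.assoc)
  ultimately show ?thesis
    unfolding power_series_q_def by simp
qed

section \<open>Polygamma functions and derivatives of the cotangent\<close>

lemma open_diff_Ints: "open (- \<int> :: complex set)"
  by (simp add: closed_Ints open_Compl)

lemma sin_pi_nonzero: "z \<notin> \<int> \<Longrightarrow> sin (of_real pi * z :: complex) \<noteq> 0"
  by (auto simp: sin_eq_0 Ints_def)

lemma Ints_one_minus: "(1 - z :: complex) \<in> \<int> \<longleftrightarrow> z \<in> \<int>"
  by (metis Ints_1 Ints_diff diff_diff_eq2 add_diff_cancel_left')

text \<open>Logarithmic derivative of Euler's reflection formula: differentiating Gamma z Gamma (1 -
  z) = pi / sin (pi z) in two ways and dividing by the common value leaves the cotangent.\<close>

lemma Digamma_reflection:
  assumes "z \<notin> \<int>"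
  shows "Digamma z - Digamma (1 - z) = - of_real pi * cot (of_real pi * z :: complex)"
proof -
  have nz: "z \<notin> \<int>\<^sub>\<le>\<^sub>0" "1 - z \<notin> \<int>\<^sub>\<le>\<^sub>0"
    using assms Ints_one_minus[of z] by (auto simp: nonpos_Ints_subset_Ints[THEN subsetD])
  have s: "sin (of_real pi * z) \<noteq> 0" using sin_pi_nonzero[OF assms] .
  have "((\<lambda>z. Gamma z * Gamma (1 - z)) has_field_derivative
          Gamma z * Gamma (1 - z) * (Digamma z - Digamma (1 - z))) (at z)"
    by (rule derivative_eq_intros refl nz | simp add: algebra_simps)+
  moreover have "((\<lambda>z. Gamma z * Gamma (1 - z)) has_field_derivative
      - (of_real pi * (of_real pi * cos (of_real pi * z)) / (sin (of_real pi * z))\<^sup>2)) (at z)"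
    unfolding Gamma_reflection_complex
    by (rule derivative_eq_intros refl s | simp add: power2_eq_square)+
  ultimately have eq: "Gamma z * Gamma (1 - z) * (Digamma z - Digamma (1 - z)) =
     - (of_real pi * (of_real pi * cos (of_real pi * z)) / (sin (of_real pi * z))\<^sup>2)"
    by (rule DERIV_unique)
  have key: "D = - p * (c / t)" if "p / t * D = - (p * (p * c) / t\<^sup>2)" "p \<noteq> 0" "t \<noteq> 0" for D p c t :: complex
  proof -
    have "D = (t / p) * (p / t * D)" using that(2,3) by simp
    also have "\<dots> = (t / p) * (- (p * (p * c) / t\<^sup>2))" by (simp only: that(1))
    also have "\<dots> = - p * (c / t)" using that(2,3) by (simp add: power2_eq_square)
    finally show ?thesis .
  qed
  show ?thesis
    unfolding cot_def by (rule key[OF eq[unfolded Gamma_reflection_complex] _ s]) simp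
qed

text \<open>Packages one differentiation of an identity on an open set; it is iterated for the
  cotangent, for transformation laws and for local factorisations at a zero.\<close>

lemma DERIV_eq_on_open:
  assumes "open A" "\<And>z. z \<in> A \<Longrightarrow> f z = g z" "\<And>z. z \<in> A \<Longrightarrow> (f has_field_derivative f' z) (at z)"
    "\<And>z. z \<in> A \<Longrightarrow> (g has_field_derivative g' z) (at z)" "z \<in> A"
  shows "f' z = (g' z :: complex)"
proof -
  have "(g has_field_derivative f' z) (at z)"
    by (rule has_field_derivative_transform_within_open[OF assms(3)[OF assms(5)] assms(1,5)]) (use assms in auto)
  then show ?thesis using assms(4,5) DERIV_unique by blast
qed

text \<open>The \<open>n\<close>-th derivative of - pi cot (pi z) off the integers, with the two
  terms of the reflection formula kept apart so that each can be written as a series. The sign comes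
  from differentiating in 1 - z.\<close>

definition refl_polygamma :: "nat \<Rightarrow> complex \<Rightarrow> complex" where
  "refl_polygamma n z = Polygamma n z + (-1) ^ Suc n * Polygamma n (1 - z)"

lemma refl_polygamma_derivative:
  assumes "z \<notin> \<int>"
  shows "(refl_polygamma n has_field_derivative refl_polygamma (Suc n) z) (at z)"
proof -
  have nz: "z \<notin> \<int>\<^sub>\<le>\<^sub>0" "1 - z \<notin> \<int>\<^sub>\<le>\<^sub>0"
    using assms Ints_one_minus[of z] by (auto simp: nonpos_Ints_subset_Ints[THEN subsetD])
  show ?thesis
    unfolding refl_polygamma_def by (rule derivative_eq_intros refl nz | simp)+
qed

lemma refl_polygamma_0: "z \<notin> \<int> \<Longrightarrow> refl_polygamma 0 z = - of_real pi * cot (of_real pi * z)"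
  using Digamma_reflection[of z] by (simp add: refl_polygamma_def)

text \<open>On the upper half plane - pi cot (pi z) is - pi i plus 2 pi i times a geometric series
  in q. The additive constant is lost at the first derivative, so the formula starts at
  \<open>Suc n\<close>.\<close>

lemma refl_polygamma_q:
  assumes "z \<in> \<H>"
  shows "refl_polygamma (Suc n) z = (2 * of_real pi * \<i>) ^ Suc (Suc n) * power_series_q (Suc n) (nome z)"
proof -
  have base: "refl_polygamma 0 z = - (of_real pi * \<i>) + 2 * of_real pi * \<i> * power_series_q 0 (nome z)" if "z \<in> \<H>" for z
  proof -
    have q: "norm (nome z) < 1" using norm_nome_less_1[OF that] .
    then have "nome z \<noteq> 1" by auto
    have "power_series_q 0 (nome z) = 1 / (1 - nome z)"
      using power_series_q_sums[OF q, of 0] geometric_sums[OF q] by (simp add: sums_unique2)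
    moreover have "cot (of_real pi * z) = - \<i> * (1 + nome z) / (1 - nome z)"
    proof -
      define e where "e = exp (\<i> * (of_real pi * z))"
      have e: "e \<noteq> 0" "nome z = e\<^sup>2" "exp (- (\<i> * (of_real pi * z))) = inverse e"
        by (simp_all add: e_def exp_minus nome_def power2_eq_square mult_exp_exp) (simp add: mult_ac)
      show ?thesis
        unfolding cot_def sin_exp_eq cos_exp_eq e_def[symmetric] e(2,3) mult_minus_left
        using e(1) \<open>nome z \<noteq> 1\<close>[unfolded e(2)]
        by (simp add: field_simps power2_eq_square)
    qed
    moreover have "- p * (- \<i> * (1 + x) / (1 - x)) = - (p * \<i>) + 2 * p * \<i> * (1 / (1 - x))" if "x \<noteq> 1" for x p :: complex
      using that by (simp add: divide_simps) (simp add: algebra_simps)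
    ultimately show ?thesis
      using refl_polygamma_0[OF upper_half_plane_not_Int[OF that]] \<open>nome z \<noteq> 1\<close> by simp
  qed
  show ?thesis using assms
  proof (induction n arbitrary: z)
    case 0
    show ?case
      by (rule DERIV_eq_on_open[OF open_upper_half_plane base
            refl_polygamma_derivative[OF upper_half_plane_not_Int] _ 0(1)])
        (auto intro!: derivative_eq_intros power_series_q_derivative simp: power2_eq_square)
  next
    case (Suc n)
    show ?case
      by (rule DERIV_eq_on_open[OF open_upper_half_plane Suc.IH
            refl_polygamma_derivative[OF upper_half_plane_not_Int] _ Suc.prems])
        (auto intro!: derivative_eq_intros power_series_q_derivative simp: mult_ac)
  qed
qed

text \<open>With y = pi cot (pi z) the Riccati equation y' = - (pi^2 + y^2) turns every derivative
  into a polynomial in y. At 1/2 the cotangent vanishes and only the constant term is left. Orders 3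
  and 5 are the ones that give zeta(4) and zeta(6).\<close>

lemma refl_polygamma_half: "refl_polygamma 3 (1/2) = 2 * of_real pi ^ 4" "refl_polygamma 5 (1/2) = 16 * of_real pi ^ 6"
proof -
  let ?w = "(of_real pi)\<^sup>2 :: complex"
  define y where "y = (\<lambda>z. of_real pi * cot (of_real pi * z) :: complex)"
  have y: "(y has_field_derivative - (?w + y z ^ 2)) (at z)" if "z \<notin> \<int>" for z
  proof -
    have s: "sin (of_real pi * z) \<noteq> 0" using sin_pi_nonzero[OF that] .
    have "(y has_field_derivative of_real pi * (of_real pi * (- inverse ((sin (of_real pi * z))\<^sup>2)))) (at z)"
      unfolding y_def by (rule derivative_eq_intros refl DERIV_cot[THEN DERIV_chain2] s | simp)+
    moreover have "of_real pi * (of_real pi * (- inverse ((sin (of_real pi * z))\<^sup>2))) = - (?w + y z ^ 2)"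
    proof -
      have *: "inverse ((sin (of_real pi * z))\<^sup>2) = 1 + (cos (of_real pi * z) / sin (of_real pi * z)) ^ 2"
        unfolding power_divide cos_squared_eq using s by (simp add: field_simps)
      show ?thesis unfolding * y_def cot_def power_mult_distrib by (simp add: algebra_simps power2_eq_square)
    qed
    ultimately show ?thesis by simp
  qed
  note step = DERIV_eq_on_open[OF open_diff_Ints _ refl_polygamma_derivative]
  have 0: "refl_polygamma 0 z = - y z" if "z \<in> - \<int>" for z
    using refl_polygamma_0 that by (simp add: y_def)
  have 1: "refl_polygamma (Suc 0) z = ?w + y z ^ 2" if "z \<in> - \<int>" for z
    by (rule step[OF 0 _ _ that]) (auto intro!: derivative_eq_intros y)
  have 2: "refl_polygamma (Suc (Suc 0)) z = - (2 * ?w * y z + 2 * y z ^ 3)" if "z \<in> - \<int>" for z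
    by (rule step[OF 1 _ _ that]) (auto intro!: derivative_eq_intros y simp: algebra_simps eval_nat_numeral)
  have 3: "refl_polygamma (Suc (Suc (Suc 0))) z = 2 * ?w ^ 2 + 8 * ?w * y z ^ 2 + 6 * y z ^ 4" if "z \<in> - \<int>" for z
    by (rule step[OF 2 _ _ that]) (auto intro!: derivative_eq_intros y simp: algebra_simps eval_nat_numeral)
  have 4: "refl_polygamma (Suc (Suc (Suc (Suc 0)))) z = - (16 * ?w ^ 2 * y z + 40 * ?w * y z ^ 3 + 24 * y z ^ 5)" if "z \<in> - \<int>" for z
    by (rule step[OF 3 _ _ that]) (auto intro!: derivative_eq_intros y simp: algebra_simps eval_nat_numeral)
  have 5: "refl_polygamma (Suc (Suc (Suc (Suc (Suc 0))))) z = 16 * ?w ^ 3 + 136 * ?w ^ 2 * y z ^ 2 + 240 * ?w * y z ^ 4 + 120 * y z ^ 6" if "z \<in> - \<int>" for z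
    by (rule step[OF 4 _ _ that]) (auto intro!: derivative_eq_intros y simp: algebra_simps eval_nat_numeral)
  have half: "1/2 \<in> - (\<int> :: complex set)" using fraction_not_in_Ints[of 2 1, where 'a = complex] by simp
  have "cos (of_real pi * (1/2) :: complex) = of_real (cos (pi / 2))"
    unfolding cos_of_real[symmetric] by simp
  then have "y (1/2) = 0" by (simp add: y_def cot_def)
  then show "refl_polygamma 3 (1/2) = 2 * of_real pi ^ 4" "refl_polygamma 5 (1/2) = 16 * of_real pi ^ 6"
    using 3[OF half] 5[OF half] by (simp_all add: eval_nat_numeral)
qed

section \<open>The Lipschitz formula and two zeta values\<close>

lemma has_sum_int_split:
  fixes f :: "int \<Rightarrow> 'a :: banach"
  assumes "summable (\<lambda>n. norm (f (int n)))" "summable (\<lambda>n. norm (f (- int n - 1)))"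
  shows "(f has_sum ((\<Sum>n. f (int n)) + (\<Sum>n. f (- int n - 1)))) UNIV"
proof -
  have "(f has_sum (\<Sum>n. f (int n))) (range int)"
    using norm_summable_imp_has_sum[OF assms(1)] assms(1)
    by (subst has_sum_reindex) (auto simp: o_def summable_norm_cancel[THEN summable_sums] inj_def)
  moreover have "(f has_sum (\<Sum>n. f (- int n - 1))) (range (\<lambda>n. - int n - 1))"
    using norm_summable_imp_has_sum[OF assms(2)] assms(2)
    by (subst has_sum_reindex) (auto simp: o_def summable_norm_cancel[THEN summable_sums] inj_def)
  ultimately have "(f has_sum ((\<Sum>n. f (int n)) + (\<Sum>n. f (- int n - 1)))) (range int \<union> range (\<lambda>n. - int n - 1))"
    by (rule has_sum_Un_disjoint) auto
  moreover have "range int \<union> range (\<lambda>n. - int n - 1) = UNIV"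
  proof -
    have "x \<in> range int \<or> x \<in> range (\<lambda>n. - int n - 1)" for x
      by (cases "x \<ge> 0") (auto intro: image_eqI[of _ _ "nat x"] image_eqI[of _ _ "nat (- x - 1)"])
    then show ?thesis by auto
  qed
  ultimately show ?thesis by simp
qed

lemma summable_norm_inverse_shift:
  fixes z :: complex
  assumes "n \<ge> 2"
  shows "summable (\<lambda>k. norm (inverse ((z + of_nat k) ^ n)))"
proof (rule summable_comparison_test_ev)
  have "summable (\<lambda>k. inverse (real k ^ n))"
    using inverse_power_summable[of n] assms by simp
  then show "summable (\<lambda>k. 2 ^ n * inverse (real k ^ n))" by (rule summable_mult)
  show "\<forall>\<^sub>F k in sequentially. norm (norm (inverse ((z + of_nat k) ^ n))) \<le> 2 ^ n * inverse (real k ^ n)"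
    using eventually_gt_at_top[of "nat \<lceil>2 * norm z\<rceil> + 1"]
  proof eventually_elim
    case (elim k)
    then have k: "real k > 2 * norm z" "k > 0" by linarith+
    have "real k / 2 \<le> norm (z + of_nat k)"
      using norm_diff_ineq[of "of_nat k :: complex" z] k by (simp add: add.commute)
    then have "(real k / 2) ^ n \<le> norm (z + of_nat k) ^ n" by (intro power_mono) auto
    then have "inverse (norm (z + of_nat k) ^ n) \<le> inverse ((real k / 2) ^ n)"
      using k by (intro le_imp_inverse_le) auto
    then have "norm (inverse ((z + of_nat k) ^ n)) \<le> inverse ((real k / 2) ^ n)"
      by (simp only: norm_inverse norm_power)
    also have "\<dots> = 2 ^ n * inverse (real k ^ n)"
      by (simp add: power_divide field_simps)
    finally show ?case by simp
  qed
qed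

text \<open>The polygamma series at z and at 1 - z are the parts of the sum with m >= 0 and m < 0.
  For odd \<open>n\<close> the exponent \<open>Suc n\<close> is even, which absorbs the sign of z +
  m on the negative part.\<close>

lemma refl_polygamma_has_sum:
  assumes "z \<notin> \<int>" "odd n"
  shows "((\<lambda>m::int. 1 / (z + of_int m) ^ Suc n) has_sum (refl_polygamma n z / fact n)) UNIV"
proof -
  have n: "n > 0" "even (Suc n)" using assms(2) by (auto intro: odd_pos)
  have nz: "z \<noteq> 0" "1 - z \<noteq> 0" using assms by auto
  have e: "z + of_int (- int k - 1) = - (1 - z + of_nat k)" for k by simp
  have e': "(z + of_int (- int k - 1)) ^ Suc n = (1 - z + of_nat k) ^ Suc n" for k
    unfolding e by (rule power_minus_even[OF n(2)])
  have "((\<lambda>m::int. inverse ((z + of_int m) ^ Suc n)) has_sum ((\<Sum>k. inverse ((z + of_int (int k)) ^ Suc n)) +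
     (\<Sum>k. inverse ((z + of_int (- int k - 1)) ^ Suc n)))) UNIV"
    by (rule has_sum_int_split; unfold e' of_int_of_nat_eq; intro summable_norm_inverse_shift) (use n(1) in auto)
  moreover have "(\<Sum>k. inverse ((z + of_int (int k)) ^ Suc n)) = Polygamma n z / fact n"
    using sums_unique[OF Polygamma_LIMSEQ[OF nz(1) n(1)]] assms(2) by simp
  moreover have "(\<Sum>k. inverse ((z + of_int (- int k - 1)) ^ Suc n)) = Polygamma n (1 - z) / fact n"
    using sums_unique[OF Polygamma_LIMSEQ[OF nz(2) n(1)]] assms(2) unfolding e' by (simp del: power_Suc)
  ultimately show ?thesis
    using assms(2) by (simp add: refl_polygamma_def add_divide_distrib inverse_eq_divide del: power_Suc)
qed

lemma lipschitz_formula: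
  assumes "z \<in> \<H>" "odd n"
  shows "((\<lambda>m::int. 1 / (z + of_int m) ^ Suc n) has_sum ((2 * of_real pi * \<i>) ^ Suc n / fact n * power_series_q n (nome z))) UNIV"
proof -
  obtain m where "n = Suc m" using assms(2) by (cases n) auto
  then show ?thesis
    using refl_polygamma_has_sum[OF upper_half_plane_not_Int[OF assms(1)] assms(2)] refl_polygamma_q[OF assms(1), of m]
    by (simp del: power_Suc)
qed

text \<open>At the fixed point 1/2 of z -> 1 - z the two polygamma terms agree, which accounts for
  the factor 2 in the denominator; 1/2 + k = (2 k + 1)/2 accounts for
  \<open>2 ^ Suc n\<close>.\<close>

lemma odd_zeta_sums:
  assumes "odd n"
  shows "(\<lambda>k. 1 / (2 * of_nat k + 1) ^ Suc n) sums (refl_polygamma n (1/2) / (2 * 2 ^ Suc n * fact n) :: complex)"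
proof -
  have "n > 0" using assms by (auto intro: odd_pos)
  have "(\<lambda>k. inverse ((1/2 + of_nat k) ^ Suc n) / 2 ^ Suc n) sums ((-1) ^ Suc n * Polygamma n (1/2 :: complex) / fact n / 2 ^ Suc n)"
    by (intro sums_divide Polygamma_LIMSEQ \<open>n > 0\<close>) auto
  moreover have "inverse ((1/2 + of_nat k) ^ Suc n) / 2 ^ Suc n = 1 / (2 * of_nat k + 1 :: complex) ^ Suc n" for k
  proof -
    have "(2 * of_nat k + 1 :: complex) = 2 * (1/2 + of_nat k)" by (simp add: algebra_simps)
    then show ?thesis by (simp only: power_mult_distrib) (simp add: divide_simps del: power_Suc)
  qed
  moreover have "(-1) ^ Suc n * Polygamma n (1/2 :: complex) / fact n / 2 ^ Suc n = refl_polygamma n (1/2) / (2 * 2 ^ Suc n * fact n)"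
    using assms by (simp add: refl_polygamma_def field_simps)
  ultimately show ?thesis by simp
qed

text \<open>The terms with even denominator add up to \<open>1 / 2 ^ Suc n\<close> times the whole
  sum, which gives a linear equation for it.\<close>

lemma zeta_odd_part:
  assumes "n \<ge> 1" "(\<lambda>k. 1 / (2 * of_nat k + 1) ^ Suc n) sums s"
  shows "(\<lambda>k. 1 / of_nat (Suc k) ^ Suc n) sums (2 ^ Suc n / (2 ^ Suc n - 1) * s :: complex)"
proof -
  have "summable (\<lambda>k. norm (inverse ((1 + of_nat k :: complex) ^ Suc n)))"
    using assms by (intro summable_norm_inverse_shift) simp
  from summable_norm_cancel[OF this] have "summable (\<lambda>k. 1 / of_nat (Suc k) ^ Suc n :: complex)"
    by (simp only: inverse_eq_divide of_nat_Suc)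
  then obtain Z where Z: "(\<lambda>k. 1 / of_nat (Suc k) ^ Suc n :: complex) sums Z" by (auto simp: summable_def)
  have "(\<lambda>k. \<Sum>i = k * 2..<k * 2 + 2. 1 / of_nat (Suc i) ^ Suc n :: complex) sums Z"
    by (rule sums_group[OF Z]) simp
  moreover have "(\<Sum>i = k * 2..<k * 2 + 2. 1 / of_nat (Suc i) ^ Suc n :: complex)
     = 1 / (2 * of_nat k + 1) ^ Suc n + 1 / 2 ^ Suc n * (1 / of_nat (Suc k) ^ Suc n)" for k
  proof -
    have "(\<Sum>i = k * 2..<k * 2 + 2. f i) = f (k * 2) + f (Suc (k * 2))" for f :: "nat \<Rightarrow> complex"
      by (simp add: numeral_2_eq_2)
    moreover have "1 / of_nat (Suc (Suc (k * 2))) ^ Suc n = 1 / 2 ^ Suc n * (1 / of_nat (Suc k) ^ Suc n :: complex)"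
    proof -
      have "(of_nat (Suc (Suc (k * 2))) :: complex) = 2 * of_nat (Suc k)" by simp
      then show ?thesis by (simp only: power_mult_distrib) (simp del: power_Suc of_nat_Suc)
    qed
    moreover have "(of_nat (Suc (k * 2)) :: complex) = 2 * of_nat k + 1" by simp
    ultimately show ?thesis by (simp only:)
  qed
  ultimately have "(\<lambda>k. 1 / (2 * of_nat k + 1) ^ Suc n + 1 / 2 ^ Suc n * (1 / of_nat (Suc k) ^ Suc n) :: complex) sums Z"
    by simp
  moreover have "(\<lambda>k. 1 / (2 * of_nat k + 1) ^ Suc n + 1 / 2 ^ Suc n * (1 / of_nat (Suc k) ^ Suc n) :: complex) sums (s + 1 / 2 ^ Suc n * Z)"
    by (intro sums_add assms sums_mult Z)
  ultimately have eq: "Z = s + 1 / 2 ^ Suc n * Z" by (rule sums_unique2)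
  have "(2 ^ Suc n :: complex) \<noteq> 1"
  proof
    assume "(2 ^ Suc n :: complex) = 1"
    then have "norm (2 ^ Suc n :: complex) = 1" by (simp del: power_Suc)
    then have "(2::real) ^ Suc n = 1" by (simp add: norm_power del: power_Suc)
    then show False using one_less_power[of "2::real" "Suc n"] by simp
  qed
  then have "Z = 2 ^ Suc n / (2 ^ Suc n - 1) * s"
    using eq by (simp add: field_simps del: power_Suc)
  then show ?thesis using Z by simp
qed

lemma zeta_4: "(\<lambda>k. 1 / of_nat (Suc k) ^ 4) sums (of_real pi ^ 4 / 90 :: complex)"
  using zeta_odd_part[OF _ odd_zeta_sums, of 3] by (simp add: refl_polygamma_half fact_numeral)

lemma zeta_6: "(\<lambda>k. 1 / of_nat (Suc k) ^ 6) sums (of_real pi ^ 6 / 945 :: complex)"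
  using zeta_odd_part[OF _ odd_zeta_sums, of 5] by (simp add: refl_polygamma_half fact_numeral)

section \<open>Lattice sums and their modularity\<close>

definition eisenstein :: "nat \<Rightarrow> complex \<Rightarrow> complex" where
  "eisenstein k \<tau> = (\<Sum>\<^sub>\<infinity>(m, n)\<in>UNIV. 1 / (of_int m * \<tau> + of_int n) ^ k)"

lemma summable_on_inverse_square_int: "(\<lambda>n::int. 1 / (1 + (real_of_int n)\<^sup>2)) summable_on UNIV"
proof -
  have "summable (\<lambda>n. norm (1 / (1 + (real n)\<^sup>2)))"
  proof (rule summable_comparison_test')
    show "summable (\<lambda>n. inverse (real n ^ 2))" using inverse_power_summable[of 2] by simp
    show "norm (norm (1 / (1 + (real n)\<^sup>2))) \<le> inverse (real n ^ 2)" if "n \<ge> 1" for n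
    proof -
      have "1 / (1 + (real n)\<^sup>2) \<le> 1 / (real n)\<^sup>2" using that by (intro frac_le) auto
      then show ?thesis by (simp add: inverse_eq_divide)
    qed
  qed
  moreover from this have "summable (\<lambda>n. norm (1 / (1 + (real (Suc n))\<^sup>2)))"
    by (subst summable_Suc_iff)
  moreover have "(real_of_int (- int n - 1))\<^sup>2 = (real (Suc n))\<^sup>2" for n
    by (simp add: power2_eq_square algebra_simps)
  ultimately show ?thesis
    by (intro has_sum_imp_summable[OF has_sum_int_split]) (simp_all only: of_int_of_nat_eq)
qed

lemma summable_on_prod:
  fixes f :: "'a \<Rightarrow> real" and g :: "'b \<Rightarrow> real"
  assumes "f summable_on A" "g summable_on B" "\<And>x. x \<in> A \<Longrightarrow> f x \<ge> 0" "\<And>x. x \<in> B \<Longrightarrow> g x \<ge> 0"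
  shows "(\<lambda>(x, y). f x * g y) summable_on A \<times> B"
proof (rule summable_on_SigmaI)
  show "((\<lambda>y. case (x, y) of (x, y) \<Rightarrow> f x * g y) has_sum (f x * infsum g B)) B" if "x \<in> A" for x
    using has_sum_cmult_right[OF has_sum_infsum[OF assms(2)], of "f x"] by simp
  show "(\<lambda>x. f x * infsum g B) summable_on A"
    by (intro summable_on_cmult_left assms)
qed (use assms in auto)

lemma lattice_norm_bound:
  assumes "\<tau> \<in> \<H>"
  obtains K where "K \<ge> 1" "\<And>m n :: int. (real_of_int m)\<^sup>2 + (real_of_int n)\<^sup>2 \<le> K * (norm (of_int m * \<tau> + of_int n))\<^sup>2"
proof
  define x y where "x = Re \<tau>" "y = Im \<tau>"
  have y: "y > 0" using assms by (simp add: x_y_def upper_half_plane_def)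
  \<comment> \<open>Chosen for the identity a^2 + b^2 + (2 a x + b)^2 = 2 (a x + b)^2 + (1 + 2 x^2)
    a^2, whose right side is at most \<open>?K\<close> times |m \<tau> + n|^2.\<close>
  let ?K = "2 + (1 + 2 * x\<^sup>2) / y\<^sup>2"
  show "?K \<ge> 1" by (simp add: add_nonneg_nonneg add_increasing)
  fix m n :: int
  define a b where "a = real_of_int m" "b = real_of_int n"
  have "(norm (of_int m * \<tau> + of_int n))\<^sup>2 = (a * x + b)\<^sup>2 + a\<^sup>2 * y\<^sup>2"
    by (simp add: cmod_power2 a_b_def x_y_def power_mult_distrib)
  moreover have "a\<^sup>2 + b\<^sup>2 \<le> ?K * ((a * x + b)\<^sup>2 + a\<^sup>2 * y\<^sup>2)"
  proof -
    have "?K * ((a * x + b)\<^sup>2 + a\<^sup>2 * y\<^sup>2) = 2 * (a * x + b)\<^sup>2 + 2 * (a\<^sup>2 * y\<^sup>2) + (1 + 2 * x\<^sup>2) / y\<^sup>2 * (a * x + b)\<^sup>2 + (1 + 2 * x\<^sup>2) * a\<^sup>2"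
      using y by (simp add: field_simps)
    also have "\<dots> \<ge> 2 * (a * x + b)\<^sup>2 + (1 + 2 * x\<^sup>2) * a\<^sup>2" by simp
    also have "2 * (a * x + b)\<^sup>2 + (1 + 2 * x\<^sup>2) * a\<^sup>2 = a\<^sup>2 + b\<^sup>2 + (2 * a * x + b)\<^sup>2"
      by (simp add: power2_eq_square algebra_simps)
    finally show ?thesis using zero_le_power2[of "2 * a * x + b"] by linarith
  qed
  ultimately show "(real_of_int m)\<^sup>2 + (real_of_int n)\<^sup>2 \<le> ?K * (norm (of_int m * \<tau> + of_int n))\<^sup>2"
    by (simp add: a_b_def)
qed

text \<open>Away from the origin (1 + m^2)(1 + n^2) is bounded by a multiple of |m \<tau> + n|^4.
  The terms are therefore dominated by products of 1/(1 + m^2) and 1/(1 + n^2), and the double sum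
  reduces to single sums.\<close>

lemma eisenstein_abs_summable:
  assumes "\<tau> \<in> \<H>" "p \<ge> 2"
  shows "(\<lambda>(m :: int, n :: int). norm (1 / (of_int m * \<tau> + of_int n) ^ (2 * p))) summable_on UNIV"
proof -
  obtain K where K: "K \<ge> 1" "\<And>m n :: int. (real_of_int m)\<^sup>2 + (real_of_int n)\<^sup>2 \<le> K * (norm (of_int m * \<tau> + of_int n))\<^sup>2"
    using lattice_norm_bound[OF assms(1)] by blast
  have "(\<lambda>(m, n). 1 / (1 + (real_of_int m)\<^sup>2) * (1 / (1 + (real_of_int n)\<^sup>2))) summable_on UNIV \<times> UNIV"
    by (intro summable_on_prod summable_on_inverse_square_int) (auto simp: add_nonneg_nonneg)
  then have s: "(\<lambda>mn. 4 * K ^ p * (case mn of (m, n) \<Rightarrow> 1 / (1 + (real_of_int m)\<^sup>2) * (1 / (1 + (real_of_int n)\<^sup>2)))) summable_on UNIV"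
    by (intro summable_on_cmult_right) simp
  show ?thesis
  proof (rule summable_on_comparison_test[OF s])
    fix mn :: "int \<times> int"
    obtain m n where mn: "mn = (m, n)" by (cases mn)
    define a b r where "a = (real_of_int m)\<^sup>2" "b = (real_of_int n)\<^sup>2" "r = (norm (of_int m * \<tau> + of_int n))\<^sup>2"
    have ab: "a \<ge> 0" "b \<ge> 0" "a + b \<le> K * r" using K(2) by (auto simp: a_b_r_def)
    have "norm (1 / (of_int m * \<tau> + of_int n) ^ (2 * p)) = 1 / r ^ p"
      by (simp add: a_b_r_def norm_divide norm_power power_mult)
    also have "\<dots> \<le> 4 * K ^ p * (1 / (1 + a) * (1 / (1 + b)))"
    proof (cases "m = 0 \<and> n = 0")
      \<comment> \<open>The origin is not excluded from the lattice sum: its term is 1/0 =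
        0.\<close>
      case True
      then have "r = 0" by (simp add: a_b_r_def)
      then show ?thesis using K(1) assms(2) ab by (simp add: power_0_left)
    next
      case False
      have "(real_of_int z)\<^sup>2 \<ge> 1" if "z \<noteq> 0" for z
      proof -
        have "1 \<le> \<bar>z\<bar>" using that by simp
        then have "1 \<le> \<bar>z\<bar>\<^sup>2" by (rule one_le_power)
        then have "1 \<le> z\<^sup>2" by simp
        then show ?thesis by (metis of_int_1_le_iff of_int_power)
      qed
      then have ge1: "a + b \<ge> 1" using False ab by (fastforce simp: a_b_r_def intro: add_increasing add_increasing2)
      then have Kr: "K * r \<ge> 1" using ab by linarith
      then have r: "r > 0" using K(1) by (metis less_eq_real_def mult_eq_0_iff not_one_le_zero zero_le_power2 a_b_r_def(3))
      have "(1 + a) * (1 + b) \<le> (1 + (a + b))\<^sup>2"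
        using ab(1,2) by (simp add: power2_eq_square algebra_simps add_nonneg_nonneg)
      also have "\<dots> \<le> (2 * (K * r))\<^sup>2" using ab ge1 by (intro power_mono) auto
      also have "\<dots> = 4 * (K * r) ^ 2" by (simp add: power2_eq_square)
      also have "\<dots> \<le> 4 * (K * r) ^ p" using Kr assms(2) by (intro mult_left_mono power_increasing) auto
      finally have "(1 + a) * (1 + b) \<le> 4 * K ^ p * r ^ p" by (simp add: power_mult_distrib)
      moreover have "(1 + a) * (1 + b) > 0" using ab by (simp add: add_pos_nonneg)
      ultimately show ?thesis using r by (simp add: divide_simps mult_ac)
    qed
    finally show "(case mn of (m, n) \<Rightarrow> norm (1 / (of_int m * \<tau> + of_int n) ^ (2 * p))) \<le>
       4 * K ^ p * (case mn of (m, n) \<Rightarrow> 1 / (1 + (real_of_int m)\<^sup>2) * (1 / (1 + (real_of_int n)\<^sup>2)))"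
      by (simp add: mn a_b_r_def)
  qed auto
qed

lemma eisenstein_has_sum:
  assumes "\<tau> \<in> \<H>" "p \<ge> 2"
  shows "((\<lambda>(m :: int, n :: int). 1 / (of_int m * \<tau> + of_int n) ^ (2 * p)) has_sum eisenstein (2 * p) \<tau>) UNIV"
  unfolding eisenstein_def
  using eisenstein_abs_summable[OF assms]
  by - (rule has_sum_infsum, rule abs_summable_summable, simp add: case_prod_unfold)

lemma moebius_upper_half_plane:
  fixes a b c d :: int
  assumes "\<tau> \<in> \<H>" "a * d - b * c = 1"
  shows "(of_int a * \<tau> + of_int b) / (of_int c * \<tau> + of_int d) \<in> \<H>" "of_int c * \<tau> + of_int d \<noteq> 0"
proof -
  show nz: "of_int c * \<tau> + of_int d \<noteq> 0"
  proof
    assume *: "of_int c * \<tau> + of_int d = 0"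
    have "Im (of_int c * \<tau> + of_int d) = of_int c * Im \<tau>" by simp
    then have "c = 0" using assms(1) unfolding * by (simp add: upper_half_plane_def)
    moreover have "d = 0" using * \<open>c = 0\<close> by simp
    ultimately show False using assms(2) by simp
  qed
  have "Im ((of_int a * \<tau> + of_int b) / (of_int c * \<tau> + of_int d)) =
     of_int (a * d - b * c) * Im \<tau> / (norm (of_int c * \<tau> + of_int d))\<^sup>2"
    unfolding Im_divide cmod_power2 by (simp add: algebra_simps)
  then show "(of_int a * \<tau> + of_int b) / (of_int c * \<tau> + of_int d) \<in> \<H>"
    using nz assms by (simp add: upper_half_plane_def)
qed

text \<open>A matrix of determinant 1 permutes the index pairs, and every term picks up the same
  factor (c \<tau> + d)^k.\<close>

lemma eisenstein_modular:
  fixes a b c d :: int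
  assumes "\<tau> \<in> \<H>" "a * d - b * c = 1"
  shows "eisenstein k ((of_int a * \<tau> + of_int b) / (of_int c * \<tau> + of_int d)) = (of_int c * \<tau> + of_int d) ^ k * eisenstein k \<tau>"
proof -
  let ?j = "of_int c * \<tau> + of_int d :: complex"
  have nz: "?j \<noteq> 0" using moebius_upper_half_plane[OF assms] by simp
  let ?f = "\<lambda>(m, n). (m * a + n * c, m * b + n * d)" and ?g = "\<lambda>(m, n). (m * d - n * c, n * a - m * b)"
  let ?t = "\<lambda>(m :: int, n :: int). 1 / (of_int m * \<tau> + of_int n) ^ k"
  have "a * d = 1 + b * c" using assms by simp
  then have ad: "x * (a * d) = x + x * (b * c)" for x
    by (simp add: distrib_left)
  have bij: "bij_betw ?f UNIV UNIV"
    by (rule bij_betw_byWitness[of _ ?g]) (auto simp: algebra_simps ad)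
  have "eisenstein k ((of_int a * \<tau> + of_int b) / ?j) = (\<Sum>\<^sub>\<infinity>mn\<in>UNIV. ?j ^ k * ?t (?f mn))"
    unfolding eisenstein_def
  proof (rule infsum_cong)
    fix mn :: "int \<times> int"
    obtain m n where mn: "mn = (m, n)" by (cases mn)
    have "of_int m * ((of_int a * \<tau> + of_int b) / ?j) + of_int n = (of_int (m * a + n * c) * \<tau> + of_int (m * b + n * d)) / ?j"
      using nz by (simp add: field_simps)
    then show "(case mn of (m, n) \<Rightarrow> 1 / (of_int m * ((of_int a * \<tau> + of_int b) / ?j) + of_int n) ^ k) = ?j ^ k * ?t (?f mn)"
      by (simp add: mn power_divide)
  qed
  also have "\<dots> = ?j ^ k * (\<Sum>\<^sub>\<infinity>mn\<in>UNIV. ?t (?f mn))"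
    by (rule infsum_cmult_right')
  also have "(\<Sum>\<^sub>\<infinity>mn\<in>UNIV. ?t (?f mn)) = eisenstein k \<tau>"
    unfolding eisenstein_def by (rule infsum_reindex_bij_betw[OF bij])
  finally show ?thesis .
qed

section \<open>Fourier expansions of the Eisenstein series\<close>

lemma lambert_has_sum:
  fixes q :: complex
  assumes "norm q < 1" "j \<ge> 1"
  obtains L where "((\<lambda>m. power_series_q j (q ^ m)) has_sum L) {1..}"
    "((\<lambda>n. of_nat (divisor_sum j n) * q ^ n) has_sum L) {1..}"
proof -
  \<comment> \<open>The double series behind both sums: summed over d first it gives the first one,
    grouped by n = m d the second.\<close>
  define f where "f = (\<lambda>(m :: nat, d :: nat). of_nat d ^ j * q ^ (m * d))"
  have s: "summable (\<lambda>d. norm (of_nat d ^ j * z ^ d))" if "norm z < 1" for z :: complex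
    using norm_summable_fps[of z "Abs_fps (\<lambda>n. of_nat n ^ j)"] that
    by (simp add: fps_conv_radius_def conv_radius_power)
  have "(\<lambda>x. norm (f x)) summable_on {1..} \<times> {1..}"
  proof (rule summable_on_comparison_test)
    have "summable (\<lambda>d. norm (of_nat d ^ j * q ^ d))" using s assms(1) by blast
    then have "(\<lambda>d. norm (of_nat d ^ j * q ^ d)) summable_on {1..}"
      by (intro norm_summable_imp_summable_on[THEN summable_on_subset_banach]) auto
    moreover have "(\<lambda>m. norm q ^ (m - 1)) summable_on {1..}"
    proof (rule summable_on_subset_banach[OF norm_summable_imp_summable_on])
      have "summable (\<lambda>m. norm q ^ (Suc m - 1))" using assms(1) by (simp add: summable_geometric)
      then have "summable (\<lambda>m. norm q ^ (m - 1))" using summable_Suc_iff by blast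
      then show "summable (\<lambda>m. norm (norm q ^ (m - 1)))" by simp
    qed auto
    ultimately show "(\<lambda>(m, d). norm q ^ (m - 1) * norm (of_nat d ^ j * q ^ d)) summable_on {1..} \<times> {1..}"
      by (intro summable_on_prod) auto
    show "norm (f x) \<le> (case x of (m, d) \<Rightarrow> norm q ^ (m - 1) * norm (of_nat d ^ j * q ^ d))"
      if "x \<in> {1..} \<times> {1..}" for x
    proof -
      obtain m d where x: "x = (Suc m, Suc d)"
      proof -
        obtain a b where "x = (a, b)" "a > 0" "b > 0" using \<open>x \<in> _\<close> by (cases x) auto
        then show ?thesis using that[of "a - 1" "b - 1"] by simp
      qed
      \<comment> \<open>(m + 1)(d + 1) >= m + (d + 1) separates the two variables in the
        majorant.\<close>
      have "norm q ^ (Suc m * Suc d) \<le> norm q ^ (m + Suc d)"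
        using assms(1) by (intro power_decreasing) auto
      then have "real (Suc d) ^ j * norm q ^ (Suc m * Suc d) \<le> real (Suc d) ^ j * norm q ^ (m + Suc d)"
        by (intro mult_left_mono) auto
      also have "\<dots> = norm q ^ m * (real (Suc d) ^ j * norm q ^ Suc d)"
        by (simp only: power_add mult.left_commute)
      finally show ?thesis
        by (simp only: x f_def split_conv norm_mult norm_power norm_of_nat diff_Suc_1)
    qed
  qed auto
  then have "f summable_on {1..} \<times> {1..}" by (rule abs_summable_summable)
  then obtain L where L: "(f has_sum L) ({1..} \<times> {1..})" unfolding summable_on_def by blast
  have "((\<lambda>m. power_series_q j (q ^ m)) has_sum L) {1..}"
  proof (rule has_sum_SigmaD[OF L])
    fix m :: nat assume "m \<in> {1..}"
    then have qm: "norm (q ^ m) < 1" using assms(1) by (simp add: norm_power power_less_one_iff)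
    have "((\<lambda>d. of_nat d ^ j * (q ^ m) ^ d) has_sum power_series_q j (q ^ m)) UNIV"
      using norm_summable_imp_has_sum[OF s[OF qm] power_series_q_sums[OF qm]] .
    then have "((\<lambda>d. of_nat d ^ j * (q ^ m) ^ d) has_sum power_series_q j (q ^ m)) {1..}"
      by (rule has_sum_cong_neutral[THEN iffD1, rotated -1]) (use assms(2) in auto)
    then show "((\<lambda>d. f (m, d)) has_sum power_series_q j (q ^ m)) {1..}"
      by (simp add: f_def power_mult)
  qed
  moreover have "((\<lambda>(n, d). of_nat d ^ j * q ^ n) has_sum L) (SIGMA n:{1..}. {d. d dvd n})"
    using L
    by (rule has_sum_reindex_bij_witness[of _ "\<lambda>(n, d). (n div d, d)" "\<lambda>(m, d). (m * d, d)", THEN iffD1, rotated -1])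
      (auto simp: f_def dvd_div_eq_0_iff Suc_le_eq intro: Nat.gr0I)
  then have "((\<lambda>n. \<Sum>d | d dvd n. of_nat d ^ j * q ^ n) has_sum L) {1..}"
    by (rule has_sum_SigmaD) (auto intro!: has_sum_finiteI)
  then have "((\<lambda>n. of_nat (divisor_sum j n) * q ^ n) has_sum L) {1..}"
    by (simp add: divisor_sum_def sum_distrib_right)
  ultimately show ?thesis using that by blast
qed

text \<open>The lattice is summed by rows: the row m = 0 gives twice the zeta value, every other row
  is a Lipschitz sum, and the rows m and - m agree because the exponent is even. The resulting
  Lambert series is regrouped by divisors.\<close>

lemma eisenstein_q_expansion:
  assumes "\<tau> \<in> \<H>" "p \<ge> 2" "(\<lambda>k. 1 / of_nat (Suc k) ^ (2 * p)) sums Z"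
  shows "eisenstein (2 * p) \<tau> = 2 * Z + 2 * ((2 * of_real pi * \<i>) ^ (2 * p) / fact (2 * p - 1)) *
    (\<Sum>n. of_nat (divisor_sum (2 * p - 1) (Suc n)) * nome \<tau> ^ Suc n)"
proof -
  define j where "j = 2 * p - 1"
  have j: "odd j" "j \<ge> 1" "2 * p = Suc j" using assms(2) by (auto simp: j_def)
  define C :: complex where "C = (2 * of_real pi * \<i>) ^ Suc j / fact j"
  define q where "q = nome \<tau>"
  have q: "norm q < 1" using norm_nome_less_1[OF assms(1)] by (simp add: q_def)
  obtain L where L: "((\<lambda>m. power_series_q j (q ^ m)) has_sum L) {1..}"
    "((\<lambda>n. of_nat (divisor_sum j n) * q ^ n) has_sum L) {1..}"
    using lambert_has_sum[OF q j(2)] .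
  define R where "R = (\<lambda>m::int. if m = 0 then 2 * Z else C * power_series_q j (q ^ nat \<bar>m\<bar>))"
  have pos: "((\<lambda>n::int. 1 / (of_nat m * \<tau> + of_int n) ^ Suc j) has_sum C * power_series_q j (q ^ m)) UNIV" if "m > 0" for m
  proof -
    have "of_nat m * \<tau> \<in> \<H>" using assms(1) that by (simp add: upper_half_plane_def)
    moreover have "nome (of_nat m * \<tau>) = q ^ m"
      by (simp add: nome_def q_def exp_of_nat_mult[symmetric] mult_ac)
    ultimately show ?thesis using lipschitz_formula[OF _ j(1)] by (metis C_def)
  qed
  have row: "((\<lambda>n::int. 1 / (of_int m * \<tau> + of_int n) ^ Suc j) has_sum R m) UNIV" for m :: int
  proof -
    consider "m = 0" | "m > 0" | "m < 0" by linarith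
    then show ?thesis
    proof cases
      case 1
      have "summable (\<lambda>k. norm (inverse ((0 + of_nat k :: complex) ^ Suc j)))"
        "summable (\<lambda>k. norm (inverse ((1 + of_nat k :: complex) ^ Suc j)))"
        by (rule summable_norm_inverse_shift; use j(2) in simp)+
      moreover have e: "(of_int (- int k - 1) :: complex) ^ Suc j = (1 + of_nat k) ^ Suc j" for k
      proof -
        have "(of_int (- int k - 1) :: complex) = - (1 + of_nat k)" by simp
        then show ?thesis using power_minus_even[of "Suc j" "1 + of_nat k :: complex"] j(1) by (metis even_Suc)
      qed
      ultimately have "((\<lambda>n::int. inverse (of_int n ^ Suc j :: complex)) has_sum
         ((\<Sum>n. inverse (of_int (int n) ^ Suc j)) + (\<Sum>n. inverse (of_int (- int n - 1) ^ Suc j)))) UNIV"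
        by - (rule has_sum_int_split; simp only: e of_int_of_nat_eq add_0)
      moreover have "(\<Sum>n. inverse (of_int (- int n - 1) ^ Suc j)) = Z"
        using sums_unique[OF assms(3)] unfolding e j(3) by (simp only: inverse_eq_divide of_nat_Suc)
      moreover have "(\<Sum>n. inverse (of_int (int n) ^ Suc j)) = Z"
      proof -
        have "(\<lambda>n. inverse (of_nat (Suc n) ^ Suc j :: complex)) sums Z"
          using assms(3) unfolding j(3) by (simp only: inverse_eq_divide)
        \<comment> \<open>The term at 0 is 1/0 = 0, so prepending it leaves the sum
          unchanged.\<close>
        then have "(\<lambda>n. inverse (of_nat n ^ Suc j :: complex)) sums (Z + inverse (of_nat 0 ^ Suc j))"
          by (rule sums_Suc[where f = "\<lambda>n. inverse (of_nat n ^ Suc j)"])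
        then show ?thesis by (simp add: sums_iff)
      qed
      ultimately show ?thesis using 1 by (simp add: R_def inverse_eq_divide del: power_Suc)
    next
      case 2
      then show ?thesis using pos[of "nat m"] by (simp add: R_def del: power_Suc)
    next
      case 3
      have "((\<lambda>n::int. 1 / (of_nat (nat (- m)) * \<tau> + of_int n) ^ Suc j) has_sum R m) UNIV"
        using 3 pos[of "nat (- m)"] by (simp add: R_def del: power_Suc)
      then have "((\<lambda>n::int. 1 / (of_nat (nat (- m)) * \<tau> + of_int (- n)) ^ Suc j) has_sum R m) UNIV"
        by (rule has_sum_reindex_bij_betw[of uminus UNIV UNIV, THEN iffD2, rotated]) (simp add: bij_uminus)
      moreover have "(of_nat (nat (- m)) * \<tau> + of_int (- n)) ^ Suc j = (of_int m * \<tau> + of_int n) ^ Suc j" for n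
      proof -
        have "of_nat (nat (- m)) * \<tau> + of_int (- n) = - (of_int m * \<tau> + of_int n)"
          using 3 by simp
        then show ?thesis using power_minus_even[of "Suc j" "of_int m * \<tau> + of_int n"] j(1) by (metis even_Suc)
      qed
      ultimately show ?thesis by (simp only:)
    qed
  qed
  have "((\<lambda>(m :: int, n :: int). 1 / (of_int m * \<tau> + of_int n) ^ Suc j) has_sum eisenstein (Suc j) \<tau>) (UNIV \<times> UNIV)"
    using eisenstein_has_sum[OF assms(1,2)] unfolding j(3) by simp
  then have RG: "(R has_sum eisenstein (Suc j) \<tau>) UNIV"
    by (rule has_sum_SigmaD) (use row in auto)
  have CL: "((\<lambda>m. C * power_series_q j (q ^ m)) has_sum C * L) {1..}"
    by (rule has_sum_cmult_right[OF L(1)])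
  have "((\<lambda>m. R (int m)) has_sum C * L) {1..}"
    by (rule has_sum_cong[THEN iffD1, OF _ CL]) (auto simp: R_def)
  then have "(R has_sum C * L) (int ` {1..})"
    by (subst has_sum_reindex) (auto simp: o_def)
  moreover have "((\<lambda>m. R (- int m)) has_sum C * L) {1..}"
    by (rule has_sum_cong[THEN iffD1, OF _ CL]) (auto simp: R_def)
  then have "(R has_sum C * L) ((\<lambda>n. - int n) ` {1..})"
    by (subst has_sum_reindex) (auto simp: o_def inj_on_def)
  ultimately have "(R has_sum (C * L + C * L)) (int ` {1..} \<union> (\<lambda>n. - int n) ` {1..})"
    by (rule has_sum_Un_disjoint) auto
  moreover have "(R has_sum 2 * Z) {0}"
    by (intro has_sum_finiteI) (auto simp: R_def)
  ultimately have "(R has_sum (C * L + C * L + 2 * Z)) (int ` {1..} \<union> (\<lambda>n. - int n) ` {1..} \<union> {0})"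
    by (rule has_sum_Un_disjoint) auto
  moreover have "int ` {1..} \<union> (\<lambda>n. - int n) ` {1..} \<union> {0} = UNIV"
  proof -
    have "x \<in> int ` {1..} \<or> x \<in> (\<lambda>n. - int n) ` {1..} \<or> x = 0" for x
      by (cases x rule: linorder_cases[of 0]) (auto intro: image_eqI[of _ _ "nat x"] image_eqI[of _ _ "nat (- x)"])
    then show ?thesis by auto
  qed
  ultimately have "eisenstein (Suc j) \<tau> = C * L + C * L + 2 * Z"
    using RG has_sum_unique by metis
  moreover have "((\<lambda>n. of_nat (divisor_sum j (Suc n)) * q ^ Suc n) has_sum L) UNIV"
  proof -
    have "range Suc = {1..}" by (auto simp: image_iff Suc_le_eq gr0_conv_Suc)
    then show ?thesis
      using L(2) has_sum_reindex[of Suc UNIV "\<lambda>n. of_nat (divisor_sum j n) * q ^ n" L]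
      unfolding o_def by (metis inj_Suc)
  qed
  then have "(\<Sum>n. of_nat (divisor_sum j (Suc n)) * q ^ Suc n) = L"
    using has_sum_imp_sums sums_unique by metis
  ultimately show ?thesis
    unfolding j(3) by (simp add: j_def[symmetric] C_def q_def[symmetric] algebra_simps)
qed

text \<open>The constant term 2 zeta(4) = pi^4/45 of the lattice sum fixes the factor, and the ratio
  of 2 (2 pi i)^4 / 3! to it is the 240 of the definition. In weight 6 the same computation produces
  - 504.\<close>

lemma form_a_eisenstein:
  assumes "\<tau> \<in> \<H>"
  shows "form_a \<tau> = - (15 / of_real pi ^ 4) * eisenstein 4 \<tau>"
proof -
  let ?S = "\<Sum>n. of_nat (divisor_sum 3 (Suc n)) * nome \<tau> ^ Suc n"
  have "eisenstein 4 \<tau> = 2 * (of_real pi ^ 4 / 90) + 2 * ((2 * of_real pi * \<i>) ^ 4 / 6) * ?S"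
    using eisenstein_q_expansion[OF assms, of 2] zeta_4 by (simp add: fact_numeral)
  moreover have "(2 * of_real pi * \<i>) ^ 4 = 16 * of_real pi ^ 4"
    by (simp add: power_mult_distrib)
  ultimately show ?thesis
    unfolding form_a_def by (simp add: field_simps)
qed

lemma form_b_eisenstein:
  assumes "\<tau> \<in> \<H>"
  shows "form_b \<tau> = 35 / of_real pi ^ 6 * eisenstein 6 \<tau>"
proof -
  let ?S = "\<Sum>n. of_nat (divisor_sum 5 (Suc n)) * nome \<tau> ^ Suc n"
  have "eisenstein 6 \<tau> = 2 * (of_real pi ^ 6 / 945) + 2 * ((2 * of_real pi * \<i>) ^ 6 / 120) * ?S"
    using eisenstein_q_expansion[OF assms, of 3] zeta_6 by (simp add: fact_numeral)
  moreover have "(2 * of_real pi * \<i>) ^ 6 = - 64 * of_real pi ^ 6"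
    by (simp add: power_mult_distrib)
  ultimately show ?thesis
    unfolding form_b_def by (simp add: field_simps)
qed

lemma form_modular:
  fixes a b c d :: int
  assumes "\<tau> \<in> \<H>" "a * d - b * c = 1"
  shows "form_a ((of_int a * \<tau> + of_int b) / (of_int c * \<tau> + of_int d)) = (of_int c * \<tau> + of_int d) ^ 4 * form_a \<tau>"
    "form_b ((of_int a * \<tau> + of_int b) / (of_int c * \<tau> + of_int d)) = (of_int c * \<tau> + of_int d) ^ 6 * form_b \<tau>"
  using moebius_upper_half_plane[OF assms] assms
  by (simp_all add: form_a_eisenstein form_b_eisenstein eisenstein_modular)

section \<open>Modular forms for the full modular group\<close>

lemma nome_surj:
  assumes "q \<noteq> 0" "norm q < 1"
  obtains \<tau> where "\<tau> \<in> \<H>" "nome \<tau> = q"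
proof
  let ?t = "Ln q / (2 * of_real pi * \<i>)"
  show "nome ?t = q" using assms(1) by (simp add: nome_def)
  then have "norm (nome ?t) < 1" using assms(2) by simp
  then show "?t \<in> \<H>" by (simp add: norm_nome upper_half_plane_def mult_less_0_iff zero_less_mult_iff)
qed

lemma nome_nonzero [simp]: "nome \<tau> \<noteq> 0"
  by (simp add: nome_def)

lemma nome_periodic: "nome (\<tau> + of_int n) = nome \<tau>"
proof -
  have "nome (\<tau> + of_int n) = nome \<tau> * exp (of_int n * (2 * of_real pi * \<i>))"
    by (simp add: nome_def exp_add[symmetric] algebra_simps)
  also have "exp (of_int n * (2 * of_real pi * \<i>)) = 1"
    using exp_integer_2pi[of "of_int n"] by (simp add: mult_ac)
  finally show ?thesis by simp
qed

definition q_expansion :: "(complex \<Rightarrow> complex) \<Rightarrow> complex fps \<Rightarrow> bool" where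
  "q_expansion f F \<longleftrightarrow> fps_conv_radius F \<ge> 1 \<and> (\<forall>\<tau>\<in>\<H>. f \<tau> = eval_fps F (nome \<tau>))"

lemma q_expansionD:
  assumes "q_expansion f F"
  shows "fps_conv_radius F \<ge> 1" "\<tau> \<in> \<H> \<Longrightarrow> f \<tau> = eval_fps F (nome \<tau>)"
    "\<tau> \<in> \<H> \<Longrightarrow> (\<lambda>n. fps_nth F n * nome \<tau> ^ n) sums f \<tau>"
    "norm (q :: complex) < 1 \<Longrightarrow> ereal (norm q) < fps_conv_radius F"
proof -
  show 1: "fps_conv_radius F \<ge> 1"
    using assms by (simp add: q_expansion_def)
  have 2: "f \<tau> = eval_fps F (nome \<tau>)" if "\<tau> \<in> \<H>" for \<tau>
    using assms that by (simp add: q_expansion_def)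
  then show "\<tau> \<in> \<H> \<Longrightarrow> f \<tau> = eval_fps F (nome \<tau>)" .
  have 3: "ereal (norm q) < fps_conv_radius F" if "norm q < 1" for q :: complex
    using 1 that less_le_trans[of "ereal (norm q)" 1] by simp
  then show "norm q < 1 \<Longrightarrow> ereal (norm q) < fps_conv_radius F" .
  show "(\<lambda>n. fps_nth F n * nome \<tau> ^ n) sums f \<tau>" if "\<tau> \<in> \<H>"
    unfolding 2[OF that] by (intro sums_eval_fps 3 norm_nome_less_1 that)
qed

text \<open>Every real q in (0, 1) is a value of \<open>nome\<close>, so convergence on the upper
  half plane already forces radius of convergence at least 1.\<close>

lemma q_expansionI:
  assumes "\<And>\<tau>. \<tau> \<in> \<H> \<Longrightarrow> (\<lambda>n. fps_nth F n * nome \<tau> ^ n) sums f \<tau>"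
  shows "q_expansion f F"
proof -
  have "conv_radius (fps_nth F) \<ge> 1"
  proof (rule conv_radius_geI_ex)
    fix r :: real assume r: "0 < r" "ereal r < 1"
    then obtain \<tau> where "\<tau> \<in> \<H>" "nome \<tau> = of_real r"
      using nome_surj[of "of_real r"] by auto
    then show "\<exists>z. norm z = r \<and> summable (\<lambda>n. fps_nth F n * z ^ n)"
      using assms[of \<tau>] r by (intro exI[of _ "of_real r"]) (auto simp: sums_iff)
  qed
  then show ?thesis
    using assms by (auto simp: q_expansion_def fps_conv_radius_def eval_fps_def sums_iff)
qed

lemma q_expansion_cong: "q_expansion f F \<Longrightarrow> (\<And>\<tau>. \<tau> \<in> \<H> \<Longrightarrow> g \<tau> = f \<tau>) \<Longrightarrow> q_expansion g F"
  by (auto simp: q_expansion_def)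

lemma q_expansion_const: "q_expansion (\<lambda>\<tau>. c) (fps_const c)"
  by (auto simp: q_expansion_def)

lemma q_expansion_add:
  assumes "q_expansion f F" "q_expansion g G"
  shows "q_expansion (\<lambda>\<tau>. f \<tau> + g \<tau>) (F + G)"
  unfolding q_expansion_def
proof (intro conjI ballI)
  show "fps_conv_radius (F + G) \<ge> 1"
    using fps_conv_radius_add[of F G] q_expansionD(1)[OF assms(1)] q_expansionD(1)[OF assms(2)]
    by (meson min.boundedI order.trans)
  show "f \<tau> + g \<tau> = eval_fps (F + G) (nome \<tau>)" if "\<tau> \<in> \<H>" for \<tau>
    using that norm_nome_less_1[OF that] q_expansionD[OF assms(1)] q_expansionD[OF assms(2)]
    by (simp add: eval_fps_add)
qed

lemma q_expansion_mult:
  assumes "q_expansion f F" "q_expansion g G"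
  shows "q_expansion (\<lambda>\<tau>. f \<tau> * g \<tau>) (F * G)"
  unfolding q_expansion_def
proof (intro conjI ballI)
  show "fps_conv_radius (F * G) \<ge> 1"
    using fps_conv_radius_mult[of F G] q_expansionD(1)[OF assms(1)] q_expansionD(1)[OF assms(2)]
    by (meson min.boundedI order.trans)
  show "f \<tau> * g \<tau> = eval_fps (F * G) (nome \<tau>)" if "\<tau> \<in> \<H>" for \<tau>
    using that norm_nome_less_1[OF that] q_expansionD[OF assms(1)] q_expansionD[OF assms(2)]
    by (simp add: eval_fps_mult)
qed

lemma q_expansion_cmult: "q_expansion f F \<Longrightarrow> q_expansion (\<lambda>\<tau>. c * f \<tau>) (fps_const c * F)"
  using q_expansion_mult[OF q_expansion_const] .

lemma q_expansion_diff:
  assumes "q_expansion f F" "q_expansion g G"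
  shows "q_expansion (\<lambda>\<tau>. f \<tau> - g \<tau>) (F - G)"
proof -
  have "fps_const (- 1) * G = - G" by (simp add: fps_eq_iff)
  then show ?thesis
    using q_expansion_add[OF assms(1) q_expansion_cmult[OF assms(2), of "- 1"]] by simp
qed

lemma q_expansion_power: "q_expansion f F \<Longrightarrow> q_expansion (\<lambda>\<tau>. f \<tau> ^ n) (F ^ n)"
  by (induction n) (auto intro: q_expansion_mult simp: q_expansion_const[of 1, simplified])

lemma q_expansion_sum:
  "(\<And>i. i \<in> A \<Longrightarrow> q_expansion (f i) (F i)) \<Longrightarrow> q_expansion (\<lambda>\<tau>. \<Sum>i\<in>A. f i \<tau>) (\<Sum>i\<in>A. F i)"
  by (induction A rule: infinite_finite_induct)
    (auto intro: q_expansion_add simp: q_expansion_const[of 0, simplified])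

lemma q_expansion_holomorphic:
  assumes "h holomorphic_on ball 0 1"
  shows "q_expansion (\<lambda>\<tau>. h (nome \<tau>)) (Abs_fps (\<lambda>n. (deriv ^^ n) h 0 / fact n))"
proof (rule q_expansionI)
  fix \<tau> assume "\<tau> \<in> \<H>"
  then show "(\<lambda>n. fps_nth (Abs_fps (\<lambda>n. (deriv ^^ n) h 0 / fact n)) n * nome \<tau> ^ n) sums h (nome \<tau>)"
    using holomorphic_power_series[OF assms, of "nome \<tau>"] norm_nome_less_1[of \<tau>] by simp
qed

text \<open>The nome omits the value 0, so equality of the two series at 0 is obtained as a limit
  before the identity theorem for power series applies.\<close>

lemma q_expansion_unique:
  assumes "q_expansion f F" "q_expansion f G"
  shows "F = G"
proof -
  have D: "q_expansion (\<lambda>\<tau>. 0) (F - G)"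
    using q_expansion_diff[OF assms] by simp
  have z: "eval_fps (F - G) q = 0" if q: "q \<noteq> 0" "norm q < 1" for q
  proof -
    obtain \<tau> where "\<tau> \<in> \<H>" "nome \<tau> = q" using nome_surj[OF q] .
    then show ?thesis using q_expansionD(2)[OF D] by metis
  qed
  have "continuous_on (ball 0 1) (eval_fps (F - G))"
    by (rule continuous_on_subset[OF continuous_on_eval_fps]) (use q_expansionD(4)[OF D] in auto)
  then have "isCont (eval_fps (F - G)) 0"
    by (simp add: continuous_on_eq_continuous_at)
  then have "(eval_fps (F - G) \<longlongrightarrow> eval_fps (F - G) 0) (at 0)" by (simp add: isCont_def)
  moreover have "(eval_fps (F - G) \<longlongrightarrow> 0) (at 0)"
  proof (rule tendsto_eventually)
    have "\<forall>\<^sub>F q in at 0. q \<in> ball 0 1 - {0 :: complex}"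
      by (rule eventually_at_in_open) auto
    then show "\<forall>\<^sub>F q in at 0. eval_fps (F - G) q = 0"
      by eventually_elim (use z in auto)
  qed
  ultimately have "eval_fps (F - G) 0 = 0"
    by (rule tendsto_unique[rotated]) auto
  then have "\<forall>q\<in>ball 0 1. eval_fps (F - G) q = eval_fps 0 q"
    using z by (metis eval_fps_0 mem_ball_0)
  then have "F - G = 0"
  proof (intro eval_fps_eqD)
    show "\<forall>\<^sub>F q in nhds 0. eval_fps (F - G) q = eval_fps 0 q" if "\<forall>q\<in>ball 0 1. eval_fps (F - G) q = eval_fps 0 q"
      using eventually_nhds_in_open[of "ball 0 1" "0::complex"] by (rule eventually_mono[OF _]) (use that in auto)
  qed (use q_expansionD(1)[OF D] in \<open>auto intro: less_le_trans[of 0 1]\<close>)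
  then show ?thesis by simp
qed

definition q_deriv :: "complex fps \<Rightarrow> complex fps" where
  "q_deriv F = fps_const (2 * of_real pi * \<i>) * (fps_X * fps_deriv F)"

lemma q_expansion_derivative:
  assumes "q_expansion f F"
  shows "\<tau> \<in> \<H> \<Longrightarrow> (f has_field_derivative eval_fps (q_deriv F) (nome \<tau>)) (at \<tau>)"
    and "q_expansion (\<lambda>\<tau>. eval_fps (q_deriv F) (nome \<tau>)) (q_deriv F)"
proof -
  have r: "fps_conv_radius (fps_deriv F) \<ge> 1" "fps_conv_radius (fps_X * fps_deriv F) \<ge> 1" "fps_conv_radius (q_deriv F) \<ge> 1"
  proof -
    show 1: "fps_conv_radius (fps_deriv F) \<ge> 1"
      using fps_conv_radius_deriv[of F] q_expansionD(1)[OF assms] by (rule order.trans[rotated])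
    show 2: "fps_conv_radius (fps_X * fps_deriv F) \<ge> 1"
      using 1 fps_conv_radius_mult[of fps_X "fps_deriv F"] by (simp add: order.trans)
    show "fps_conv_radius (q_deriv F) \<ge> 1"
      unfolding q_deriv_def by (subst fps_conv_radius_cmult_left) (use 2 in auto)
  qed
  then show "q_expansion (\<lambda>\<tau>. eval_fps (q_deriv F) (nome \<tau>)) (q_deriv F)"
    by (simp add: q_expansion_def)
  assume \<tau>: "\<tau> \<in> \<H>"
  have q: "norm (nome \<tau>) < 1" using norm_nome_less_1[OF \<tau>] .
  have lt: "ereal (norm (nome \<tau>)) < R" if "R \<ge> 1" for R
    using q that less_le_trans[of "ereal (norm (nome \<tau>))" 1] by simp
  have "((\<lambda>z. eval_fps F (nome z)) has_field_derivative eval_fps (fps_deriv F) (nome \<tau>) * (2 * of_real pi * \<i> * nome \<tau>)) (at \<tau>)"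
    by (rule DERIV_chain2[OF has_field_derivative_eval_fps nome_derivative])
      (use q_expansionD(4)[OF assms q] in simp)
  moreover have "eval_fps (q_deriv F) (nome \<tau>) = eval_fps (fps_deriv F) (nome \<tau>) * (2 * of_real pi * \<i> * nome \<tau>)"
  proof -
    have "eval_fps (q_deriv F) (nome \<tau>) = 2 * of_real pi * \<i> * eval_fps (fps_X * fps_deriv F) (nome \<tau>)"
      unfolding q_deriv_def by (subst eval_fps_mult) (use r lt in auto)
    also have "eval_fps (fps_X * fps_deriv F) (nome \<tau>) = nome \<tau> * eval_fps (fps_deriv F) (nome \<tau>)"
      by (subst eval_fps_mult) (use r lt in auto)
    finally show ?thesis by (simp add: mult_ac)
  qed
  ultimately have "((\<lambda>z. eval_fps F (nome z)) has_field_derivative eval_fps (q_deriv F) (nome \<tau>)) (at \<tau>)"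
    by simp
  then show "(f has_field_derivative eval_fps (q_deriv F) (nome \<tau>)) (at \<tau>)"
    by (rule has_field_derivative_transform_within_open[OF _ open_upper_half_plane \<tau>])
      (use q_expansionD(2)[OF assms] in auto)
qed

text \<open>Periodicity, holomorphy and boundedness at the cusp are all implied by the \<open>q\<close>-expansion.\<close>

definition modular_form :: "nat \<Rightarrow> (complex \<Rightarrow> complex) \<Rightarrow> bool" where
  "modular_form k f \<longleftrightarrow> (\<exists>F. q_expansion f F) \<and> (\<forall>\<tau>\<in>\<H>. f (- 1 / \<tau>) = \<tau> ^ k * f \<tau>)"

lemma modular_formD:
  assumes "modular_form k f"
  shows "\<tau> \<in> \<H> \<Longrightarrow> f (- 1 / \<tau>) = \<tau> ^ k * f \<tau>" "\<tau> \<in> \<H> \<Longrightarrow> f (\<tau> + of_int n) = f \<tau>"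
proof -
  show "f (- 1 / \<tau>) = \<tau> ^ k * f \<tau>" if "\<tau> \<in> \<H>" using assms that by (auto simp: modular_form_def)
  assume "\<tau> \<in> \<H>"
  moreover from this have "\<tau> + of_int n \<in> \<H>" by (simp add: upper_half_plane_def)
  ultimately show "f (\<tau> + of_int n) = f \<tau>"
    using assms unfolding modular_form_def by (metis q_expansionD(2) nome_periodic)
qed

lemma upper_half_plane_S: "\<tau> \<in> \<H> \<Longrightarrow> - 1 / \<tau> \<in> \<H>" "\<tau> \<in> \<H> \<Longrightarrow> \<tau> \<noteq> 0" "Im (- 1 / \<tau>) = Im \<tau> / (norm \<tau>)\<^sup>2"
  using moebius_upper_half_plane[of \<tau> 0 0 "-1" 1]
  by (auto simp: upper_half_plane_def Im_divide cmod_power2)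

lemma modular_form_mult: "modular_form k f \<Longrightarrow> modular_form l g \<Longrightarrow> modular_form (k + l) (\<lambda>\<tau>. f \<tau> * g \<tau>)"
  unfolding modular_form_def by (auto simp: power_add intro: q_expansion_mult)

lemma modular_form_add: "modular_form k f \<Longrightarrow> modular_form k g \<Longrightarrow> modular_form k (\<lambda>\<tau>. f \<tau> + g \<tau>)"
  unfolding modular_form_def by (auto simp: algebra_simps intro: q_expansion_add)

lemma modular_form_diff: "modular_form k f \<Longrightarrow> modular_form k g \<Longrightarrow> modular_form k (\<lambda>\<tau>. f \<tau> - g \<tau>)"
  unfolding modular_form_def by (auto simp: algebra_simps intro: q_expansion_diff)

lemma modular_form_cmult: "modular_form k f \<Longrightarrow> modular_form k (\<lambda>\<tau>. c * f \<tau>)"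
  unfolding modular_form_def by (auto simp: algebra_simps intro: q_expansion_cmult)

lemma modular_form_const: "modular_form 0 (\<lambda>\<tau>. c)"
  unfolding modular_form_def by (auto intro: q_expansion_const)

lemma modular_form_power: "modular_form k f \<Longrightarrow> modular_form (k * n) (\<lambda>\<tau>. f \<tau> ^ n)"
  by (induction n) (auto intro: modular_form_mult modular_form_const)

section \<open>Vanishing of forms of large order at the cusp\<close>

lemma orbit_reaches_high:
  assumes "\<tau> \<in> \<H>" "\<And>\<tau> n. \<tau> \<in> \<H> \<Longrightarrow> h (\<tau> + of_int n) = h \<tau>" "\<And>\<tau>. \<tau> \<in> \<H> \<Longrightarrow> h (- 1 / \<tau>) = h \<tau>"
  obtains \<tau>' where "Im \<tau>' \<ge> 17/20" "h \<tau>' = (h \<tau> :: real)"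
proof -
  have *: "\<exists>\<tau>'. Im \<tau>' \<ge> 17/20 \<and> h \<tau>' = h \<tau>" if "\<tau> \<in> \<H>" "Im \<tau> \<ge> (39/40) ^ n * (17/20)" for \<tau> n
    using that
  proof (induction n arbitrary: \<tau>)
    case 0
    then show ?case by auto
  next
    case (Suc n)
    show ?case
    proof (cases "Im \<tau> \<ge> 17/20")
      case True
      then show ?thesis by blast
    next
      case False
      define \<sigma> where "\<sigma> = \<tau> + of_int (- round (Re \<tau>))"
      have "\<bar>Re \<sigma>\<bar> \<le> 1/2"
        using of_int_round_abs_le[of "Re \<tau>"] by (simp add: \<sigma>_def abs_minus_commute)
      then have "(Re \<sigma>)\<^sup>2 \<le> (1/2)\<^sup>2" by (subst abs_le_square_iff[symmetric]) simp
      have \<sigma>: "\<sigma> \<in> \<H>" "Im \<sigma> = Im \<tau>" "Im \<tau> > 0" using Suc.prems by (auto simp: \<sigma>_def upper_half_plane_def)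
      have "(Im \<sigma>)\<^sup>2 \<le> (17/20)\<^sup>2" using False \<sigma> by (intro power_mono) auto
      \<comment> \<open>(1/2)^2 + (17/20)^2 = 0.9725 is at most 39/40, so inversion raises the
        imaginary part by a factor of at least 40/39. The induction counts these steps, and the
        invariance of \<open>h\<close> stands in for the group elements.\<close>
      then have n: "(norm \<sigma>)\<^sup>2 \<le> 39/40"
        using \<open>(Re \<sigma>)\<^sup>2 \<le> _\<close> unfolding cmod_power2 by (simp add: power2_eq_square)
      have n0: "(norm \<sigma>)\<^sup>2 > 0" using upper_half_plane_S(2)[OF \<sigma>(1)] by simp
      have "(39/40) ^ n * (17/20) \<le> Im \<tau> / (39/40)" using Suc.prems(2) by (simp add: field_simps)
      also have "\<dots> \<le> Im (- 1 / \<sigma>)"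
        unfolding upper_half_plane_S(3) \<sigma>(2) using n n0 \<sigma>(3) by (intro divide_left_mono) auto
      finally have "\<exists>\<tau>'. Im \<tau>' \<ge> 17/20 \<and> h \<tau>' = h (- 1 / \<sigma>)"
        by (intro Suc.IH upper_half_plane_S \<sigma>)
      moreover have "h (- 1 / \<sigma>) = h \<tau>"
        using assms(3)[OF \<sigma>(1)] assms(2)[OF Suc.prems(1)] by (simp only: \<sigma>_def)
      ultimately show ?thesis by simp
    qed
  qed
  have "(\<lambda>n. (39/40 :: real) ^ n * (17/20)) \<longlonglongrightarrow> 0 * (17/20)"
    by (intro tendsto_mult tendsto_const LIMSEQ_realpow_zero) auto
  then have "\<forall>\<^sub>F n in sequentially. (39/40) ^ n * (17/20) < Im \<tau>"
    by (rule order_tendstoD) (use assms(1) in \<open>simp add: upper_half_plane_def\<close>)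
  then obtain n where "(39/40) ^ n * (17/20) < Im \<tau>"
    using eventually_sequentially by (metis le_refl)
  then show ?thesis using *[OF assms(1), of n] that by auto
qed

text \<open>A single term of the exponential series bounds the power.\<close>

lemma power_exp_bounded:
  fixes c :: real
  assumes "c > 0"
  obtains B where "\<And>y. y \<ge> 0 \<Longrightarrow> y ^ k * exp (- c * y) \<le> B"
proof
  fix y :: real assume "y \<ge> 0"
  have "(c * y) ^ k / fact k \<le> exp (c * y)"
  proof -
    have "(\<lambda>n. inverse (fact n) * (c * y) ^ n) sums exp (c * y)"
      using exp_converges[of "c * y"] by simp
    then have "(\<Sum>n\<in>{k}. inverse (fact n) * (c * y) ^ n) \<le> exp (c * y)"
      unfolding sums_iff using assms \<open>y \<ge> 0\<close> by (metis (no_types, lifting) finite.emptyI finite_insert inverse_nonnegative_iff_nonnegative less_imp_le mult_nonneg_nonneg sum_le_suminf zero_le_power fact_ge_zero)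
    then show ?thesis by (simp add: divide_inverse mult.commute)
  qed
  then have "c ^ k * y ^ k \<le> fact k * exp (c * y)" by (simp add: field_simps)
  then show "y ^ k * exp (- c * y) \<le> fact k / c ^ k"
    using assms by (simp add: exp_minus field_simps)
qed

lemma q_expansion_vanishing_order:
  assumes "q_expansion f F" "\<And>n. n < m \<Longrightarrow> fps_nth F n = 0"
  obtains G where "fps_conv_radius G \<ge> 1" "F = fps_X ^ m * G" "\<And>\<tau>. \<tau> \<in> \<H> \<Longrightarrow> f \<tau> = nome \<tau> ^ m * eval_fps G (nome \<tau>)"
proof
  let ?G = "fps_shift m F"
  show 1: "F = fps_X ^ m * ?G"
    by (rule fps_ext) (use assms(2) in \<open>auto simp: fps_X_power_mult_nth\<close>)
  show 2: "fps_conv_radius ?G \<ge> 1" using q_expansionD(1)[OF assms(1)] by simp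
  show "f \<tau> = nome \<tau> ^ m * eval_fps ?G (nome \<tau>)" if "\<tau> \<in> \<H>" for \<tau>
  proof -
    have "ereal (norm (nome \<tau>)) < fps_conv_radius ?G"
      using q_expansionD(4)[OF assms(1) norm_nome_less_1[OF that]] by simp
    then have "eval_fps (fps_X ^ m * ?G) (nome \<tau>) = nome \<tau> ^ m * eval_fps ?G (nome \<tau>)"
      by (subst eval_fps_mult) auto
    then show ?thesis using q_expansionD(2)[OF assms(1) that] 1 by simp
  qed
qed

text \<open>
  A weak form of the valence formula: the invariant function \<open>\<bar>f\<bar>\<^sup>2 (Im \<tau>)\<^sup>k\<close> is bounded by its supremum
  on \<open>Im \<tau> \<ge> 17/20\<close>, and the maximum principle for \<open>f / q\<^sup>m\<close> on a slightly larger disc improves this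
  bound by a constant factor less than 1. (Any height below \<open>sqrt 3 / 2\<close> is reached by every orbit; with \<open>17/20\<close>
  the estimate only needs \<open>\<pi> > 3\<close>.)
\<close>

lemma modular_form_vanishes:
  assumes "modular_form k f" "q_expansion f F" "\<And>n. n < m \<Longrightarrow> fps_nth F n = 0" "m \<ge> 1" "k \<le> 10 * m" "\<tau> \<in> \<H>"
  shows "f \<tau> = 0"
proof -
  obtain G where G: "fps_conv_radius G \<ge> 1" "\<And>\<tau>. \<tau> \<in> \<H> \<Longrightarrow> f \<tau> = nome \<tau> ^ m * eval_fps G (nome \<tau>)"
    using q_expansion_vanishing_order[OF assms(2,3)] by metis
  have lt: "ereal (norm q) < fps_conv_radius G" if "norm q < 1" for q :: complex
    using that G(1) less_le_trans[of "ereal (norm q)" 1] by simp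
  have holG: "eval_fps G holomorphic_on ball 0 1"
    by (rule holomorphic_on_eval_fps) (use lt in auto)
  have contG: "continuous_on (ball 0 1) (eval_fps G)"
    by (rule holomorphic_on_imp_continuous_on[OF holG])
  define h where "h = (\<lambda>\<tau>. (norm (f \<tau>))\<^sup>2 * Im \<tau> ^ k)"
  define S where "S = {\<tau>. Im \<tau> \<ge> 17/20}"
  have SH: "\<tau> \<in> \<H>" if "\<tau> \<in> S" for \<tau> using that by (simp add: S_def upper_half_plane_def)
  have h0: "h \<tau> \<ge> 0" if "\<tau> \<in> \<H>" for \<tau>
    using that by (simp add: h_def upper_half_plane_def)
  have hT: "h (\<tau> + of_int n) = h \<tau>" if "\<tau> \<in> \<H>" for \<tau> n
    using modular_formD(2)[OF assms(1) that] by (simp add: h_def)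
  have hS: "h (- 1 / \<tau>) = h \<tau>" if "\<tau> \<in> \<H>" for \<tau>
    unfolding h_def modular_formD(1)[OF assms(1) that] upper_half_plane_S(3)
    using upper_half_plane_S(2)[OF that]
    by (simp add: norm_mult norm_power power_divide power_mult_distrib power_mult[symmetric] mult.commute)
  have h_exp: "h \<tau> = norm (nome \<tau>) ^ (2 * m) * (norm (eval_fps G (nome \<tau>)))\<^sup>2 * Im \<tau> ^ k" if "\<tau> \<in> \<H>" for \<tau>
    unfolding h_def G(2)[OF that] by (simp add: norm_mult norm_power power_mult_distrib power_mult[symmetric] mult.commute)
  have nome_pow: "norm (nome \<tau>) ^ (2 * m) = exp (- (4 * pi * m) * Im \<tau>)" for \<tau>
    by (simp add: norm_nome exp_of_nat_mult[symmetric])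
  have "bdd_above (h ` S)"
  proof -
    have "compact (cball (0::complex) (exp (- 2 * pi * (17/20))))" by simp
    moreover have "cball (0::complex) (exp (- 2 * pi * (17/20))) \<subseteq> ball 0 1"
      by (subst cball_subset_ball_iff) simp
    ultimately have "bounded (eval_fps G ` cball 0 (exp (- 2 * pi * (17/20))))"
      by (intro compact_imp_bounded compact_continuous_image) (rule continuous_on_subset[OF contG])
    then obtain B where B: "\<And>q. norm q \<le> exp (- 2 * pi * (17/20)) \<Longrightarrow> norm (eval_fps G q) \<le> B"
      unfolding bounded_iff using mem_cball_0 by blast
    obtain C where C: "\<And>y. y \<ge> 0 \<Longrightarrow> y ^ k * exp (- (4 * pi * m) * y) \<le> C"
      using power_exp_bounded[of "4 * pi * m" k] assms(4) by auto
    have "h \<tau> \<le> C * B\<^sup>2" if "\<tau> \<in> S" for \<tau>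
    proof -
      have "norm (nome \<tau>) \<le> exp (- 2 * pi * (17/20))" using that by (simp add: norm_nome S_def)
      then have "(norm (eval_fps G (nome \<tau>)))\<^sup>2 \<le> B\<^sup>2" using B by (intro power_mono) auto
      moreover have "Im \<tau> ^ k * exp (- (4 * pi * m) * Im \<tau>) \<le> C" using that by (intro C) (simp add: S_def)
      moreover have "0 \<le> Im \<tau> ^ k * exp (- (4 * pi * m) * Im \<tau>)" using that by (simp add: S_def)
      ultimately have "(Im \<tau> ^ k * exp (- (4 * pi * m) * Im \<tau>)) * (norm (eval_fps G (nome \<tau>)))\<^sup>2 \<le> C * B\<^sup>2"
        by (intro mult_mono) auto
      then show ?thesis unfolding h_exp[OF SH[OF that]] nome_pow by (simp only: mult_ac)
    qed
    then show ?thesis by (auto simp: bdd_above_def)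
  qed
  define M where "M = Sup (h ` S)"
  \<comment> \<open>Here the behaviour under inversion enters: it extends the bound from
    \<open>S\<close> to the whole upper half plane.\<close>
  have hM: "h \<tau> \<le> M" if \<tau>: "\<tau> \<in> \<H>" for \<tau>
  proof -
    obtain \<tau>' where "Im \<tau>' \<ge> 17/20" "h \<tau>' = h \<tau>"
      using orbit_reaches_high[OF \<tau>, of h] hT hS by blast
    then show ?thesis unfolding M_def
      using \<open>bdd_above (h ` S)\<close> by (metis (mono_tags, lifting) S_def cSUP_upper mem_Collect_eq)
  qed
  have M0: "M \<ge> 0" using h0[OF assms(6)] hM[OF assms(6)] by linarith
  \<comment> \<open>Any \<open>s\<close> close enough to 1 would do. The loss (1/s)^k is at most
    e^(10 m / 99), the gain is e^(- 0.034 pi m), and 0.034 pi > 0.102 > 10/99.\<close>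
  define s :: real where "s = 99/100"
  define \<theta> where "\<theta> = (1 / s) ^ k * exp (- (4 * pi * m) * (17/20 * (1 - s)))"
  have "h \<tau> \<le> \<theta> * M" if "\<tau> \<in> S" for \<tau>
  proof -
    define y where "y = Im \<tau>"
    have y: "y \<ge> 17/20" "y > 0" using that by (auto simp: S_def y_def)
    define r where "r = exp (- 2 * pi * (s * y))"
    have s: "0 < s" "s < 1" "s * y > 0" "s * y < y" using y by (auto simp: s_def)
    have r: "0 < r" "r < 1" "norm (nome \<tau>) < r"
      using s by (auto simp: r_def norm_nome y_def)
    \<comment> \<open>The circle of radius \<open>r\<close> is the image of the horizontal line at
      height s y, slightly below \<tau>. There the global bound \<open>hM\<close> applies even if s
      y is less than 17/20.\<close>
    have "norm (eval_fps G (nome \<tau>)) \<le> sqrt (M / (s * y) ^ k / r ^ (2 * m))"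
    proof (rule maximum_modulus_frontier[where f = "eval_fps G" and S = "ball 0 r"])
      show "eval_fps G holomorphic_on interior (ball 0 r)"
        by (rule holomorphic_on_subset[OF holG]) (use r in auto)
      show "continuous_on (closure (ball 0 r)) (eval_fps G)"
        by (rule continuous_on_subset[OF contG]) (use r in auto)
      show "nome \<tau> \<in> ball 0 r" using r by simp
      fix z :: complex assume "z \<in> frontier (ball 0 r)"
      then have z: "norm z = r" using r by simp
      then obtain \<sigma> where \<sigma>: "\<sigma> \<in> \<H>" "nome \<sigma> = z" using nome_surj[of z] r by (metis norm_zero less_irrefl)
      then have "exp (- 2 * pi * Im \<sigma>) = exp (- 2 * pi * (s * y))"
        using z unfolding r_def norm_nome[symmetric] by simp
      then have im: "Im \<sigma> = s * y" by simp
      have "r ^ (2 * m) * (norm (eval_fps G z))\<^sup>2 * (s * y) ^ k \<le> M"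
        using hM[OF \<sigma>(1)] unfolding h_exp[OF \<sigma>(1)] \<sigma>(2) z im .
      then have "(norm (eval_fps G z))\<^sup>2 \<le> M / (s * y) ^ k / r ^ (2 * m)"
        using r s by (simp add: field_simps)
      then show "norm (eval_fps G z) \<le> sqrt (M / (s * y) ^ k / r ^ (2 * m))"
        by (rule real_le_rsqrt)
    qed auto
    then have "(norm (eval_fps G (nome \<tau>)))\<^sup>2 \<le> (sqrt (M / (s * y) ^ k / r ^ (2 * m)))\<^sup>2"
      by (intro power_mono) auto
    also have "\<dots> = M / (s * y) ^ k / r ^ (2 * m)"
      using M0 r s by (intro real_sqrt_pow2) auto
    finally have "h \<tau> \<le> norm (nome \<tau>) ^ (2 * m) * (M / (s * y) ^ k / r ^ (2 * m)) * y ^ k"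
      unfolding h_exp[OF SH[OF that]] y_def[symmetric] using y by (intro mult_right_mono mult_left_mono) auto
    also have "\<dots> = M * (1 / s) ^ k * (norm (nome \<tau>) ^ (2 * m) / r ^ (2 * m))"
      using s y by (simp add: power_mult_distrib power_divide field_simps)
    also have "\<dots> \<le> M * (1 / s) ^ k * exp (- (4 * pi * m) * (17/20 * (1 - s)))"
    proof (intro mult_left_mono)
      have "norm (nome \<tau>) ^ (2 * m) / r ^ (2 * m) = exp (- (4 * pi * m) * (y * (1 - s)))"
        unfolding nome_pow r_def y_def[symmetric] exp_of_nat_mult[symmetric] exp_diff[symmetric] by (simp add: algebra_simps)
      moreover have "17/20 * (1 - s) \<le> y * (1 - s)" using y s by (intro mult_right_mono) auto
      then have "(4 * pi * m) * (17/20 * (1 - s)) \<le> (4 * pi * m) * (y * (1 - s))" by (intro mult_left_mono) auto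
      ultimately show "norm (nome \<tau>) ^ (2 * m) / r ^ (2 * m) \<le> exp (- (4 * pi * m) * (17/20 * (1 - s)))" by simp
    qed (use M0 s in auto)
    finally show ?thesis by (simp only: \<theta>_def mult_ac)
  qed
  moreover have "S \<noteq> {}" by (auto simp: S_def intro!: exI[of _ \<i>])
  ultimately have "M \<le> \<theta> * M" unfolding M_def by (intro cSUP_least) auto
  moreover have "\<theta> < 1"
  proof -
    have "(1 / s) ^ k \<le> exp (1 / 99) ^ k"
      using exp_ge_add_one_self[of "1/99"] by (intro power_mono) (auto simp: s_def)
    also have "\<dots> = exp (real k / 99)" by (simp add: exp_of_nat_mult[symmetric])
    also have "\<dots> \<le> exp (10 * m / 99)" using assms(5) by simp
    finally have "\<theta> \<le> exp (10 * m / 99) * exp (- (4 * pi * m) * (17/20 * (1 - s)))"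
      by (simp add: \<theta>_def)
    also have "\<dots> = exp (m * (10 / 99 - 34 / 1000 * pi))"
      by (simp add: exp_add[symmetric] s_def algebra_simps)
    also have "\<dots> < 1"
      using pi_gt3 assms(4) by (simp add: mult_less_0_iff)
    finally show ?thesis .
  qed
  ultimately have "M = 0" using M0 by (smt (verit) mult_left_le_one_le mult_cancel_right2 mult_le_cancel_right2)
  then have "h \<tau> = 0" using hM[OF assms(6)] h0[OF assms(6)] by linarith
  then show ?thesis using assms(6) by (simp add: h_def upper_half_plane_def)
qed

section \<open>The forms a and b and the discriminant\<close>

definition fps_a :: "complex fps" where
  "fps_a = Abs_fps (\<lambda>n. if n = 0 then - 1/3 else - 80 * of_nat (divisor_sum 3 n))"

definition fps_b :: "complex fps" where
  "fps_b = Abs_fps (\<lambda>n. if n = 0 then 2/27 else - (112/3) * of_nat (divisor_sum 5 n))"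

lemma divisor_sum_sums:
  assumes "norm q < 1" "j \<ge> 1"
  shows "(\<lambda>n. of_nat (divisor_sum j (Suc n)) * q ^ Suc n) sums (\<Sum>n. of_nat (divisor_sum j (Suc n)) * q ^ Suc n :: complex)"
proof -
  obtain L where L: "((\<lambda>n. of_nat (divisor_sum j n) * q ^ n) has_sum L) {1..}"
    using lambert_has_sum[OF assms] .
  have "range Suc = {1..}" by (auto simp: image_iff Suc_le_eq gr0_conv_Suc)
  then have "((\<lambda>n. of_nat (divisor_sum j (Suc n)) * q ^ Suc n) has_sum L) UNIV"
    using L has_sum_reindex[of Suc UNIV "\<lambda>n. of_nat (divisor_sum j n) * q ^ n" L]
    unfolding o_def by (metis inj_Suc)
  then show ?thesis by (intro summable_sums sums_summable has_sum_imp_sums)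
qed

lemma q_expansion_form_a: "q_expansion form_a fps_a"
proof (rule q_expansionI)
  fix \<tau> assume "\<tau> \<in> \<H>"
  then have "(\<lambda>n. - 80 * (of_nat (divisor_sum 3 (Suc n)) * nome \<tau> ^ Suc n)) sums
     (- 80 * (\<Sum>n. of_nat (divisor_sum 3 (Suc n)) * nome \<tau> ^ Suc n))"
    by (intro sums_mult divisor_sum_sums norm_nome_less_1) auto
  then have "(\<lambda>n. fps_nth fps_a (Suc n) * nome \<tau> ^ Suc n) sums (- 80 * (\<Sum>n. of_nat (divisor_sum 3 (Suc n)) * nome \<tau> ^ Suc n))"
    by (simp add: fps_a_def mult_ac del: power_Suc)
  from sums_Suc[OF this] show "(\<lambda>n. fps_nth fps_a n * nome \<tau> ^ n) sums form_a \<tau>"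
    by (simp add: form_a_def fps_a_def algebra_simps del: power_Suc)
qed

lemma q_expansion_form_b: "q_expansion form_b fps_b"
proof (rule q_expansionI)
  fix \<tau> assume "\<tau> \<in> \<H>"
  then have "(\<lambda>n. - (112/3) * (of_nat (divisor_sum 5 (Suc n)) * nome \<tau> ^ Suc n)) sums
     (- (112/3) * (\<Sum>n. of_nat (divisor_sum 5 (Suc n)) * nome \<tau> ^ Suc n))"
    by (intro sums_mult divisor_sum_sums norm_nome_less_1) auto
  then have "(\<lambda>n. fps_nth fps_b (Suc n) * nome \<tau> ^ Suc n) sums (- (112/3) * (\<Sum>n. of_nat (divisor_sum 5 (Suc n)) * nome \<tau> ^ Suc n))"
    by (simp add: fps_b_def mult_ac del: power_Suc)
  from sums_Suc[OF this] show "(\<lambda>n. fps_nth fps_b n * nome \<tau> ^ n) sums form_b \<tau>"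
    by (simp add: form_b_def fps_b_def algebra_simps del: power_Suc)
qed

lemma modular_form_a: "modular_form 4 form_a"
  unfolding modular_form_def using q_expansion_form_a form_modular(1)[of _ 0 0 "-1" 1] by auto

lemma modular_form_b: "modular_form 6 form_b"
  unfolding modular_form_def using q_expansion_form_b form_modular(2)[of _ 0 0 "-1" 1] by auto

text \<open>Up to sign the discriminant of the cubic x^3 + a x + b. It is - 256 times the normalised
  cusp form q - 24 q^2 + ... of weight 12.\<close>

definition disc :: "complex \<Rightarrow> complex" where
  "disc \<tau> = 4 * form_a \<tau> ^ 3 + 27 * form_b \<tau> ^ 2"

definition fps_disc :: "complex fps" where
  "fps_disc = fps_const 4 * fps_a ^ 3 + fps_const 27 * fps_b ^ 2"

lemma q_expansion_disc: "q_expansion disc fps_disc"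
  unfolding disc_def[abs_def] fps_disc_def
  by (intro q_expansion_add q_expansion_cmult q_expansion_power q_expansion_form_a q_expansion_form_b)

lemma modular_form_disc: "modular_form 12 disc"
  using modular_form_add[OF modular_form_cmult[OF modular_form_power[OF modular_form_a, of 3, simplified], of 4]
      modular_form_cmult[OF modular_form_power[OF modular_form_b, of 2, simplified], of 27]]
  by (simp add: disc_def[abs_def])

lemma fps_disc_nth: "fps_nth fps_disc 0 = 0" "fps_nth fps_disc 1 = - 256"
proof -
  have [simp]: "divisor_sum j (Suc 0) = 1" for j by (simp add: divisor_sum_def)
  show "fps_nth fps_disc 0 = 0" "fps_nth fps_disc 1 = - 256"
    by (simp_all add: fps_disc_def fps_a_def fps_b_def power3_eq_cube power2_eq_square fps_mult_nth_1)
qed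

lemma q_deriv_nth: "fps_nth (q_deriv F) n = 2 * of_real pi * \<i> * of_nat n * fps_nth F n"
  by (cases n) (simp_all add: q_deriv_def fps_X_mult_nth)

text \<open>Up to a scalar the left side is the second Rankin-Cohen bracket of \<open>disc\<close>
  with itself, of weight 12 + 12 + 4 = 28: under inversion the derivatives acquire the extra terms
  of \<open>S1\<close> and \<open>S2\<close>, which cancel in this combination. Both sides start at
  q^2, where the factor 3 makes them agree, so the difference vanishes to order 3, and 28 <= 10 * 3
  forces it to be 0.\<close>

lemma disc_bracket:
  assumes "\<tau> \<in> \<H>"
  defines "d1 \<equiv> eval_fps (q_deriv fps_disc) (nome \<tau>)"
    and "d2 \<equiv> eval_fps (q_deriv (q_deriv fps_disc)) (nome \<tau>)"
  shows "12 * disc \<tau> * d2 - 13 * d1\<^sup>2 = 3 * (2 * of_real pi * \<i>)\<^sup>2 * (disc \<tau> ^ 2 * form_a \<tau>)"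
proof -
  define D1 where "D1 = (\<lambda>\<tau>. eval_fps (q_deriv fps_disc) (nome \<tau>))"
  define D2 where "D2 = (\<lambda>\<tau>. eval_fps (q_deriv (q_deriv fps_disc)) (nome \<tau>))"
  let ?C = "2 * of_real pi * \<i> :: complex"
  have q1: "(disc has_field_derivative D1 \<tau>) (at \<tau>)" "q_expansion D1 (q_deriv fps_disc)" if "\<tau> \<in> \<H>" for \<tau>
    using q_expansion_derivative[OF q_expansion_disc] that by (simp_all add: D1_def)
  have q2: "(D1 has_field_derivative D2 \<tau>) (at \<tau>)" "q_expansion D2 (q_deriv (q_deriv fps_disc))" if "\<tau> \<in> \<H>" for \<tau>
    using q_expansion_derivative[OF q1(2)[OF that]] that by (simp_all add: D2_def)
  let ?B = "\<lambda>\<tau>. (12 * (disc \<tau> * D2 \<tau>) - 13 * D1 \<tau> ^ 2) - 3 * ?C\<^sup>2 * (disc \<tau> ^ 2 * form_a \<tau>)"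
  define F where "F = (fps_const 12 * (fps_disc * q_deriv (q_deriv fps_disc)) - fps_const 13 * q_deriv fps_disc ^ 2)
     - fps_const (3 * ?C\<^sup>2) * (fps_disc ^ 2 * fps_a)"
  have qB: "q_expansion ?B F"
    unfolding F_def by (intro q_expansion_diff q_expansion_cmult q_expansion_mult q_expansion_power
        q_expansion_disc q_expansion_form_a q1(2)[OF assms(1)] q2(2)[OF assms(1)])
  have S1: "D1 (- 1 / \<tau>) = 12 * \<tau> ^ 13 * disc \<tau> + \<tau> ^ 14 * D1 \<tau>" if "\<tau> \<in> \<H>" for \<tau>
  proof -
    note t = upper_half_plane_S(1,2)[OF that]
    have "D1 (- 1 / \<tau>) * (1 / \<tau>\<^sup>2) = 12 * \<tau> ^ 11 * disc \<tau> + \<tau> ^ 12 * D1 \<tau>"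
    proof (rule DERIV_eq_on_open[OF open_upper_half_plane _ _ _ that])
      show "disc (- 1 / \<tau>) = \<tau> ^ 12 * disc \<tau>" if "\<tau> \<in> \<H>" for \<tau>
        using modular_formD(1)[OF modular_form_disc that] .
      show "((\<lambda>\<tau>. disc (- 1 / \<tau>)) has_field_derivative D1 (- 1 / \<tau>) * (1 / \<tau>\<^sup>2)) (at \<tau>)" if "\<tau> \<in> \<H>" for \<tau>
        by (rule DERIV_chain2[where g = "\<lambda>\<tau>. - 1 / \<tau>", OF q1(1)[OF upper_half_plane_S(1)[OF that]]])
          (use upper_half_plane_S(2)[OF that] in \<open>auto intro!: derivative_eq_intros simp: power2_eq_square\<close>)
      show "((\<lambda>\<tau>. \<tau> ^ 12 * disc \<tau>) has_field_derivative 12 * \<tau> ^ 11 * disc \<tau> + \<tau> ^ 12 * D1 \<tau>) (at \<tau>)" if "\<tau> \<in> \<H>" for \<tau>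
        by (auto intro!: derivative_eq_intros q1(1)[OF that])
    qed
    then have "D1 (- 1 / \<tau>) = \<tau>\<^sup>2 * (12 * \<tau> ^ 11 * disc \<tau> + \<tau> ^ 12 * D1 \<tau>)"
      using t(2) by (simp add: field_simps)
    then show ?thesis by (simp add: algebra_simps eval_nat_numeral)
  qed
  have S2: "D2 (- 1 / \<tau>) = 156 * \<tau> ^ 14 * disc \<tau> + 26 * \<tau> ^ 15 * D1 \<tau> + \<tau> ^ 16 * D2 \<tau>" if "\<tau> \<in> \<H>" for \<tau>
  proof -
    note t = upper_half_plane_S(1,2)[OF that]
    have "D2 (- 1 / \<tau>) * (1 / \<tau>\<^sup>2) = (156 * \<tau> ^ 12 * disc \<tau> + 12 * \<tau> ^ 13 * D1 \<tau>) + (14 * \<tau> ^ 13 * D1 \<tau> + \<tau> ^ 14 * D2 \<tau>)"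
    proof (rule DERIV_eq_on_open[OF open_upper_half_plane S1 _ _ that])
      show "((\<lambda>\<tau>. D1 (- 1 / \<tau>)) has_field_derivative D2 (- 1 / \<tau>) * (1 / \<tau>\<^sup>2)) (at \<tau>)" if "\<tau> \<in> \<H>" for \<tau>
        by (rule DERIV_chain2[where g = "\<lambda>\<tau>. - 1 / \<tau>", OF q2(1)[OF upper_half_plane_S(1)[OF that]]])
          (use upper_half_plane_S(2)[OF that] in \<open>auto intro!: derivative_eq_intros simp: power2_eq_square\<close>)
      show "((\<lambda>\<tau>. 12 * \<tau> ^ 13 * disc \<tau> + \<tau> ^ 14 * D1 \<tau>) has_field_derivative
        (156 * \<tau> ^ 12 * disc \<tau> + 12 * \<tau> ^ 13 * D1 \<tau>) + (14 * \<tau> ^ 13 * D1 \<tau> + \<tau> ^ 14 * D2 \<tau>)) (at \<tau>)" if "\<tau> \<in> \<H>" for \<tau>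
        by (auto intro!: derivative_eq_intros q1(1)[OF that] q2(1)[OF that])
    qed
    then have "D2 (- 1 / \<tau>) = \<tau>\<^sup>2 * ((156 * \<tau> ^ 12 * disc \<tau> + 12 * \<tau> ^ 13 * D1 \<tau>) + (14 * \<tau> ^ 13 * D1 \<tau> + \<tau> ^ 14 * D2 \<tau>))"
      using t(2) by (simp add: field_simps)
    then show ?thesis by (simp add: algebra_simps eval_nat_numeral)
  qed
  have mB: "modular_form 28 ?B"
    unfolding modular_form_def
  proof (intro conjI ballI)
    show "\<exists>F. q_expansion ?B F" using qB by blast
    show "?B (- 1 / \<tau>) = \<tau> ^ 28 * ?B \<tau>" if "\<tau> \<in> \<H>" for \<tau>
      unfolding S1[OF that] S2[OF that] modular_formD(1)[OF modular_form_disc that] modular_formD(1)[OF modular_form_a that]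
      by (simp add: algebra_simps power2_eq_square)
  qed
  have ord2: "fps_nth (f * g) 0 = 0" "fps_nth (f * g) 1 = 0" "fps_nth (f * g) 2 = fps_nth f 1 * fps_nth g 1"
    if "fps_nth f 0 = 0" "fps_nth g 0 = 0" for f g :: "complex fps"
    using that by (simp_all add: fps_mult_nth numeral_2_eq_2)
  have F0: "fps_nth F n = 0" if "n < 3" for n
  proof -
    note [simp] = fps_disc_nth fps_disc_nth(2)[unfolded One_nat_def] q_deriv_nth ord2 ord2(2)[unfolded One_nat_def] ord2(3)[unfolded numeral_2_eq_2]
    have "n = 0 \<or> n = 1 \<or> n = 2" using that by linarith
    moreover have "fps_nth (fps_disc\<^sup>2 * fps_a) 0 = 0" "fps_nth (fps_disc\<^sup>2 * fps_a) 1 = 0"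
      "fps_nth (fps_disc\<^sup>2 * fps_a) 2 = 256\<^sup>2 * (- 1 / 3)"
      unfolding power2_eq_square fps_mult_nth[of "fps_disc * fps_disc"]
      by (simp_all add: numeral_2_eq_2 fps_a_def)
    ultimately show ?thesis
      by (auto simp: F_def power2_eq_square[of "q_deriv _"]) (simp_all add: power2_eq_square)
  qed
  have "?B \<tau> = 0"
    by (rule modular_form_vanishes[OF mB qB, of 3]) (use F0 assms(1) in auto)
  then show ?thesis by (simp add: d1_def d2_def D1_def D2_def mult.assoc)
qed

lemma connected_upper_half_plane: "connected \<H>"
  unfolding upper_half_plane_def by (intro convex_connected convex_halfspace_Im_gt)

lemma q_expansion_holomorphic_on: "q_expansion f F \<Longrightarrow> f holomorphic_on \<H>"
  using q_expansion_derivative(1) open_upper_half_plane by (auto simp: holomorphic_on_open)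

text \<open>
  At a zero of order \<open>m\<close> of the discriminant \<open>D\<close>, the left-hand side of
  \<open>12 D D'' - 13 D'\<^sup>2 = const D\<^sup>2 a\<close> vanishes to order exactly \<open>2m - 2\<close>, since
  \<open>12 m (m - 1) - 13 m\<^sup>2 < 0\<close>, and the right-hand side to order at least \<open>2m\<close>.
\<close>

lemma disc_nonzero:
  assumes "\<xi> \<in> \<H>"
  shows "disc \<xi> \<noteq> 0"
proof
  assume zero: "disc \<xi> = 0"
  have "\<not> disc constant_on \<H>"
  proof
    assume "disc constant_on \<H>"
    then obtain c where "\<And>\<tau>. \<tau> \<in> \<H> \<Longrightarrow> disc \<tau> = c" by (auto simp: constant_on_def)
    then have "q_expansion disc (fps_const c)"
      using q_expansion_cong[OF q_expansion_const] by blast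
    then have e: "fps_disc = fps_const c" using q_expansion_unique[OF q_expansion_disc] by blast
    have "fps_nth fps_disc 1 = 0" unfolding e by simp
    then show False unfolding fps_disc_nth(2) by simp
  qed
  then obtain g r n where grn: "0 < n" "0 < r" "ball \<xi> r \<subseteq> \<H>" "g holomorphic_on ball \<xi> r"
    "\<And>w. w \<in> ball \<xi> r \<Longrightarrow> disc w = (w - \<xi>) ^ n * g w" "\<And>w. w \<in> ball \<xi> r \<Longrightarrow> g w \<noteq> 0"
    using holomorphic_factor_zero_nonconstant[OF q_expansion_holomorphic_on[OF q_expansion_disc]
        open_upper_half_plane connected_upper_half_plane assms zero] by metis
  let ?U = "ball \<xi> r"
  define D1 where "D1 = (\<lambda>\<tau>. eval_fps (q_deriv fps_disc) (nome \<tau>))"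
  define D2 where "D2 = (\<lambda>\<tau>. eval_fps (q_deriv (q_deriv fps_disc)) (nome \<tau>))"
  have q1: "(disc has_field_derivative D1 \<tau>) (at \<tau>)" "q_expansion D1 (q_deriv fps_disc)" if "\<tau> \<in> \<H>" for \<tau>
    using q_expansion_derivative[OF q_expansion_disc] that by (simp_all add: D1_def)
  have q2: "(D1 has_field_derivative D2 \<tau>) (at \<tau>)" "q_expansion D2 (q_deriv (q_deriv fps_disc))" if "\<tau> \<in> \<H>" for \<tau>
    using q_expansion_derivative[OF q1(2)[OF that]] that by (simp_all add: D2_def)
  have g': "(g has_field_derivative deriv g w) (at w)" if "w \<in> ?U" for w
    by (rule holomorphic_derivI[OF grn(4) open_ball that])
  have holg': "deriv g holomorphic_on ?U" by (rule holomorphic_deriv[OF grn(4) open_ball])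
  have g'': "(deriv g has_field_derivative deriv (deriv g) w) (at w)" if "w \<in> ?U" for w
    by (rule holomorphic_derivI[OF holg' open_ball that])
  \<comment> \<open>Each derivative is multiplied by w - \<xi>, which keeps the exponent n and
    avoids n - 1 and n - 2 for small n.\<close>
  define h where "h = (\<lambda>w. of_nat n * g w + (w - \<xi>) * deriv g w)"
  define h' where "h' = (\<lambda>w. of_nat n * deriv g w + (deriv g w + (w - \<xi>) * deriv (deriv g) w))"
  have hh': "(h has_field_derivative h' w) (at w)" if "w \<in> ?U" for w
    unfolding h_def h'_def by (auto intro!: derivative_eq_intros g' g'' that)
  have pow: "(w - \<xi>) * (of_nat n * (w - \<xi>) ^ (n - 1)) = of_nat n * (w - \<xi>) ^ n" for w
    using grn(1) by (cases n) auto
  have e1: "(w - \<xi>) * D1 w = (w - \<xi>) ^ n * h w" if "w \<in> ?U" for w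
  proof -
    have "D1 w = of_nat n * (w - \<xi>) ^ (n - 1) * g w + (w - \<xi>) ^ n * deriv g w"
      by (rule DERIV_eq_on_open[OF open_ball grn(5) _ _ that])
        (use grn(3) in \<open>auto intro!: derivative_eq_intros q1(1) g'\<close>)
    then have "(w - \<xi>) * D1 w = (w - \<xi>) * (of_nat n * (w - \<xi>) ^ (n - 1)) * g w + (w - \<xi>) ^ n * ((w - \<xi>) * deriv g w)"
      by (simp add: algebra_simps)
    then show ?thesis unfolding pow h_def by (simp add: algebra_simps)
  qed
  have e2: "(w - \<xi>)\<^sup>2 * D2 w = (w - \<xi>) ^ n * (of_nat n * h w + (w - \<xi>) * h' w - h w)" if "w \<in> ?U" for w
  proof -
    have "D1 w + (w - \<xi>) * D2 w = of_nat n * (w - \<xi>) ^ (n - 1) * h w + (w - \<xi>) ^ n * h' w"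
      by (rule DERIV_eq_on_open[OF open_ball e1 _ _ that])
        (use grn(3) in \<open>auto intro!: derivative_eq_intros q2(1) hh'\<close>)
    then have "(w - \<xi>) * (D1 w + (w - \<xi>) * D2 w) = (w - \<xi>) * (of_nat n * (w - \<xi>) ^ (n - 1)) * h w + (w - \<xi>) ^ n * ((w - \<xi>) * h' w)"
      by (simp add: algebra_simps)
    then have "(w - \<xi>) * D1 w + (w - \<xi>)\<^sup>2 * D2 w = (w - \<xi>) ^ n * (of_nat n * h w + (w - \<xi>) * h' w)"
      unfolding pow by (simp add: algebra_simps power2_eq_square)
    then show ?thesis unfolding e1[OF that] by (simp add: algebra_simps)
  qed
  \<comment> \<open>\<open>L\<close> and \<open>R\<close> are the two sides of
    \<open>disc_bracket\<close> times (w - \<xi>)^2, divided by (w - \<xi>)^(2 n). They agree off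
    \<xi>, hence by continuity also at \<xi>, where L = - (n^2 + 12 n) g^2 and R = 0.\<close>
  define L where "L = (\<lambda>w. 12 * g w * (of_nat n * h w + (w - \<xi>) * h' w - h w) - 13 * (h w)\<^sup>2)"
  define R where "R = (\<lambda>w. 3 * (2 * of_real pi * \<i>)\<^sup>2 * (w - \<xi>)\<^sup>2 * g w ^ 2 * form_a w)"
  have LR: "L w = R w" if "w \<in> ?U" "w \<noteq> \<xi>" for w
  proof -
    have "((w - \<xi>) ^ n)\<^sup>2 * L w = 12 * disc w * ((w - \<xi>)\<^sup>2 * D2 w) - 13 * ((w - \<xi>) * D1 w)\<^sup>2"
      unfolding e1[OF that(1)] e2[OF that(1)] grn(5)[OF that(1)] L_def
      by (simp add: algebra_simps power_mult_distrib) (simp add: power2_eq_square)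
    also have "\<dots> = (w - \<xi>)\<^sup>2 * (12 * disc w * D2 w - 13 * (D1 w)\<^sup>2)"
      by (simp add: algebra_simps power2_eq_square)
    also have "\<dots> = ((w - \<xi>) ^ n)\<^sup>2 * R w"
      using disc_bracket[of w, folded D1_def[THEN fun_cong] D2_def[THEN fun_cong]] that grn(3) unfolding grn(5)[OF that(1), symmetric] R_def
      by (auto simp: grn(5)[OF that(1)] power_mult_distrib)
    finally show ?thesis using that by simp
  qed
  have \<xi>: "\<xi> \<in> ?U" using grn(2) by simp
  have "isCont g \<xi>" "isCont h \<xi>" "isCont form_a \<xi>" "isCont (deriv g) \<xi>" "isCont (deriv (deriv g)) \<xi>"
    using g'[OF \<xi>] hh'[OF \<xi>] q_expansion_derivative(1)[OF q_expansion_form_a assms] g''[OF \<xi>]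
      holomorphic_derivI[OF holomorphic_deriv[OF holg' open_ball] open_ball \<xi>]
    by (auto intro: DERIV_isCont)
  then have "isCont L \<xi>" "isCont R \<xi>"
    unfolding L_def R_def h'_def by (auto intro!: continuous_intros)
  then have "(L \<longlongrightarrow> L \<xi>) (at \<xi>)" "(R \<longlongrightarrow> R \<xi>) (at \<xi>)" by (simp_all add: isCont_def)
  moreover have "\<forall>\<^sub>F w in at \<xi>. L w = R w"
    using eventually_at_in_open[OF open_ball \<xi>] by eventually_elim (use LR in auto)
  ultimately have "L \<xi> = R \<xi>"
    by (metis tendsto_cong tendsto_unique trivial_limit_at)
  then have "12 * g \<xi> * (of_nat n * (of_nat n * g \<xi>) - of_nat n * g \<xi>) - 13 * (of_nat n * g \<xi>)\<^sup>2 = 0"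
    by (simp add: L_def R_def h_def)
  then have "- (of_nat n ^ 2 + 12 * of_nat n) * (g \<xi>)\<^sup>2 = 0"
    by (simp add: algebra_simps power2_eq_square)
  then have "of_nat n ^ 2 + 12 * of_nat n = (0 :: complex)"
    using grn(6)[OF \<xi>] by (metis mult_eq_0_iff neg_equal_0_iff_equal power_not_zero)
  then have "of_nat (n ^ 2 + 12 * n) = (0 :: complex)" by simp
  then show False using grn(1) unfolding of_nat_eq_0_iff by simp
qed

section \<open>The graded ring generated by a and b\<close>

definition homogeneous :: "nat \<Rightarrow> complex poly poly \<Rightarrow> bool" where
  "homogeneous k r \<longleftrightarrow> (\<forall>i j. coeff (coeff r j) i \<noteq> 0 \<longrightarrow> 4 * i + 6 * j = k)"

lemma form_of_simps [simp]:
  "form_of 0 \<tau> = 0" "form_of 1 \<tau> = 1"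
  "form_of (p + q) \<tau> = form_of p \<tau> + form_of q \<tau>"
  "form_of (p - q) \<tau> = form_of p \<tau> - form_of q \<tau>"
  "form_of (p * q) \<tau> = form_of p \<tau> * form_of q \<tau>"
  "form_of (p ^ n) \<tau> = form_of p \<tau> ^ n"
  "form_of (smult c p) \<tau> = poly c (form_a \<tau>) * form_of p \<tau>"
  "form_of (pCons c p) \<tau> = poly c (form_a \<tau>) + form_b \<tau> * form_of p \<tau>"
  "form_of var_a \<tau> = form_a \<tau>" "form_of var_b \<tau> = form_b \<tau>"
  by (simp_all add: form_of_def var_a_def var_b_def poly_power)

lemma form_of_sum: "form_of (\<Sum>i\<in>A. p i) \<tau> = (\<Sum>i\<in>A. form_of (p i) \<tau>)"
  by (induction A rule: infinite_finite_induct) auto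

definition representable :: "nat \<Rightarrow> (complex \<Rightarrow> complex) \<Rightarrow> bool" where
  "representable k f \<longleftrightarrow> (\<exists>r. homogeneous k r \<and> (\<forall>\<tau>\<in>\<H>. form_of r \<tau> = f \<tau>))"

lemma representable_cong: "representable k f \<Longrightarrow> (\<And>\<tau>. \<tau> \<in> \<H> \<Longrightarrow> g \<tau> = f \<tau>) \<Longrightarrow> representable k g"
  by (auto simp: representable_def)

lemma representable_0: "representable k (\<lambda>\<tau>. 0)"
  unfolding representable_def by (intro exI[of _ 0]) (auto simp: homogeneous_def)

lemma representable_const: "representable 0 (\<lambda>\<tau>. c)"
  unfolding representable_def
  by (intro exI[of _ "[:[:c:]:]"]) (auto simp: homogeneous_def coeff_pCons split: nat.splits)

lemma representable_add: "representable k f \<Longrightarrow> representable k g \<Longrightarrow> representable k (\<lambda>\<tau>. f \<tau> + g \<tau>)"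
  unfolding representable_def
proof (elim exE conjE)
  fix r s assume "homogeneous k r" "homogeneous k s" "\<forall>\<tau>\<in>\<H>. form_of r \<tau> = f \<tau>" "\<forall>\<tau>\<in>\<H>. form_of s \<tau> = g \<tau>"
  then show "\<exists>r. homogeneous k r \<and> (\<forall>\<tau>\<in>\<H>. form_of r \<tau> = f \<tau> + g \<tau>)"
    by (intro exI[of _ "r + s"]) (auto simp: homogeneous_def, metis add_0)
qed

lemma representable_cmult: "representable k f \<Longrightarrow> representable k (\<lambda>\<tau>. c * f \<tau>)"
  unfolding representable_def
proof (elim exE conjE)
  fix r assume "homogeneous k r" "\<forall>\<tau>\<in>\<H>. form_of r \<tau> = f \<tau>"
  then show "\<exists>r. homogeneous k r \<and> (\<forall>\<tau>\<in>\<H>. form_of r \<tau> = c * f \<tau>)"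
    by (intro exI[of _ "smult [:c:] r"]) (auto simp: homogeneous_def)
qed

lemma representable_times_a: "representable k f \<Longrightarrow> representable (k + 4) (\<lambda>\<tau>. form_a \<tau> * f \<tau>)"
  unfolding representable_def
proof (elim exE conjE)
  fix r assume "homogeneous k r" "\<forall>\<tau>\<in>\<H>. form_of r \<tau> = f \<tau>"
  then show "\<exists>r. homogeneous (k + 4) r \<and> (\<forall>\<tau>\<in>\<H>. form_of r \<tau> = form_a \<tau> * f \<tau>)"
    by (intro exI[of _ "smult [:0, 1:] r"]) (auto simp: homogeneous_def coeff_pCons split: nat.splits)
qed

lemma representable_times_b: "representable k f \<Longrightarrow> representable (k + 6) (\<lambda>\<tau>. form_b \<tau> * f \<tau>)"
  unfolding representable_def
proof (elim exE conjE)
  fix r assume "homogeneous k r" "\<forall>\<tau>\<in>\<H>. form_of r \<tau> = f \<tau>"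
  then show "\<exists>r. homogeneous (k + 6) r \<and> (\<forall>\<tau>\<in>\<H>. form_of r \<tau> = form_b \<tau> * f \<tau>)"
    by (intro exI[of _ "pCons 0 r"]) (auto simp: homogeneous_def coeff_pCons split: nat.splits)
qed

lemma representable_monomial: "representable (4 * i + 6 * j) (\<lambda>\<tau>. form_a \<tau> ^ i * form_b \<tau> ^ j)"
proof (induction i)
  case 0
  show ?case
  proof (induction j)
    case (Suc j)
    then show ?case using representable_times_b[OF Suc.IH] by (simp add: mult_ac add_ac)
  qed (use representable_const[of 1] in simp)
next
  case (Suc i)
  then show ?case using representable_times_a[OF Suc.IH] by (simp add: mult_ac add_ac)
qed

lemma representable_times_disc:
  assumes "representable k f"
  shows "representable (k + 12) (\<lambda>\<tau>. disc \<tau> * f \<tau>)"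
proof -
  have "representable (k + 4 + 4 + 4) (\<lambda>\<tau>. 4 * (form_a \<tau> * (form_a \<tau> * (form_a \<tau> * f \<tau>))))"
    "representable (k + 6 + 6) (\<lambda>\<tau>. 27 * (form_b \<tau> * (form_b \<tau> * f \<tau>)))"
    by (intro representable_cmult representable_times_a representable_times_b assms)+
  then have "representable (k + 12) (\<lambda>\<tau>. 4 * (form_a \<tau> * (form_a \<tau> * (form_a \<tau> * f \<tau>))))"
    "representable (k + 12) (\<lambda>\<tau>. 27 * (form_b \<tau> * (form_b \<tau> * f \<tau>)))" by (simp_all add: add.assoc)
  then show ?thesis
    by (rule representable_cong[OF representable_add]) (simp add: disc_def algebra_simps power3_eq_cube power2_eq_square)
qed

text \<open>The discriminant has no zero in the upper half plane and a simple one at q = 0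
  (coefficient - 256). After one factor q is cancelled, the quotient of the two power series is
  holomorphic on the unit disc.\<close>

lemma modular_form_divide_disc:
  assumes "modular_form (k + 12) f" "q_expansion f F" "fps_nth F 0 = 0"
  shows "modular_form k (\<lambda>\<tau>. f \<tau> / disc \<tau>)"
proof -
  obtain G where G: "fps_conv_radius G \<ge> 1" "\<And>\<tau>. \<tau> \<in> \<H> \<Longrightarrow> f \<tau> = nome \<tau> ^ 1 * eval_fps G (nome \<tau>)"
    using q_expansion_vanishing_order[OF assms(2), of 1] assms(3) by auto
  obtain D where D: "fps_conv_radius D \<ge> 1" "fps_disc = fps_X ^ 1 * D" "\<And>\<tau>. \<tau> \<in> \<H> \<Longrightarrow> disc \<tau> = nome \<tau> ^ 1 * eval_fps D (nome \<tau>)"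
    using q_expansion_vanishing_order[OF q_expansion_disc, of 1] fps_disc_nth(1) by auto
  have lt: "ereal (norm q) < R" if "norm q < 1" "R \<ge> 1" for q :: complex and R
    using that less_le_trans[of "ereal (norm q)" 1] by simp
  have nz: "eval_fps D q \<noteq> 0" if q: "norm q < 1" for q
  proof (cases "q = 0")
    case True
    have "fps_nth fps_disc 1 = fps_nth D 0" unfolding D(2) by (simp add: fps_X_mult_nth)
    then show ?thesis using True fps_disc_nth(2) by (simp add: eval_fps_at_0)
  next
    case False
    obtain \<tau> where "\<tau> \<in> \<H>" "nome \<tau> = q" using nome_surj[OF False q] .
    then show ?thesis using disc_nonzero[of \<tau>] D(3)[of \<tau>] by auto
  qed
  have "(\<lambda>q. eval_fps G q / eval_fps D q) holomorphic_on ball 0 1"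
    by (intro holomorphic_on_divide holomorphic_on_eval_fps) (use lt G(1) D(1) nz in auto)
  then obtain F where "q_expansion (\<lambda>\<tau>. eval_fps G (nome \<tau>) / eval_fps D (nome \<tau>)) F"
    using q_expansion_holomorphic by blast
  then have "q_expansion (\<lambda>\<tau>. f \<tau> / disc \<tau>) F"
    by (rule q_expansion_cong) (simp add: G(2) D(3))
  moreover have "f (- 1 / \<tau>) / disc (- 1 / \<tau>) = \<tau> ^ k * (f \<tau> / disc \<tau>)" if "\<tau> \<in> \<H>" for \<tau>
    unfolding modular_formD(1)[OF assms(1) that] modular_formD(1)[OF modular_form_disc that]
    using upper_half_plane_S(2)[OF that] by (simp add: power_add)
  ultimately show ?thesis unfolding modular_form_def by blast
qed

text \<open>Applying the inversion twice yields the factor (- 1)^k.\<close>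

lemma modular_form_odd_weight:
  assumes "modular_form k f" "odd k" "\<tau> \<in> \<H>"
  shows "f \<tau> = 0"
proof -
  have "f (- 1 / (- 1 / \<tau>)) = (- 1 / \<tau>) ^ k * (\<tau> ^ k * f \<tau>)"
    using modular_formD(1)[OF assms(1) upper_half_plane_S(1)[OF assms(3)]] modular_formD(1)[OF assms(1,3)]
    by (simp only:)
  also have "\<dots> = (- 1 / \<tau> * \<tau>) ^ k * f \<tau>" by (simp only: power_mult_distrib mult.assoc)
  finally show ?thesis
    using assms(2) upper_half_plane_S(2)[OF assms(3)] by simp
qed

lemma q_expansion_const_term_power: "fps_nth (F ^ n) 0 = fps_nth F 0 ^ n"
  by (induction n) auto

text \<open>Let c be the constant term. The vanishing criterion gives f^2 = - 3 c^2 a and f^3 =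
  (27/2) c^3 b, and the two resulting values of f^6 give c^6 disc = 0. So c = 0, and the criterion
  applies to f itself.\<close>

lemma modular_form_weight_2:
  assumes "modular_form 2 f" "\<tau> \<in> \<H>"
  shows "f \<tau> = 0"
proof -
  obtain F where F: "q_expansion f F" using assms(1) by (auto simp: modular_form_def)
  define c where "c = fps_nth F 0"
  have a: "f \<tau> ^ 2 = - 3 * c ^ 2 * form_a \<tau>" if "\<tau> \<in> \<H>" for \<tau>
  proof -
    have "f \<tau> ^ 2 - - 3 * c ^ 2 * form_a \<tau> = 0"
    proof (rule modular_form_vanishes[where k = 4 and m = 1 and f = "\<lambda>\<tau>. f \<tau> ^ 2 - - 3 * c ^ 2 * form_a \<tau>"])
      show "modular_form 4 (\<lambda>\<tau>. f \<tau> ^ 2 - - 3 * c ^ 2 * form_a \<tau>)"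
        by (intro modular_form_diff modular_form_cmult modular_form_a)
          (use modular_form_power[OF assms(1), of 2] in simp)
      show "q_expansion (\<lambda>\<tau>. f \<tau> ^ 2 - - 3 * c ^ 2 * form_a \<tau>) (F ^ 2 - fps_const (- 3 * c ^ 2) * fps_a)"
        by (intro q_expansion_diff q_expansion_cmult q_expansion_power q_expansion_form_a F)
    qed (use that in \<open>auto simp: q_expansion_const_term_power c_def fps_a_def\<close>)
    then show ?thesis by (subst eq_iff_diff_eq_0)
  qed
  have b: "f \<tau> ^ 3 = 27/2 * c ^ 3 * form_b \<tau>" if "\<tau> \<in> \<H>" for \<tau>
  proof -
    have "f \<tau> ^ 3 - 27/2 * c ^ 3 * form_b \<tau> = 0"
    proof (rule modular_form_vanishes[where k = 6 and m = 1 and f = "\<lambda>\<tau>. f \<tau> ^ 3 - 27/2 * c ^ 3 * form_b \<tau>"])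
      show "modular_form 6 (\<lambda>\<tau>. f \<tau> ^ 3 - 27/2 * c ^ 3 * form_b \<tau>)"
        by (intro modular_form_diff modular_form_cmult modular_form_b)
          (use modular_form_power[OF assms(1), of 3] in simp)
      show "q_expansion (\<lambda>\<tau>. f \<tau> ^ 3 - 27/2 * c ^ 3 * form_b \<tau>) (F ^ 3 - fps_const (27/2 * c ^ 3) * fps_b)"
        by (intro q_expansion_diff q_expansion_cmult q_expansion_power q_expansion_form_b F)
    qed (use that in \<open>auto simp: q_expansion_const_term_power c_def fps_b_def\<close>)
    then show ?thesis by simp
  qed
  have "c = 0"
  proof (rule ccontr)
    assume "c \<noteq> 0"
    have "f \<tau> ^ 6 = (f \<tau> ^ 2) ^ 3" "f \<tau> ^ 6 = (f \<tau> ^ 3) ^ 2" by (simp_all flip: power_mult)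
    then have e: "(- 3 * c ^ 2 * form_a \<tau>) ^ 3 = (27/2 * c ^ 3 * form_b \<tau>) ^ 2"
      unfolding a[OF assms(2)] b[OF assms(2)] by simp
    have "c ^ 6 * disc \<tau> = - (4/27) * ((- 3 * c ^ 2 * form_a \<tau>) ^ 3 - (27/2 * c ^ 3 * form_b \<tau>) ^ 2)"
      by (simp add: disc_def algebra_simps power_mult_distrib power_divide flip: power_mult)
    then have "c ^ 6 * disc \<tau> = 0" unfolding e by simp
    then show False using \<open>c \<noteq> 0\<close> disc_nonzero[OF assms(2)] by simp
  qed
  then show ?thesis
    by (intro modular_form_vanishes[OF assms(1) F, of 1]) (use assms(2) in \<open>auto simp: c_def\<close>)
qed

text \<open>Subtracting a multiple of one monomial a^i b^j of the same weight removes the constant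
  term; division by the discriminant then lowers the weight by 12. Odd weights and weight 2, which
  have no monomial, carry only the zero form.\<close>

theorem modular_form_representable: "modular_form k f \<Longrightarrow> representable k f"
proof (induction k arbitrary: f rule: less_induct)
  case (less k)
  have cusp: "representable k g" if g: "modular_form k g" "q_expansion g G" "fps_nth G 0 = 0" for g G
  proof (cases "k \<le> 10")
    case True
    then have "g \<tau> = 0" if "\<tau> \<in> \<H>" for \<tau>
      using modular_form_vanishes[OF g(1,2), of 1] g(3) that by auto
    then show ?thesis using representable_cong[OF representable_0] by blast
  next
    case False
    show ?thesis
    proof (cases "k = 11")
      case True
      then show ?thesis
        using modular_form_odd_weight[OF g(1)] representable_cong[OF representable_0] by auto
    next
      case False
      with \<open>\<not> k \<le> 10\<close> have "12 \<le> k" by linarith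
      then obtain l where l: "k = l + 12" by (metis le_add_diff_inverse2)
      then have "representable l (\<lambda>\<tau>. g \<tau> / disc \<tau>)"
        using modular_form_divide_disc[of l g G] g by (intro less.IH) auto
      then have "representable k (\<lambda>\<tau>. disc \<tau> * (g \<tau> / disc \<tau>))"
        unfolding l by (rule representable_times_disc)
      then show ?thesis by (rule representable_cong) (simp add: disc_nonzero)
    qed
  qed
  consider "odd k" | "k = 2" | i j where "k = 4 * i + 6 * j"
  proof -
    have "k = 4 * (k div 4) + 6 * 0 \<or> k = 4 * ((k - 6) div 4) + 6 * 1" if "even k" "k \<noteq> 2"
      using that by presburger
    then show ?thesis using that by blast
  qed
  then show ?case
  proof cases
    case 1
    then show ?thesis
      using modular_form_odd_weight[OF less.prems] representable_cong[OF representable_0] by auto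
  next
    case 2
    then show ?thesis
      using modular_form_weight_2 less.prems representable_cong[OF representable_0] by blast
  next
    case 3
    obtain F where F: "q_expansion f F" using less.prems by (auto simp: modular_form_def)
    let ?m = "\<lambda>\<tau>. form_a \<tau> ^ i * form_b \<tau> ^ j" and ?M = "fps_a ^ i * fps_b ^ j"
    have m: "modular_form k ?m" "q_expansion ?m ?M"
      using modular_form_mult[OF modular_form_power[OF modular_form_a] modular_form_power[OF modular_form_b]]
      by (auto simp: 3 intro!: q_expansion_mult q_expansion_power q_expansion_form_a q_expansion_form_b)
    define c where "c = fps_nth F 0 / fps_nth ?M 0"
    have "fps_nth ?M 0 \<noteq> 0"
      by (simp add: q_expansion_const_term_power fps_a_def fps_b_def)
    then have "fps_nth (F - fps_const c * ?M) 0 = 0"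
      by (simp add: c_def)
    then have "representable k (\<lambda>\<tau>. f \<tau> - c * ?m \<tau>)"
      by (intro cusp[of _ "F - fps_const c * ?M"] modular_form_diff modular_form_cmult q_expansion_diff q_expansion_cmult m F less.prems)
    moreover have "representable k (\<lambda>\<tau>. c * ?m \<tau>)"
      using representable_cmult[OF representable_monomial[of i j]] by (simp add: 3)
    ultimately show ?thesis
      by (rule representable_cong[OF representable_add]) simp
  qed
qed

lemma q_expansion_form_of: "\<exists>F. q_expansion (form_of r) F"
proof (induction r)
  case 0
  then show ?case using q_expansion_const[of 0] by auto
next
  case (pCons c r)
  then obtain F where F: "q_expansion (form_of r) F" by blast
  have "\<exists>G. q_expansion (\<lambda>\<tau>. poly c (form_a \<tau>)) G"
  proof (induction c)
    case 0
    then show ?case using q_expansion_const[of 0] by auto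
  next
    case (pCons d c)
    then show ?case
      using q_expansion_add[OF q_expansion_const q_expansion_mult[OF q_expansion_form_a]] by fastforce
  qed
  then obtain G where "q_expansion (\<lambda>\<tau>. poly c (form_a \<tau>)) G" ..
  then have "q_expansion (\<lambda>\<tau>. poly c (form_a \<tau>) + form_b \<tau> * form_of r \<tau>) (G + fps_b * F)"
    by (intro q_expansion_add q_expansion_mult q_expansion_form_b F)
  then show ?case by (auto intro: q_expansion_cong)
qed

text \<open>
  The form \<open>b\<close> vanishes on the orbit of \<open>\<i>\<close>, where \<open>a\<close> takes infinitely many values.
\<close>

theorem form_of_eq_0:
  assumes "\<And>\<tau>. \<tau> \<in> \<H> \<Longrightarrow> form_of r \<tau> = 0"
  shows "r = 0"
  using assms
proof (induction r)
  case (pCons c r)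
  have i: "\<i> \<in> \<H>" by (simp add: upper_half_plane_def)
  have "form_b \<i> = 0"
    using modular_formD(1)[OF modular_form_b i] by (simp add: eval_nat_numeral)
  then have a: "form_a \<i> \<noteq> 0" using disc_nonzero[OF i] by (auto simp: disc_def)
  define t where "t = (\<lambda>n::nat. - 1 / (\<i> + of_int (int n)))"
  have in_H: "\<i> + of_int (int n) \<in> \<H>" for n by (simp add: upper_half_plane_def)
  have t: "t n \<in> \<H>" "form_b (t n) = 0" "form_a (t n) = (\<i> + of_int (int n)) ^ 4 * form_a \<i>" for n
    using upper_half_plane_S(1)[OF in_H] modular_formD(1)[OF modular_form_b in_H, of n]
      modular_formD(1)[OF modular_form_a in_H, of n] modular_formD(2)[OF modular_form_a i, of "int n"]
      modular_formD(2)[OF modular_form_b i, of "int n"] \<open>form_b \<i> = 0\<close>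
    by (auto simp: t_def)
  have "c = 0"
  proof (rule ccontr)
    assume "c \<noteq> 0"
    have "poly c (form_a (t n)) = 0" for n
      using pCons.prems[OF t(1)[of n]] t(2)[of n] by simp
    then have "range (\<lambda>n. form_a (t n)) \<subseteq> {x. poly c x = 0}" by auto
    then have "finite (range (\<lambda>n. form_a (t n)))"
      using poly_roots_finite[OF \<open>c \<noteq> 0\<close>] finite_subset by blast
    moreover have "inj (\<lambda>n. form_a (t n))"
    proof (rule injI)
      fix m n assume "form_a (t m) = form_a (t n)"
      then have "(\<i> + of_int (int m)) ^ 4 = (\<i> + of_int (int n)) ^ 4" using a by (simp add: t(3))
      then have "norm (\<i> + of_int (int m)) ^ 4 = norm (\<i> + of_int (int n)) ^ 4" by (metis norm_power)
      then have "norm (\<i> + of_int (int m)) = norm (\<i> + of_int (int n))"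
        by (rule power_eq_imp_eq_base) auto
      then show "m = n" by (simp add: cmod_def)
    qed
    ultimately show False using finite_imageD by fastforce
  qed
  moreover have "r = 0"
  proof (rule pCons.IH)
    \<comment> \<open>What remains of the relation is b times the form of \<open>r\<close>; b is
      cancelled in the ring of power series, which has no zero divisors.\<close>
    obtain F where F: "q_expansion (form_of r) F" using q_expansion_form_of by blast
    have e: "q_expansion (\<lambda>\<tau>. 0) (fps_b * F)"
      by (rule q_expansion_cong[OF q_expansion_mult[OF q_expansion_form_b F]])
        (use pCons.prems \<open>c = 0\<close> in auto)
    have "fps_b * F = 0"
      using q_expansion_unique[OF e q_expansion_const[of 0]] by simp
    moreover have "fps_nth fps_b 0 \<noteq> 0" by (simp add: fps_b_def)
    then have "fps_b \<noteq> 0" by auto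
    ultimately have "F = 0" by simp
    then show "form_of r \<tau> = 0" if "\<tau> \<in> \<H>" for \<tau>
      using q_expansionD(2)[OF F that] by simp
  qed
  ultimately show ?case by simp
qed simp

corollary form_of_inject: "(\<And>\<tau>. \<tau> \<in> \<H> \<Longrightarrow> form_of r \<tau> = form_of s \<tau>) \<Longrightarrow> r = s"
  using form_of_eq_0[of "r - s"] by simp

section \<open>Hecke operators and the complex denominator\<close>

text \<open>The indices form the projective line over the field with N elements, with
  \<open>t = N\<close> as the point at infinity. The factor N^k makes these functions one family
  permuted by the weight k action: translation acts by t -> t + 1, inversion by t -> - 1/t.\<close>

definition isogenous :: "nat \<Rightarrow> nat \<Rightarrow> (complex \<Rightarrow> complex) \<Rightarrow> nat \<Rightarrow> complex \<Rightarrow> complex" where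
  "isogenous N k f t \<tau> = (if t < N then f ((\<tau> + of_nat t) / of_nat N) else of_nat N ^ k * f (of_nat N * \<tau>))"

lemma sum_isogenous:
  "(\<Sum>t\<le>N. isogenous N k f t \<tau> ^ i * isogenous N l g t \<tau> ^ j) =
    (\<Sum>t<N. f ((\<tau> + of_nat t) / of_nat N) ^ i * g ((\<tau> + of_nat t) / of_nat N) ^ j) +
    of_nat N ^ (k * i + l * j) * (f (of_nat N * \<tau>) ^ i * g (of_nat N * \<tau>) ^ j)"
  by (simp add: lessThan_Suc_atMost[symmetric] isogenous_def power_mult_distrib power_mult[symmetric] power_add)

lemma upper_half_plane_divide: "\<tau> \<in> \<H> \<Longrightarrow> N > 0 \<Longrightarrow> (\<tau> + of_nat t) / of_nat N \<in> \<H>"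
  by (simp add: upper_half_plane_def)

lemma upper_half_plane_times: "\<tau> \<in> \<H> \<Longrightarrow> N > 0 \<Longrightarrow> of_nat N * \<tau> \<in> \<H>"
  by (simp add: upper_half_plane_def)

lemma upper_half_plane_plus: "\<tau> \<in> \<H> \<Longrightarrow> \<tau> + of_nat n \<in> \<H>"
  by (simp add: upper_half_plane_def)

text \<open>Stated for all matrices and not only for the generators, because
  \<open>isogenous_S\<close> applies it to a matrix with lower left entry N.\<close>

definition full_modular :: "nat \<Rightarrow> (complex \<Rightarrow> complex) \<Rightarrow> bool" where
  "full_modular k f \<longleftrightarrow> (\<forall>\<tau>\<in>\<H>. \<forall>a b c d :: int. a * d - b * c = 1 \<longrightarrow>
     f ((of_int a * \<tau> + of_int b) / (of_int c * \<tau> + of_int d)) = (of_int c * \<tau> + of_int d) ^ k * f \<tau>)"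

lemma full_modularD:
  assumes "full_modular k f" "\<tau> \<in> \<H>"
  shows "f (\<tau> + of_nat n) = f \<tau>" "f (- 1 / \<tau>) = \<tau> ^ k * f \<tau>"
    "a * d - b * c = 1 \<Longrightarrow> f ((of_int a * \<tau> + of_int b) / (of_int c * \<tau> + of_int d)) = (of_int c * \<tau> + of_int d) ^ k * f \<tau>"
proof -
  show *: "a * d - b * c = 1 \<Longrightarrow> f ((of_int a * \<tau> + of_int b) / (of_int c * \<tau> + of_int d)) = (of_int c * \<tau> + of_int d) ^ k * f \<tau>" for a b c d
    using assms unfolding full_modular_def by blast
  show "f (\<tau> + of_nat n) = f \<tau>" using *[of 1 1 "int n" 0] by simp
  show "f (- 1 / \<tau>) = \<tau> ^ k * f \<tau>" using *[of 0 0 "-1" 1] by simp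
qed

lemma full_modular_forms: "full_modular 4 form_a" "full_modular 6 form_b"
  using form_modular by (auto simp: full_modular_def)

lemma isogenous_T:
  assumes "N > 0" "full_modular k f" "\<tau> \<in> \<H>" "t \<le> N"
  shows "isogenous N k f t (\<tau> + 1) = isogenous N k f (if t = N then N else Suc t mod N) \<tau>"
proof -
  consider "t = N" | "Suc t < N" | "Suc t = N" using assms(4) by linarith
  then show ?thesis
  proof cases
    case 1
    then show ?thesis
      using full_modularD(1)[OF assms(2) upper_half_plane_times[OF assms(3,1)], of N]
      by (simp add: isogenous_def algebra_simps)
  next
    case 2
    then show ?thesis by (simp add: isogenous_def algebra_simps)
  next
    case 3
    then have "(\<tau> + 1 + of_nat t) / of_nat N = (\<tau> + of_nat 0) / of_nat N + of_nat 1"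
      by (auto simp: field_simps)
    then show ?thesis
      using 3 full_modularD(1)[OF assms(2) upper_half_plane_divide[OF assms(3,1), of 0], of 1]
      by (simp add: isogenous_def)
  qed
qed

lemma bij_betw_shift: "N > 0 \<Longrightarrow> bij_betw (\<lambda>t. if t = N then N else Suc t mod N) {..N} {..N::nat}"
proof -
  assume N: "N > 0"
  let ?s = "\<lambda>t. if t = N then N else Suc t mod N"
  have "inj_on ?s {..N}"
  proof (rule inj_onI)
    fix x y assume "x \<in> {..N}" "y \<in> {..N}" "?s x = ?s y"
    then show "x = y"
      using N mod_less_divisor[of N "Suc x"] mod_less_divisor[of N "Suc y"]
      by (auto simp: mod_Suc split: if_splits)
  qed
  moreover have "?s ` {..N} \<subseteq> {..N}" using N by (auto intro: less_imp_le)
  ultimately show ?thesis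
    using endo_inj_surj[of "{..N}" ?s] by (auto simp: bij_betw_def)
qed

text \<open>For 0 < t < N take t' with t t' + 1 = N y. The matrix with rows (t, - y) and (N, - t')
  has determinant 1, sends (\<tau> + t')/N to (- 1/\<tau> + t)/N and has automorphy factor \<tau>
  there. The permutation does not depend on the form, so the values of \<open>a\<close> and
  \<open>b\<close> are moved together.\<close>

lemma isogenous_S:
  assumes "prime N"
  obtains \<sigma> where "bij_betw \<sigma> {..N} {..N}"
    "\<And>k f t \<tau>. full_modular k f \<Longrightarrow> \<tau> \<in> \<H> \<Longrightarrow> t \<le> N \<Longrightarrow>
       isogenous N k f t (- 1 / \<tau>) = \<tau> ^ k * isogenous N k f (\<sigma> t) \<tau>"
proof -
  have N: "N > 0" using assms prime_gt_0_nat by blast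
  have "\<exists>s. 0 < s \<and> s < N \<and> N dvd t * s + 1" if t: "0 < t" "t < N" for t
  proof -
    have "coprime t N" using t assms by (metis coprime_commute nat_dvd_not_less prime_imp_coprime)
    then obtain x where x: "[t * x = 1] (mod N)" using cong_solve_coprime_nat by (metis One_nat_def)
    \<comment> \<open>This is - x modulo N, written with natural numbers.\<close>
    let ?s = "(x * (N - 1)) mod N"
    have "[t * ?s + 1 = t * (x * (N - 1)) + 1] (mod N)"
      by (intro cong_add cong_mult) (auto simp: cong_def)
    also have "t * (x * (N - 1)) + 1 = (t * x) * (N - 1) + 1" by simp
    also have "[(t * x) * (N - 1) + 1 = 1 * (N - 1) + 1] (mod N)"
      by (intro cong_add cong_mult x) auto
    also have "1 * (N - 1) + 1 = N" using N by simp
    finally have "N dvd t * ?s + 1" by (simp add: cong_0_iff[symmetric] cong_def)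
    moreover have "?s \<noteq> 0"
    proof
      assume "?s = 0"
      then have "N dvd 1" using \<open>N dvd t * ?s + 1\<close> by simp
      then show False using assms by (simp add: prime_nat_iff)
    qed
    ultimately show ?thesis using N by (intro exI[of _ ?s]) auto
  qed
  then obtain \<rho> where \<rho>: "\<And>t. 0 < t \<Longrightarrow> t < N \<Longrightarrow> 0 < \<rho> t \<and> \<rho> t < N \<and> N dvd t * \<rho> t + 1"
    by metis
  define \<sigma> where "\<sigma> t = (if t = 0 then N else if t = N then 0 else \<rho> t)" for t
  have "inj_on \<sigma> {..N}"
  proof (rule inj_onI)
    fix x y assume xy: "x \<in> {..N}" "y \<in> {..N}" "\<sigma> x = \<sigma> y"
    show "x = y"
    proof (cases "0 < x \<and> x < N \<and> 0 < y \<and> y < N")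
      case True
      then have e: "\<rho> x = \<rho> y" using xy by (simp add: \<sigma>_def)
      have "int N dvd (int x * int (\<rho> x) + 1) - (int y * int (\<rho> x) + 1)"
      proof (rule dvd_diff)
        show "int N dvd int x * int (\<rho> x) + 1"
          using \<rho>[of x] True by (metis int_dvd_int_iff of_nat_1 of_nat_add of_nat_mult)
        show "int N dvd int y * int (\<rho> x) + 1"
          unfolding e using \<rho>[of y] True by (metis int_dvd_int_iff of_nat_1 of_nat_add of_nat_mult)
      qed
      also have "(int x * int (\<rho> x) + 1) - (int y * int (\<rho> x) + 1) = (int x - int y) * int (\<rho> x)"
        by (simp add: algebra_simps)
      finally have "int N dvd (int x - int y) \<or> int N dvd int (\<rho> x)"
        using assms by (simp add: prime_dvd_mult_iff)
      moreover have "\<not> int N dvd int (\<rho> x)"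
        using \<rho>[of x] True by (auto dest: nat_dvd_not_less)
      ultimately have "int N dvd int x - int y" by blast
      then have "\<bar>int N\<bar> \<le> \<bar>int x - int y\<bar>" if "x \<noteq> y"
        using that by (intro dvd_imp_le_int) auto
      then show ?thesis using True by linarith
    next
      case False
      then show ?thesis using xy \<rho>[of x] \<rho>[of y] N by (auto simp: \<sigma>_def split: if_splits)
    qed
  qed
  moreover have "\<sigma> ` {..N} \<subseteq> {..N}" 
  proof (rule image_subsetI)
    show "\<sigma> t \<in> {..N}" if "t \<in> {..N}" for t using that \<rho>[of t] by (auto simp: \<sigma>_def)
  qed
  ultimately have "bij_betw \<sigma> {..N} {..N}"
    using endo_inj_surj[of "{..N}" \<sigma>] by (auto simp: bij_betw_def)
  moreover have "isogenous N k f t (- 1 / \<tau>) = \<tau> ^ k * isogenous N k f (\<sigma> t) \<tau>"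
    if f: "full_modular k f" and \<tau>: "\<tau> \<in> \<H>" and t: "t \<le> N" for k f t \<tau>
  proof -
    have \<tau>0: "\<tau> \<noteq> 0" using upper_half_plane_S(2)[OF \<tau>] .
    consider "t = 0" | "t = N" | "0 < t" "t < N" using t by linarith
    then show ?thesis
    proof cases
      case 1
      have "(- 1 / \<tau> + of_nat 0) / of_nat N = - 1 / (of_nat N * \<tau>)" using N \<tau>0 by simp
      then show ?thesis
        using 1 N full_modularD(2)[OF f upper_half_plane_times[OF \<tau> N]]
        by (simp add: isogenous_def \<sigma>_def power_mult_distrib mult_ac)
    next
      case 2
      have "of_nat N * (- 1 / \<tau>) = - 1 / ((\<tau> + of_nat 0) / of_nat N)" using N \<tau>0 by simp
      then show ?thesis
        using 2 N full_modularD(2)[OF f upper_half_plane_divide[OF \<tau> N, of 0]]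
        by (simp add: isogenous_def \<sigma>_def power_divide)
    next
      case 3
      define t' where "t' = \<rho> t"
      have t': "t' < N" "N dvd t * t' + 1" using \<rho>[OF 3] by (auto simp: t'_def)
      then obtain y where y: "t * t' + 1 = N * y" by (auto elim: dvdE)
      let ?z = "(\<tau> + of_nat t') / of_nat N"
      have det: "int t * (- int t') - (- int y) * int N = 1"
      proof -
        have "int (t * t' + 1) = int (N * y)" by (simp only: y)
        then show ?thesis by (simp add: algebra_simps)
      qed
      have yc: "of_nat N * of_nat y = of_nat t * of_nat t' + (1 :: complex)"
        using y by (metis of_nat_1 of_nat_add of_nat_mult)
      have den: "of_int (int N) * ?z + of_int (- int t') = \<tau>" using N by simp
      have num: "of_int (int t) * ?z + of_int (- int y) = (of_nat t * \<tau> - 1) / of_nat N"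
        using N yc by (simp add: field_simps)
      have "f (((of_nat t * \<tau> - 1) / of_nat N) / \<tau>) = \<tau> ^ k * f ?z"
        using full_modularD(3)[OF f upper_half_plane_divide[OF \<tau> N] det, of t'] unfolding den num .
      moreover have "((of_nat t * \<tau> - 1) / of_nat N) / \<tau> = (- 1 / \<tau> + of_nat t) / of_nat N"
        using N \<tau>0 by (simp add: field_simps)
      ultimately show ?thesis
        using 3 t' by (simp add: isogenous_def \<sigma>_def t'_def)
    qed
  qed
  ultimately show ?thesis using that by blast
qed

section \<open>Fourier expansions of Hecke images and symmetric functions\<close>

lemma sum_nome_roots:
  assumes "N > 0"
  shows "(\<Sum>t<N. nome ((\<tau> + of_nat t) / of_nat N) ^ n) = (if N dvd n then of_nat N * nome (\<tau> / of_nat N) ^ n else 0)"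
proof -
  define w where "w = exp (2 * of_real pi * \<i> * of_nat n / of_nat N)"
  have "nome ((\<tau> + of_nat t) / of_nat N) ^ n = nome (\<tau> / of_nat N) ^ n * w ^ t" for t
    unfolding nome_def w_def exp_of_nat_mult[symmetric] exp_add[symmetric]
    by (rule arg_cong[of _ _ exp]) (simp add: algebra_simps add_divide_distrib)
  then have "(\<Sum>t<N. nome ((\<tau> + of_nat t) / of_nat N) ^ n) = nome (\<tau> / of_nat N) ^ n * (\<Sum>t<N. w ^ t)"
    by (simp add: sum_distrib_left)
  moreover have "w ^ N = 1"
  proof -
    have "w ^ N = exp (of_nat n * (2 * of_real pi * \<i>))"
      using assms unfolding w_def exp_of_nat_mult[symmetric] by (simp add: mult_ac)
    then show ?thesis using exp_integer_2pi[of "of_nat n"] by (simp add: mult_ac)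
  qed
  moreover have "w = 1 \<longleftrightarrow> N dvd n"
    using complex_root_unity_eq_1[of N n] assms by (simp add: w_def)
  ultimately show ?thesis
    by (auto simp: sum_gp_strict)
qed

text \<open>Summing over the N-th roots of unity keeps exactly the exponents divisible by N.\<close>

lemma decimation_sums:
  assumes "N > 0" "\<And>\<tau>. \<tau> \<in> \<H> \<Longrightarrow> (\<lambda>n. c n * nome \<tau> ^ n) sums f \<tau>" "\<tau> \<in> \<H>"
  shows "(\<lambda>n. of_nat N * c (N * n) * nome \<tau> ^ n) sums (\<Sum>t<N. f ((\<tau> + of_nat t) / of_nat N))"
proof -
  have "(\<lambda>n. \<Sum>t<N. c n * nome ((\<tau> + of_nat t) / of_nat N) ^ n) sums (\<Sum>t<N. f ((\<tau> + of_nat t) / of_nat N))"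
    by (intro sums_sum assms(2) upper_half_plane_divide assms)
  then have s: "(\<lambda>n. c n * (if N dvd n then of_nat N * nome (\<tau> / of_nat N) ^ n else 0)) sums (\<Sum>t<N. f ((\<tau> + of_nat t) / of_nat N))"
    by (simp add: sum_distrib_left[symmetric] sum_nome_roots[OF assms(1)])
  have "(\<lambda>m. c (N * m) * (if N dvd N * m then of_nat N * nome (\<tau> / of_nat N) ^ (N * m) else 0)) sums (\<Sum>t<N. f ((\<tau> + of_nat t) / of_nat N))"
    by (rule sums_mono_reindex[of "\<lambda>m. N * m", THEN iffD2, OF _ _ s])
      (use assms(1) in \<open>auto simp: strict_mono_def\<close>)
  moreover have "nome (\<tau> / of_nat N) ^ N = nome \<tau>"
    using assms(1) by (simp add: nome_def exp_of_nat_mult[symmetric])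
  then have "nome (\<tau> / of_nat N) ^ (N * m) = nome \<tau> ^ m" for m by (simp only: power_mult)
  then have "c (N * m) * (if N dvd N * m then of_nat N * nome (\<tau> / of_nat N) ^ (N * m) else 0) = of_nat N * c (N * m) * nome \<tau> ^ m" for m
    by simp
  ultimately show ?thesis by (simp only:)
qed

lemma q_expansion_multiple:
  assumes "q_expansion f F" "M > 0"
  shows "q_expansion (\<lambda>\<tau>. f (of_nat M * \<tau>)) (Abs_fps (\<lambda>n. if M dvd n then fps_nth F (n div M) else 0))"
proof (rule q_expansionI)
  fix \<tau> assume \<tau>: "\<tau> \<in> \<H>"
  have e: "nome (of_nat M * \<tau>) = nome \<tau> ^ M"
    by (simp add: nome_def exp_of_nat_mult[symmetric] mult_ac)
  have "(\<lambda>n. fps_nth F n * nome \<tau> ^ (M * n)) sums f (of_nat M * \<tau>)"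
    using q_expansionD(3)[OF assms(1) upper_half_plane_times[OF \<tau> assms(2)]] unfolding e by (simp add: power_mult)
  then show "(\<lambda>n. fps_nth (Abs_fps (\<lambda>n. if M dvd n then fps_nth F (n div M) else 0)) n * nome \<tau> ^ n) sums f (of_nat M * \<tau>)"
    using assms(2) by (subst sums_mono_reindex[of "\<lambda>n. M * n", symmetric]) (auto simp: strict_mono_def)
qed

lemma q_expansion_shift:
  assumes "q_expansion f F" "Im z = 0"
  shows "q_expansion (\<lambda>\<tau>. f (\<tau> + z)) (Abs_fps (\<lambda>n. fps_nth F n * nome z ^ n))"
proof (rule q_expansionI)
  fix \<tau> assume "\<tau> \<in> \<H>"
  then have "\<tau> + z \<in> \<H>" using assms(2) by (simp add: upper_half_plane_def)
  moreover have "nome (\<tau> + z) = nome \<tau> * nome z"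
    by (simp add: nome_def exp_add[symmetric] algebra_simps)
  ultimately show "(\<lambda>n. fps_nth (Abs_fps (\<lambda>n. fps_nth F n * nome z ^ n)) n * nome \<tau> ^ n) sums f (\<tau> + z)"
    using q_expansionD(3)[OF assms(1), of "\<tau> + z"] by (simp add: power_mult_distrib mult_ac)
qed

text \<open>A single function f((\<tau> + t)/N) expands only in powers of q^(1/N). Rescaling \<tau>
  to N \<tau> turns this into a power series in q.\<close>

lemma q_expansion_isogenous:
  assumes "q_expansion f F" "N > 0"
  shows "\<exists>G. q_expansion (\<lambda>\<tau>. isogenous N k f t (of_nat N * \<tau>)) G"
proof (cases "t < N")
  case True
  have "(of_nat N * \<tau> + of_nat t) / of_nat N = \<tau> + of_nat t / of_nat N" for \<tau> :: complex
    using assms(2) by (simp add: field_simps)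
  then show ?thesis
    using True q_expansion_shift[OF assms(1), of "of_nat t / of_nat N"] by (auto simp: isogenous_def)
next
  case False
  then show ?thesis
    using q_expansion_cmult[OF q_expansion_multiple[OF assms(1), of "N * N"], of "of_nat N ^ k"] assms(2)
    by (auto simp: isogenous_def mult.assoc)
qed

text \<open>For a function of period 1, averaging over the translates \<tau> + t shows that only
  integral powers of q survive in its expansion in q^(1/N).\<close>

lemma q_expansion_descend:
  assumes "N > 0" "q_expansion (\<lambda>\<tau>. f (of_nat N * \<tau>)) G" "\<And>\<tau>. \<tau> \<in> \<H> \<Longrightarrow> f (\<tau> + 1) = f \<tau>"
  shows "\<exists>F. q_expansion f F"
proof (intro exI q_expansionI)
  fix \<tau> assume \<tau>: "\<tau> \<in> \<H>"
  have per: "f (\<tau> + of_nat t) = f \<tau>" for t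
  proof (induction t)
    case (Suc t)
    then show ?case using assms(3)[OF upper_half_plane_plus[OF \<tau>, of t]] by (simp add: add_ac)
  qed simp
  have "(\<lambda>n. of_nat N * fps_nth G (N * n) * nome \<tau> ^ n) sums (\<Sum>t<N. f (of_nat N * ((\<tau> + of_nat t) / of_nat N)))"
    using decimation_sums[OF assms(1) q_expansionD(3)[OF assms(2)] \<tau>] .
  also have "(\<Sum>t<N. f (of_nat N * ((\<tau> + of_nat t) / of_nat N))) = of_nat N * f \<tau>"
    using assms(1) by (simp add: per)
  finally have "(\<lambda>n. (of_nat N * fps_nth G (N * n) * nome \<tau> ^ n) / of_nat N) sums (of_nat N * f \<tau> / of_nat N)"
    by (rule sums_divide)
  then show "(\<lambda>n. fps_nth (Abs_fps (\<lambda>n. fps_nth G (N * n))) n * nome \<tau> ^ n) sums f \<tau>"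
    using assms(1) by simp
qed

text \<open>Up to sign the coefficient is an elementary symmetric function of degree i.\<close>

lemma coeff_prod_linear_scale:
  fixes g :: "'b \<Rightarrow> 'a :: comm_ring_1"
  shows "coeff (\<Prod>t\<in>A. [:1, - (c * g t):]) i = c ^ i * coeff (\<Prod>t\<in>A. [:1, - g t:]) i"
proof (induction A arbitrary: i rule: infinite_finite_induct)
  case (insert x A)
  show ?case
  proof (cases i)
    case (Suc i')
    then show ?thesis using insert by (simp add: mult_pCons_left coeff_pCons algebra_simps)
  qed (use insert in \<open>simp add: mult_pCons_left\<close>)
qed (auto simp: coeff_1)

lemma q_expansion_coeff_prod_linear:
  assumes "finite A" "\<And>t. t \<in> A \<Longrightarrow> \<exists>F. q_expansion (g t) F"
  shows "\<exists>F. q_expansion (\<lambda>\<tau>. coeff (\<Prod>t\<in>A. [:1, - g t \<tau>:]) i) F"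
  using assms
proof (induction A arbitrary: i rule: finite_induct)
  case empty
  have "\<exists>F. q_expansion (\<lambda>\<tau>. c) F" for c using q_expansion_const by blast
  then show ?case by simp
next
  case (insert x A)
  obtain G where G: "q_expansion (g x) G" using insert.prems by blast
  obtain F where F: "q_expansion (\<lambda>\<tau>. coeff (\<Prod>t\<in>A. [:1, - g t \<tau>:]) i) F" using insert by blast
  show ?case
  proof (cases i)
    case 0
    then show ?thesis using F insert by (auto simp: mult_pCons_left)
  next
    case (Suc i')
    obtain F' where "q_expansion (\<lambda>\<tau>. coeff (\<Prod>t\<in>A. [:1, - g t \<tau>:]) i') F'" using insert by blast
    then have "q_expansion (\<lambda>\<tau>. coeff (\<Prod>t\<in>A. [:1, - g t \<tau>:]) i - g x \<tau> * coeff (\<Prod>t\<in>A. [:1, - g t \<tau>:]) i') (F - G * F')"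
      by (intro q_expansion_diff q_expansion_mult F G)
    then show ?thesis using insert.hyps Suc by (auto simp: mult_pCons_left)
  qed
qed

text \<open>Translation and inversion permute the factors, the latter up to scaling by \<tau>^k.
  Since the single factors expand only in q^(1/N), the coefficient is expanded there first and
  descends to q by its invariance under translation.\<close>

lemma modular_form_coeff_prod_isogenous:
  assumes "prime N" "full_modular k f" "q_expansion f F"
  shows "modular_form (k * i) (\<lambda>\<tau>. coeff (\<Prod>t\<le>N. [:1, - isogenous N k f t \<tau>:]) i)"
proof -
  have N: "N > 0" using assms(1) prime_gt_0_nat by blast
  let ?e = "\<lambda>\<tau>. coeff (\<Prod>t\<le>N. [:1, - isogenous N k f t \<tau>:]) i"
  obtain \<sigma> where \<sigma>: "bij_betw \<sigma> {..N} {..N}"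
    "\<And>\<tau> t. \<tau> \<in> \<H> \<Longrightarrow> t \<le> N \<Longrightarrow> isogenous N k f t (- 1 / \<tau>) = \<tau> ^ k * isogenous N k f (\<sigma> t) \<tau>"
    using isogenous_S[OF assms(1)] assms(2) by metis
  have "\<exists>G. q_expansion ?e G"
  proof -
    have "\<exists>G. q_expansion (\<lambda>\<tau>. ?e (of_nat N * \<tau>)) G"
      by (intro q_expansion_coeff_prod_linear q_expansion_isogenous[OF assms(3) N]) auto
    moreover have "?e (\<tau> + 1) = ?e \<tau>" if "\<tau> \<in> \<H>" for \<tau>
    proof -
      have "(\<Prod>t\<le>N. [:1, - isogenous N k f t (\<tau> + 1):]) = (\<Prod>t\<le>N. [:1, - isogenous N k f (if t = N then N else Suc t mod N) \<tau>:])"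
        using isogenous_T[OF N assms(2) that] by (intro prod.cong) auto
      also have "\<dots> = (\<Prod>t\<le>N. [:1, - isogenous N k f t \<tau>:])"
        by (rule prod.reindex_bij_betw[OF bij_betw_shift[OF N], of "\<lambda>t. [:1, - isogenous N k f t \<tau>:]"])
      finally show ?thesis by simp
    qed
    ultimately show ?thesis using q_expansion_descend[OF N, of ?e] by blast
  qed
  moreover have "?e (- 1 / \<tau>) = \<tau> ^ (k * i) * ?e \<tau>" if "\<tau> \<in> \<H>" for \<tau>
  proof -
    have "(\<Prod>t\<le>N. [:1, - isogenous N k f t (- 1 / \<tau>):]) = (\<Prod>t\<le>N. [:1, - (\<tau> ^ k * isogenous N k f (\<sigma> t) \<tau>):])"
      using \<sigma>(2)[OF that] by (intro prod.cong) auto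
    also have "\<dots> = (\<Prod>t\<le>N. [:1, - (\<tau> ^ k * isogenous N k f t \<tau>):])"
      by (rule prod.reindex_bij_betw[OF \<sigma>(1), of "\<lambda>t. [:1, - (\<tau> ^ k * isogenous N k f t \<tau>):]"])
    finally show ?thesis
      by (simp add: coeff_prod_linear_scale power_mult)
  qed
  ultimately show ?thesis unfolding modular_form_def by blast
qed

lemma hecke_monomial:
  "hecke N (4 * i + 6 * j) (form_of (var_a ^ i * var_b ^ j)) \<tau> =
    1 / of_nat N * (\<Sum>t\<le>N. isogenous N 4 form_a t \<tau> ^ i * isogenous N 6 form_b t \<tau> ^ j)"
  by (simp add: hecke_def sum_isogenous add.commute)

text \<open>The classical formula c(N n) + N^(k - 1) c(n / N). The quotient
  \<open>of_nat N ^ k / of_nat N\<close> stays correct in weight 0, where k - 1 would be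
  truncated.\<close>

definition hecke_fps :: "nat \<Rightarrow> nat \<Rightarrow> complex fps \<Rightarrow> complex fps" where
  "hecke_fps N k F = Abs_fps (\<lambda>n. fps_nth F (N * n) + (if N dvd n then of_nat N ^ k / of_nat N * fps_nth F (n div N) else 0))"

lemma q_expansion_hecke:
  assumes "q_expansion f F" "N > 0"
  shows "q_expansion (hecke N k f) (hecke_fps N k F)"
proof (rule q_expansionI)
  fix \<tau> assume \<tau>: "\<tau> \<in> \<H>"
  have "(\<lambda>n. 1 / of_nat N * (of_nat N ^ k * (fps_nth (Abs_fps (\<lambda>n. if N dvd n then fps_nth F (n div N) else 0)) n * nome \<tau> ^ n)
      + of_nat N * fps_nth F (N * n) * nome \<tau> ^ n)) sums
     (1 / of_nat N * (of_nat N ^ k * f (of_nat N * \<tau>) + (\<Sum>t<N. f ((\<tau> + of_nat t) / of_nat N))))"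
    by (intro sums_mult sums_add q_expansionD(3)[OF q_expansion_multiple[OF assms] \<tau>]
        decimation_sums[OF assms(2) q_expansionD(3)[OF assms(1)] \<tau>])
  then have "(\<lambda>n. 1 / of_nat N * (of_nat N ^ k * (fps_nth (Abs_fps (\<lambda>n. if N dvd n then fps_nth F (n div N) else 0)) n * nome \<tau> ^ n)
      + of_nat N * fps_nth F (N * n) * nome \<tau> ^ n)) sums hecke N k f \<tau>"
    by (simp add: hecke_def)
  also have "(\<lambda>n. 1 / of_nat N * (of_nat N ^ k * (fps_nth (Abs_fps (\<lambda>n. if N dvd n then fps_nth F (n div N) else 0)) n * nome \<tau> ^ n)
      + of_nat N * fps_nth F (N * n) * nome \<tau> ^ n)) = (\<lambda>n. fps_nth (hecke_fps N k F) n * nome \<tau> ^ n)"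
    using assms(2) by (auto simp: hecke_fps_def field_simps)
  finally show "(\<lambda>n. fps_nth (hecke_fps N k F) n * nome \<tau> ^ n) sums hecke N k f \<tau>" .
qed

lemma q_expansion_monomial: "q_expansion (form_of (var_a ^ i * var_b ^ j)) (fps_a ^ i * fps_b ^ j)"
  by (rule q_expansion_cong[OF q_expansion_mult[OF q_expansion_power[OF q_expansion_form_a] q_expansion_power[OF q_expansion_form_b]]]) simp

lemma modular_form_hecke_monomial:
  assumes "prime N"
  shows "modular_form (4 * i + 6 * j) (hecke N (4 * i + 6 * j) (form_of (var_a ^ i * var_b ^ j)))"
proof -
  have N: "N > 0" using assms prime_gt_0_nat by blast
  obtain \<sigma> where \<sigma>: "bij_betw \<sigma> {..N} {..N}"
    "\<And>k f t \<tau>. full_modular k f \<Longrightarrow> \<tau> \<in> \<H> \<Longrightarrow> t \<le> N \<Longrightarrow>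
       isogenous N k f t (- 1 / \<tau>) = \<tau> ^ k * isogenous N k f (\<sigma> t) \<tau>"
    using isogenous_S[OF assms] by metis
  let ?h = "\<lambda>\<tau> t. isogenous N 4 form_a t \<tau> ^ i * isogenous N 6 form_b t \<tau> ^ j"
  have "hecke N (4 * i + 6 * j) (form_of (var_a ^ i * var_b ^ j)) (- 1 / \<tau>) =
     \<tau> ^ (4 * i + 6 * j) * hecke N (4 * i + 6 * j) (form_of (var_a ^ i * var_b ^ j)) \<tau>" if "\<tau> \<in> \<H>" for \<tau>
  proof -
    have "(\<Sum>t\<le>N. ?h (- 1 / \<tau>) t) = (\<Sum>t\<le>N. \<tau> ^ (4 * i + 6 * j) * ?h \<tau> (\<sigma> t))"
      using \<sigma>(2)[OF full_modular_forms(1) that] \<sigma>(2)[OF full_modular_forms(2) that]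
      by (intro sum.cong) (auto simp: power_mult_distrib power_add power_mult)
    also have "\<dots> = (\<Sum>t\<le>N. \<tau> ^ (4 * i + 6 * j) * ?h \<tau> t)"
      by (rule sum.reindex_bij_betw[OF \<sigma>(1)])
    finally show ?thesis unfolding hecke_monomial by (simp add: sum_distrib_left[symmetric])
  qed
  then show ?thesis
    using q_expansion_hecke[OF q_expansion_monomial N] unfolding modular_form_def by blast
qed

lemma monomial_eq_monom: "var_a ^ i * var_b ^ j = monom (monom 1 i) j"
proof -
  have "var_a ^ i = [:monom 1 i:]"
  proof (induction i)
    case (Suc i)
    then show ?case by (simp add: var_a_def monom_Suc)
  qed (simp add: monom_0 one_pCons)
  moreover have "var_b ^ j = monom 1 j"
  proof (induction j)
    case (Suc j)
    then show ?case by (simp add: var_b_def monom_Suc)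
  qed (simp add: monom_0 one_pCons)
  ultimately show ?thesis by (simp add: smult_monom)
qed

text \<open>This gives the definite description in \<open>hecke_ring\<close> its meaning: existence
  is \<open>modular_form_representable\<close>, uniqueness the algebraic independence of the two
  forms. Homogeneity is what later permits a comparison weight by weight.\<close>

lemma hecke_ring_monomial:
  assumes "prime N"
  shows "\<tau> \<in> \<H> \<Longrightarrow> form_of (hecke_ring N (var_a ^ i * var_b ^ j)) \<tau> = hecke N (4 * i + 6 * j) (form_of (var_a ^ i * var_b ^ j)) \<tau>"
    and "homogeneous (4 * i + 6 * j) (hecke_ring N (var_a ^ i * var_b ^ j))"
proof -
  let ?p = "var_a ^ i * var_b ^ j" and ?h = "hecke N (4 * i + 6 * j) (form_of (var_a ^ i * var_b ^ j))"
  have "(\<Sum>j'\<le>degree ?p. \<Sum>i'\<le>degree (coeff ?p j'). coeff (coeff ?p j') i' * hecke N (4 * i' + 6 * j') (form_of (var_a ^ i' * var_b ^ j')) \<tau>) = ?h \<tau>" for \<tau>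
  proof -
    have deg: "degree ?p = j" by (simp add: monomial_eq_monom degree_monom_eq)
    have "(\<Sum>i'\<le>degree (coeff ?p j'). coeff (coeff ?p j') i' * hecke N (4 * i' + 6 * j') (form_of (var_a ^ i' * var_b ^ j')) \<tau>) =
       (if j' = j then ?h \<tau> else 0)" for j'
    proof (cases "j' = j")
      case True
      have "(\<Sum>i'\<le>i. (if i = i' then 1 else 0) * hecke N (4 * i' + 6 * j) (form_of (var_a ^ i' * var_b ^ j)) \<tau>) =
          (\<Sum>i'\<le>i. if i = i' then hecke N (4 * i' + 6 * j) (form_of (var_a ^ i' * var_b ^ j)) \<tau> else 0)"
        by (intro sum.cong) auto
      then show ?thesis
        unfolding True by (simp add: monomial_eq_monom[of i j] degree_monom_eq)
    qed (simp add: monomial_eq_monom[of i j])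
    then show ?thesis unfolding deg by simp
  qed
  then have eq: "hecke_ring N ?p = (THE r. \<forall>\<tau>\<in>\<H>. form_of r \<tau> = ?h \<tau>)"
    unfolding hecke_ring_def by simp
  obtain r where r: "homogeneous (4 * i + 6 * j) r" "\<forall>\<tau>\<in>\<H>. form_of r \<tau> = ?h \<tau>"
    using modular_form_representable[OF modular_form_hecke_monomial[OF assms]] unfolding representable_def by blast
  have "hecke_ring N ?p = r"
    unfolding eq by (rule the_equality) (use r(2) form_of_inject in auto)
  then show "\<tau> \<in> \<H> \<Longrightarrow> form_of (hecke_ring N ?p) \<tau> = ?h \<tau>" "homogeneous (4 * i + 6 * j) (hecke_ring N ?p)"
    using r by auto
qed

section \<open>Rationality over the complex numbers\<close>

definition bounded_support :: "nat \<Rightarrow> 'a::zero fps fps \<Rightarrow> bool" where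
  "bounded_support d X \<longleftrightarrow> (\<forall>i j. i > d \<or> j > d \<longrightarrow> fps_nth (fps_nth X j) i = 0)"

lemma fps_fps_mult_nth:
  fixes X Y :: "'a :: comm_ring_1 fps fps"
  shows "fps_nth (fps_nth (X * Y) j) i =
    (\<Sum>j'\<le>j. \<Sum>i'\<le>i. fps_nth (fps_nth X j') i' * fps_nth (fps_nth Y (j - j')) (i - i'))"
  by (simp add: fps_mult_nth fps_sum_nth atLeast0AtMost)

lemma bounded_support_mult:
  fixes X Y :: "'a :: comm_ring_1 fps fps"
  assumes "bounded_support d X" "bounded_support e Y"
  shows "bounded_support (d + e) (X * Y)"
  unfolding bounded_support_def fps_fps_mult_nth
proof (intro allI impI sum.neutral ballI)
  fix i j j' i' assume "i > d + e \<or> j > d + e" "j' \<in> {..j}" "i' \<in> {..i}"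
  then have "(i' > d \<or> j' > d) \<or> (i - i' > e \<or> j - j' > e)" by auto
  then show "fps_nth (fps_nth X j') i' * fps_nth (fps_nth Y (j - j')) (i - i') = 0"
    using assms unfolding bounded_support_def by (metis mult_zero_left mult_zero_right)
qed

lemma bounded_support_diff:
  fixes X Y :: "'a :: comm_ring_1 fps fps"
  shows "bounded_support d X \<Longrightarrow> bounded_support d Y \<Longrightarrow> bounded_support d (X - Y)"
  unfolding bounded_support_def by simp

lemma bounded_support_mono: "bounded_support d X \<Longrightarrow> d \<le> e \<Longrightarrow> bounded_support e X"
  unfolding bounded_support_def by (meson le_less_trans)

lemma homogeneous_mult:
  assumes "homogeneous k r" "homogeneous l s"
  shows "homogeneous (k + l) (r * s)"
  unfolding homogeneous_def
proof (intro allI impI)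
  fix i j assume "coeff (coeff (r * s) j) i \<noteq> 0"
  then have "(\<Sum>j'\<le>j. \<Sum>i'\<le>i. coeff (coeff r j') i' * coeff (coeff s (j - j')) (i - i')) \<noteq> 0"
    by (simp add: coeff_mult coeff_sum)
  then obtain j' where j': "j' \<in> {..j}" "(\<Sum>i'\<le>i. coeff (coeff r j') i' * coeff (coeff s (j - j')) (i - i')) \<noteq> 0"
    by (rule sum.not_neutral_contains_not_neutral)
  then obtain i' where i': "i' \<in> {..i}" "coeff (coeff r j') i' * coeff (coeff s (j - j')) (i - i') \<noteq> 0"
    by (meson sum.not_neutral_contains_not_neutral)
  then have "coeff (coeff r j') i' \<noteq> 0" "coeff (coeff s (j - j')) (i - i') \<noteq> 0" by auto
  then have "4 * i' + 6 * j' = k" "4 * (i - i') + 6 * (j - j') = l"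
    using assms unfolding homogeneous_def by blast+
  then show "4 * i + 6 * j = k + l" using j' i' by auto
qed

lemma homogeneous_sum: "(\<And>x. x \<in> A \<Longrightarrow> homogeneous k (r x)) \<Longrightarrow> homogeneous k (\<Sum>x\<in>A. r x)"
  unfolding homogeneous_def coeff_sum by (meson sum.neutral)

text \<open>Convolution with the powers of a is multiplication by 1/(1 - a X), which cancels the
  linear factor.\<close>

lemma sum_coeff_linear_mult:
  fixes V :: "'a :: comm_ring_1 poly"
  shows "(\<Sum>i'\<le>i. coeff ([:1, - a:] * V) i' * a ^ (i - i')) = coeff V i"
proof (induction i)
  case (Suc i)
  have "(\<Sum>i'\<le>i. coeff ([:1, - a:] * V) i' * a ^ (Suc i - i')) = a * (\<Sum>i'\<le>i. coeff ([:1, - a:] * V) i' * a ^ (i - i'))"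
    unfolding sum_distrib_left by (intro sum.cong) (auto simp: Suc_diff_le algebra_simps)
  then show ?case using Suc by simp
qed simp

lemma sum_coeff_prod_linear:
  fixes g :: "'b \<Rightarrow> 'a :: comm_ring_1"
  assumes "finite A" "t \<in> A"
  shows "(\<Sum>i'\<le>i. coeff (\<Prod>s\<in>A. [:1, - g s:]) i' * g t ^ (i - i')) = coeff (\<Prod>s\<in>A - {t}. [:1, - g s:]) i"
  unfolding prod.remove[OF assms] by (rule sum_coeff_linear_mult)

lemma coeff_prod_linear_eq_0:
  fixes g :: "'b \<Rightarrow> 'a :: idom"
  assumes "finite A" "i > card A"
  shows "coeff (\<Prod>s\<in>A. [:1, - g s:]) i = 0"
proof (rule coeff_eq_0)
  have "degree (\<Prod>s\<in>A. [:1, - g s:]) \<le> (\<Sum>s\<in>A. degree [:1, - g s:])"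
    using degree_prod_sum_le[OF assms(1), of "\<lambda>s. [:1, - g s:]"] by (simp only: o_def)
  also have "\<dots> \<le> (\<Sum>s\<in>A. 1)" by (intro sum_mono) simp
  finally show "degree (\<Prod>s\<in>A. [:1, - g s:]) < i" using assms(2) by simp
qed

lemma hecke_gf_nth: "fps_nth (fps_nth (hecke_gf N) j) i = hecke_ring N (var_a ^ i * var_b ^ j)"
  by (simp add: hecke_gf_def)

text \<open>If A and B get the weights - 4 and - 6, the generating function is homogeneous of weight
  0, and so are its products with series of weight 0.\<close>

lemma homogeneous_mult_hecke_gf:
  assumes "prime N" "\<And>i j. homogeneous (4 * i + 6 * j) (fps_nth (fps_nth Q j) i)"
  shows "homogeneous (4 * i + 6 * j) (fps_nth (fps_nth (Q * hecke_gf N) j) i)"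
  unfolding fps_fps_mult_nth hecke_gf_nth
proof (intro homogeneous_sum)
  fix j' i' assume "j' \<in> {..j}" "i' \<in> {..i}"
  then have "4 * i + 6 * j = (4 * i' + 6 * j') + (4 * (i - i') + 6 * (j - j'))" by auto
  then show "homogeneous (4 * i + 6 * j) (fps_nth (fps_nth Q j') i' * hecke_ring N (var_a ^ (i - i') * var_b ^ (j - j')))"
    using homogeneous_mult[OF assms(2) hecke_ring_monomial(2)[OF assms(1)]] by metis
qed

text \<open>The witness for \<open>D\<close> is \<open>\<Prod>\<^sub>t (1 - a\<^sub>t A)(1 - b\<^sub>t B)\<close>.\<close>

theorem hecke_gf_complex_denominator:
  assumes "prime N"
  obtains D P where "D * hecke_gf N = P" "fps_nth (fps_nth D 0) 0 = 1"
    "bounded_support (N + 1) D" "bounded_support N P"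
    "\<And>i j. homogeneous (4 * i + 6 * j) (fps_nth (fps_nth D j) i)"
    "\<And>i j. homogeneous (4 * i + 6 * j) (fps_nth (fps_nth P j) i)"
proof -
  have N: "N > 0" using assms prime_gt_0_nat by blast
  let ?a = "\<lambda>\<tau> t. isogenous N 4 form_a t \<tau>" and ?b = "\<lambda>\<tau> t. isogenous N 6 form_b t \<tau>"
  let ?U = "\<lambda>\<tau>. \<Prod>t\<le>N. [:1, - ?a \<tau> t:]" and ?V = "\<lambda>\<tau>. \<Prod>t\<le>N. [:1, - ?b \<tau> t:]"
  have "\<forall>i. \<exists>r. homogeneous (4 * i) r \<and> (\<forall>\<tau>\<in>\<H>. form_of r \<tau> = coeff (?U \<tau>) i)"
    using modular_form_representable[OF modular_form_coeff_prod_isogenous[OF assms full_modular_forms(1) q_expansion_form_a]]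
    by (simp add: representable_def)
  then obtain u where u: "\<And>i. homogeneous (4 * i) (u i)" "\<And>i \<tau>. \<tau> \<in> \<H> \<Longrightarrow> form_of (u i) \<tau> = coeff (?U \<tau>) i"
    by metis
  have "\<forall>i. \<exists>r. homogeneous (6 * i) r \<and> (\<forall>\<tau>\<in>\<H>. form_of r \<tau> = coeff (?V \<tau>) i)"
    using modular_form_representable[OF modular_form_coeff_prod_isogenous[OF assms full_modular_forms(2) q_expansion_form_b]]
    by (simp add: representable_def)
  then obtain v where v: "\<And>i. homogeneous (6 * i) (v i)" "\<And>i \<tau>. \<tau> \<in> \<H> \<Longrightarrow> form_of (v i) \<tau> = coeff (?V \<tau>) i"
    by metis
  define D where "D = Abs_fps (\<lambda>j. Abs_fps (\<lambda>i. u i * v j))"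
  have Dn: "fps_nth (fps_nth D j) i = u i * v j" for i j by (simp add: D_def)
  have "u 0 = 1" "v 0 = 1"
    by (rule form_of_inject; simp add: u(2) v(2) poly_0_coeff_0[symmetric] poly_prod)+
  then have "fps_nth (fps_nth D 0) 0 = 1" by (simp add: Dn)
  moreover have "u i = 0" "v i = 0" if "i > N + 1" for i
    by (rule form_of_eq_0; use that in \<open>simp add: u(2) v(2) coeff_prod_linear_eq_0\<close>)+
  then have "bounded_support (N + 1) D" by (auto simp: bounded_support_def Dn)
  moreover have hD: "homogeneous (4 * i + 6 * j) (fps_nth (fps_nth D j) i)" for i j
    unfolding Dn by (intro homogeneous_mult u v)
  moreover note homogeneous_mult_hecke_gf[OF assms hD]
  moreover have "bounded_support N (D * hecke_gf N)"
    unfolding bounded_support_def fps_fps_mult_nth hecke_gf_nth Dn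
  proof (intro allI impI form_of_eq_0)
    fix i j \<tau> assume ij: "N < i \<or> N < j" and \<tau>: "\<tau> \<in> \<H>"
    have "form_of (\<Sum>j'\<le>j. \<Sum>i'\<le>i. u i' * v j' * hecke_ring N (var_a ^ (i - i') * var_b ^ (j - j'))) \<tau> =
       (\<Sum>j'\<le>j. \<Sum>i'\<le>i. \<Sum>t\<le>N. 1 / of_nat N * ((coeff (?U \<tau>) i' * ?a \<tau> t ^ (i - i')) * (coeff (?V \<tau>) j' * ?b \<tau> t ^ (j - j'))))"
      unfolding form_of_sum form_of_simps u(2)[OF \<tau>] v(2)[OF \<tau>] hecke_ring_monomial(1)[OF assms \<tau>] hecke_monomial sum_distrib_left
      by (intro sum.cong refl) (simp only: mult_ac)
    also have "\<dots> = (\<Sum>j'\<le>j. \<Sum>t\<le>N. \<Sum>i'\<le>i. 1 / of_nat N * ((coeff (?U \<tau>) i' * ?a \<tau> t ^ (i - i')) * (coeff (?V \<tau>) j' * ?b \<tau> t ^ (j - j'))))"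
      by (intro sum.cong refl sum.swap)
    also have "\<dots> = (\<Sum>t\<le>N. \<Sum>j'\<le>j. \<Sum>i'\<le>i. 1 / of_nat N * ((coeff (?U \<tau>) i' * ?a \<tau> t ^ (i - i')) * (coeff (?V \<tau>) j' * ?b \<tau> t ^ (j - j'))))"
      by (rule sum.swap)
    also have "\<dots> = (\<Sum>t\<le>N. 1 / of_nat N * ((\<Sum>i'\<le>i. coeff (?U \<tau>) i' * ?a \<tau> t ^ (i - i')) * (\<Sum>j'\<le>j. coeff (?V \<tau>) j' * ?b \<tau> t ^ (j - j'))))"
      by (intro sum.cong refl) (simp only: sum_distrib_left sum_distrib_right)
    also have "\<dots> = (\<Sum>t\<le>N. 0)"
    proof (intro sum.cong refl)
      fix t assume t: "t \<in> {..N}"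
      \<comment> \<open>In the t-th summand the geometric series cancel one linear factor in A and
        one in B. N factors of each kind remain, whence degree at most N for the numerator.\<close>
      have "card ({..N} - {t}) = N" using t by simp
      then have "coeff (\<Prod>s\<in>{..N} - {t}. [:1, - ?a \<tau> s:]) i = 0 \<or> coeff (\<Prod>s\<in>{..N} - {t}. [:1, - ?b \<tau> s:]) j = 0"
        using ij coeff_prod_linear_eq_0[of "{..N} - {t}"] by (metis finite_Diff finite_atMost)
      then show "1 / of_nat N * ((\<Sum>i'\<le>i. coeff (?U \<tau>) i' * ?a \<tau> t ^ (i - i')) * (\<Sum>j'\<le>j. coeff (?V \<tau>) j' * ?b \<tau> t ^ (j - j'))) = 0"
        unfolding sum_coeff_prod_linear[OF finite_atMost t, of "?a \<tau>" i] sum_coeff_prod_linear[OF finite_atMost t, of "?b \<tau>" j]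
        by auto
    qed
    finally show "form_of (\<Sum>j'\<le>j. \<Sum>i'\<le>i. u i' * v j' * hecke_ring N (var_a ^ (i - i') * var_b ^ (j - j'))) \<tau> = 0"
      by simp
  qed
  ultimately show ?thesis using that by blast
qed

text \<open>
  Truncating at order \<open>d + N + 1\<close> is enough to test a relation: multiplied by the complex denominator,
  \<open>Q F - P\<close> becomes a polynomial of degree at most \<open>d + N + 1\<close> in both variables.
\<close>

lemma hecke_gf_relation_truncation:
  assumes "prime N" "bounded_support d Q" "bounded_support d P"
    "\<And>i j. i \<le> d + N + 1 \<Longrightarrow> j \<le> d + N + 1 \<Longrightarrow> fps_nth (fps_nth (Q * hecke_gf N) j) i = fps_nth (fps_nth P j) i"
  shows "Q * hecke_gf N = P"
proof -
  obtain D P0 where D: "D * hecke_gf N = P0" "fps_nth (fps_nth D 0) 0 = 1" "bounded_support (N + 1) D" "bounded_support N P0"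
    using hecke_gf_complex_denominator[OF assms(1)] by metis
  define E where "E = Q * hecke_gf N - P"
  have E0: "fps_nth (fps_nth E j) i = 0" if "i \<le> d + N + 1" "j \<le> d + N + 1" for i j
    using assms(4)[OF that] by (simp add: E_def)
  have "D * E = Q * P0 - D * P"
    by (simp add: E_def D(1)[symmetric] algebra_simps)
  moreover have "bounded_support (d + N + 1) (Q * P0)"
    by (rule bounded_support_mono[OF bounded_support_mult[OF assms(2) D(4)]]) simp
  moreover have "bounded_support (d + N + 1) (D * P)"
    by (rule bounded_support_mono[OF bounded_support_mult[OF D(3) assms(3)]]) simp
  ultimately have "bounded_support (d + N + 1) (D * E)"
    by (simp add: bounded_support_diff)
  \<comment> \<open>A coefficient of \<open>D * E\<close> involves only coefficients of
    \<open>E\<close> with indices at most i and j.\<close>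
  moreover have "fps_nth (fps_nth (D * E) j) i = 0" if "i \<le> d + N + 1" "j \<le> d + N + 1" for i j
    unfolding fps_fps_mult_nth by (intro sum.neutral ballI) (use that E0 in auto)
  ultimately have "D * E = 0"
    unfolding bounded_support_def by (intro fps_ext) (metis fps_zero_nth not_le)
  moreover have "D \<noteq> 0" using D(2) by auto
  ultimately have "E = 0" by simp
  then show ?thesis by (simp add: E_def)
qed

section \<open>Recursive functions\<close>

text \<open>
  Only lists of length \<open>k\<close> matter. Variables are accessed in de Bruijn style as \<open>hd\<close>, \<open>hd \<circ> tl\<close>, ..., so that the
  bound variable of a sum or a quantifier is pushed onto the argument list.
\<close>

definition recf :: "nat \<Rightarrow> (nat list \<Rightarrow> nat) \<Rightarrow> bool" where
  "recf k f \<longleftrightarrow> (\<exists>g. recursive_fn k g \<and> (\<forall>xs. length xs = k \<longrightarrow> f xs = g xs))"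

definition recp :: "nat \<Rightarrow> (nat list \<Rightarrow> bool) \<Rightarrow> bool" where
  "recp k P \<longleftrightarrow> recf k (\<lambda>xs. if P xs then 1 else 0)"

text \<open>With differences instead of sign codes, closure under ring operations and finite sums
  reduces to arithmetic on natural numbers.\<close>

definition reci :: "nat \<Rightarrow> (nat list \<Rightarrow> int) \<Rightarrow> bool" where
  "reci k f \<longleftrightarrow> (\<exists>p m. recf k p \<and> recf k m \<and> f = (\<lambda>xs. int (p xs) - int (m xs)))"

lemma recf_cong: "recf k f \<Longrightarrow> (\<And>xs. length xs = k \<Longrightarrow> f xs = g xs) \<Longrightarrow> recf k g"
  unfolding recf_def by metis

section \<open>Composition, primitive recursion and handling of variables\<close>

lemma recf_zero: "recf k (\<lambda>xs. 0)"
  unfolding recf_def using recursive_fn.zero by blast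

lemma recf_nth: "i < k \<Longrightarrow> recf k (\<lambda>xs. xs ! i)"
  unfolding recf_def using recursive_fn.proj by blast

lemma recf_comp:
  assumes "recf (length gs) f" "\<And>g. g \<in> set gs \<Longrightarrow> recf k g"
  shows "recf k (\<lambda>xs. f (map (\<lambda>g. g xs) gs))"
proof -
  obtain f' where f': "recursive_fn (length gs) f'" "\<And>xs. length xs = length gs \<Longrightarrow> f xs = f' xs"
    using assms(1) unfolding recf_def by blast
  obtain c where c: "\<And>g. g \<in> set gs \<Longrightarrow> recursive_fn k (c g) \<and> (\<forall>xs. length xs = k \<longrightarrow> g xs = c g xs)"
    using assms(2) unfolding recf_def by metis
  have "recursive_fn k (\<lambda>xs. f' (map (\<lambda>g. g xs) (map c gs)))"
    by (rule recursive_fn.comp) (use f' c in auto)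
  moreover have "f (map (\<lambda>g. g xs) gs) = f' (map (\<lambda>g. g xs) (map c gs))" if "length xs = k" for xs
  proof -
    have "map (\<lambda>g. g xs) gs = map (\<lambda>g. g xs) (map c gs)"
      using c that by auto
    then show ?thesis using f'(2) by (metis length_map)
  qed
  ultimately show ?thesis unfolding recf_def by blast
qed

lemma recf_comp1:
  assumes "recf 1 (\<lambda>xs. F (hd xs))" "recf k f"
  shows "recf k (\<lambda>xs. F (f xs))"
  using recf_comp[of "[f]" "\<lambda>xs. F (hd xs)" k] assms by simp

lemma recf_comp2:
  assumes "recf 2 (\<lambda>xs. F (hd xs) (hd (tl xs)))" "recf k f" "recf k g"
  shows "recf k (\<lambda>xs. F (f xs) (g xs))"
  using recf_comp[of "[f, g]" "\<lambda>xs. F (hd xs) (hd (tl xs))" k] assms by (auto simp: numeral_2_eq_2)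

lemma recf_comp3:
  assumes "recf 3 (\<lambda>xs. F (hd xs) (hd (tl xs)) (hd (tl (tl xs))))" "recf k f" "recf k g" "recf k h"
  shows "recf k (\<lambda>xs. F (f xs) (g xs) (h xs))"
  using recf_comp[of "[f, g, h]" "\<lambda>xs. F (hd xs) (hd (tl xs)) (hd (tl (tl xs)))" k] assms
  by (auto simp: numeral_3_eq_3)

lemma recf_Suc: "recf k f \<Longrightarrow> recf k (\<lambda>xs. Suc (f xs))"
proof (rule recf_comp1[where F = "Suc"])
  show "recf 1 (\<lambda>xs. Suc (hd xs))"
    unfolding recf_def using recursive_fn.succ by (intro exI[of _ "\<lambda>xs. Suc (xs ! 0)"]) (auto simp: length_Suc_conv)
qed

text \<open>The constructor \<open>prec\<close> takes the recursion variable from the head of the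
  argument list. Composition with the projections allows an arbitrary recursive bound
  \<open>n xs\<close>.\<close>

lemma recf_prec:
  assumes "recf k f" "recf (Suc (Suc k)) (\<lambda>ys. h (hd ys) (hd (tl ys)) (tl (tl ys)))" "recf k n"
  shows "recf k (\<lambda>xs. rec_nat (f xs) (\<lambda>i r. h i r xs) (n xs))"
proof -
  obtain f' where f': "recursive_fn k f'" "\<And>xs. length xs = k \<Longrightarrow> f xs = f' xs"
    using assms(1) unfolding recf_def by blast
  obtain h' where h': "recursive_fn (Suc (Suc k)) h'"
    "\<And>ys. length ys = Suc (Suc k) \<Longrightarrow> h (hd ys) (hd (tl ys)) (tl (tl ys)) = h' ys"
    using assms(2) unfolding recf_def by blast
  have "recf (Suc k) (\<lambda>ys. rec_nat (f (tl ys)) (\<lambda>i r. h i r (tl ys)) (hd ys))"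
    unfolding recf_def
  proof (intro exI conjI allI impI)
    show "recursive_fn (Suc k) (\<lambda>xs. rec_nat (f' (tl xs)) (\<lambda>n r. h' (n # r # tl xs)) (hd xs))"
      by (rule recursive_fn.prec) (use f' h' in auto)
    fix ys :: "nat list" assume len: "length ys = Suc k"
    have "rec_nat (f (tl ys)) (\<lambda>i r. h i r (tl ys)) m = rec_nat (f' (tl ys)) (\<lambda>n r. h' (n # r # tl ys)) m" for m
    proof (induction m)
      case 0 then show ?case using f'(2) len by simp
    next
      case (Suc m)
      then show ?case using h'(2)[of "m # _ # tl ys"] len by simp
    qed
    then show "rec_nat (f (tl ys)) (\<lambda>i r. h i r (tl ys)) (hd ys) =
       rec_nat (f' (tl ys)) (\<lambda>n r. h' (n # r # tl ys)) (hd ys)" .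
  qed
  then have "recf k (\<lambda>xs. (\<lambda>ys. rec_nat (f (tl ys)) (\<lambda>i r. h i r (tl ys)) (hd ys))
      (map (\<lambda>g. g xs) (n # map (\<lambda>i xs. xs ! i) [0..<k])))"
    by (intro recf_comp) (use assms(3) recf_nth in auto)
  moreover have "map (\<lambda>g. g xs) (n # map (\<lambda>i xs. xs ! i) [0..<k]) = n xs # xs" if "length xs = k" for xs
    using that map_nth[of xs] by (simp add: o_def)
  ultimately show ?thesis
    by (elim recf_cong) (simp only: list.sel)
qed

lemma recf_proj: "n < k \<Longrightarrow> recf k (\<lambda>xs. hd ((tl ^^ n) xs))"
proof (rule recf_cong[OF recf_nth])
  have "n < length xs \<Longrightarrow> xs ! n = hd ((tl ^^ n) xs)" for xs :: "nat list"
  proof (induction n arbitrary: xs)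
    case (Suc n)
    then have "xs ! Suc n = hd ((tl ^^ n) (tl xs))"
      by (metis (no_types, lifting) Suc_lessD Suc_less_eq length_tl less_diff_conv add.commute plus_1_eq_Suc nth_tl)
    then show ?case by (simp add: funpow_swap1)
  qed (simp add: hd_conv_nth)
  then show "xs ! n = hd ((tl ^^ n) xs)" if "n < k" "length xs = k" for xs :: "nat list"
    using that by blast
qed

text \<open>Ten variables are the deepest scope that occurs: in \<open>recp_certifies\<close> there
  are two arguments, three quantifiers and five nested sums.\<close>

lemma recf_var:
  "recf (Suc k) (\<lambda>xs. hd xs)"
  "recf (Suc (Suc k)) (\<lambda>xs. hd (tl xs))"
  "recf (Suc (Suc (Suc k))) (\<lambda>xs. hd (tl (tl xs)))"
  "recf (Suc (Suc (Suc (Suc k)))) (\<lambda>xs. hd (tl (tl (tl xs))))"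
  "recf (Suc (Suc (Suc (Suc (Suc k))))) (\<lambda>xs. hd (tl (tl (tl (tl xs)))))"
  "recf (Suc (Suc (Suc (Suc (Suc (Suc k)))))) (\<lambda>xs. hd (tl (tl (tl (tl (tl xs))))))"
  "recf (Suc (Suc (Suc (Suc (Suc (Suc (Suc k))))))) (\<lambda>xs. hd (tl (tl (tl (tl (tl (tl xs)))))))"
  "recf (Suc (Suc (Suc (Suc (Suc (Suc (Suc (Suc k)))))))) (\<lambda>xs. hd (tl (tl (tl (tl (tl (tl (tl xs))))))))"
  "recf (Suc (Suc (Suc (Suc (Suc (Suc (Suc (Suc (Suc k))))))))) (\<lambda>xs. hd (tl (tl (tl (tl (tl (tl (tl (tl xs)))))))))"
  "recf (Suc (Suc (Suc (Suc (Suc (Suc (Suc (Suc (Suc (Suc k)))))))))) (\<lambda>xs. hd (tl (tl (tl (tl (tl (tl (tl (tl (tl xs))))))))))"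
  using recf_proj[of 0 "Suc k"] recf_proj[of 1 "Suc (Suc k)"] recf_proj[of 2 "Suc (Suc (Suc k))"]
    recf_proj[of 3 "Suc (Suc (Suc (Suc k)))"] recf_proj[of 4 "Suc (Suc (Suc (Suc (Suc k))))"]
    recf_proj[of 5 "Suc (Suc (Suc (Suc (Suc (Suc k)))))"]
    recf_proj[of 6 "Suc (Suc (Suc (Suc (Suc (Suc (Suc k))))))"]
    recf_proj[of 7 "Suc (Suc (Suc (Suc (Suc (Suc (Suc (Suc k)))))))"]
    recf_proj[of 8 "Suc (Suc (Suc (Suc (Suc (Suc (Suc (Suc (Suc k))))))))"]
    recf_proj[of 9 "Suc (Suc (Suc (Suc (Suc (Suc (Suc (Suc (Suc (Suc k)))))))))"]
  by (simp_all add: eval_nat_numeral funpow_swap1)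

text \<open>The common form of weakening, substitution and skipping of variables: an argument list
  may be rearranged as soon as each new entry is recursive.\<close>

lemma recf_projections:
  assumes "\<And>xs. length xs = k \<Longrightarrow> length (e xs) = m" "recf m f"
    "\<And>i. i < m \<Longrightarrow> recf k (\<lambda>xs. e xs ! i)"
  shows "recf k (\<lambda>xs. f (e xs))"
proof -
  have "recf k (\<lambda>xs. f (map (\<lambda>g. g xs) (map (\<lambda>i xs. e xs ! i) [0..<m])))"
    by (intro recf_comp) (use assms in auto)
  moreover have "map (\<lambda>g. g xs) (map (\<lambda>i xs. e xs ! i) [0..<m]) = e xs" if "length xs = k" for xs
    using assms(1)[OF that] map_nth[of "e xs"] by (simp add: o_def)
  ultimately show ?thesis
    by (elim recf_cong) simp
qed

lemma recf_weaken: "recf k f \<Longrightarrow> recf (Suc k) (\<lambda>ys. f (tl ys))"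
proof (rule recf_projections)
  show "recf (Suc k) (\<lambda>xs. tl xs ! i)" if "i < k" for i
    by (rule recf_cong[OF recf_nth[of "Suc i"]]) (use that in \<open>auto simp: nth_tl\<close>)
qed auto

lemma recf_subst:
  assumes "recf (Suc k) (\<lambda>ys. g (hd ys) (tl ys))" "recf k e"
  shows "recf k (\<lambda>xs. g (e xs) xs)"
proof -
  have "recf k (\<lambda>xs. (\<lambda>ys. g (hd ys) (tl ys)) (e xs # xs))"
  proof (rule recf_projections[OF _ assms(1)])
    show "recf k (\<lambda>xs. (e xs # xs) ! i)" if "i < Suc k" for i
      using that assms(2) by (cases i) (auto intro: recf_nth)
  qed auto
  then show ?thesis by simp
qed

text \<open>Makes room for a second argument: the step function of \<open>recf_prec\<close> sees the
  accumulator between the index and the parameters.\<close>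

lemma recf_skip:
  assumes "recf (Suc k) (\<lambda>ys. g (hd ys) (tl ys))"
  shows "recf (Suc (Suc k)) (\<lambda>ys. g (hd ys) (tl (tl ys)))"
proof -
  have "recf (Suc (Suc k)) (\<lambda>xs. (\<lambda>ys. g (hd ys) (tl ys)) (hd xs # tl (tl xs)))"
  proof (rule recf_projections[OF _ assms])
    show "recf (Suc (Suc k)) (\<lambda>xs. (hd xs # tl (tl xs)) ! i)" if "i < Suc k" for i
    proof (cases i)
      case (Suc i')
      then have "recf (Suc (Suc k)) (\<lambda>xs. xs ! Suc i)"
        using that by (intro recf_nth) auto
      then show ?thesis
        by (rule recf_cong) (use that Suc in \<open>auto simp: nth_tl\<close>)
    qed (simp add: recf_var)
  qed auto
  then show ?thesis by simp
qed

section \<open>Arithmetic, bounded search and pairing\<close>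

lemma recf_const: "recf k (\<lambda>xs. c)"
  by (induction c) (auto intro: recf_zero recf_Suc)

lemma recf_plus: "recf k f \<Longrightarrow> recf k g \<Longrightarrow> recf k (\<lambda>xs. f xs + g xs)"
proof -
  assume "recf k f" "recf k g"
  then have "recf k (\<lambda>xs. rec_nat (f xs) (\<lambda>i r. Suc r) (g xs))"
    by (intro recf_prec recf_Suc recf_var)
  moreover have "rec_nat a (\<lambda>i r. Suc r) b = a + b" for a b :: nat
    by (induction b) auto
  ultimately show ?thesis by simp
qed

lemma recf_mult: "recf k f \<Longrightarrow> recf k g \<Longrightarrow> recf k (\<lambda>xs. f xs * g xs)"
proof (rule recf_comp2[where F = "(*)"])
  have "recf 2 (\<lambda>xs. rec_nat 0 (\<lambda>i r. r + hd xs) (hd (tl xs)))"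
    unfolding numeral_2_eq_2 by (intro recf_prec recf_plus recf_var recf_zero)
  moreover have "rec_nat 0 (\<lambda>i r. r + a) b = a * b" for a b :: nat
    by (induction b) auto
  ultimately show "recf 2 (\<lambda>xs. hd xs * hd (tl xs))" by simp
qed

lemma recf_power: "recf k f \<Longrightarrow> recf k g \<Longrightarrow> recf k (\<lambda>xs. f xs ^ g xs)"
proof (rule recf_comp2[where F = "(^)"])
  have "recf 2 (\<lambda>xs. rec_nat (Suc 0) (\<lambda>i r. r * hd xs) (hd (tl xs)))"
    unfolding numeral_2_eq_2 by (intro recf_prec recf_mult recf_var recf_const)
  moreover have "rec_nat (Suc 0) (\<lambda>i r. r * a) b = a ^ b" for a b :: nat
    by (induction b) auto
  ultimately show "recf 2 (\<lambda>xs. hd xs ^ hd (tl xs))" by simp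
qed

lemma recf_minus: "recf k f \<Longrightarrow> recf k g \<Longrightarrow> recf k (\<lambda>xs. f xs - g xs)"
proof (rule recf_comp2[where F = "(-)"])
  have "recf 1 (\<lambda>xs. rec_nat 0 (\<lambda>i r. i) (hd xs))"
    unfolding One_nat_def by (intro recf_prec recf_var recf_const)
  moreover have "rec_nat 0 (\<lambda>i r. i) b = b - 1" for b :: nat
    by (induction b) auto
  ultimately have pred: "recf 1 (\<lambda>xs. hd xs - 1)" by simp
  have "recf 2 (\<lambda>xs. rec_nat (hd xs) (\<lambda>i r. r - 1) (hd (tl xs)))"
    unfolding numeral_2_eq_2 by (intro recf_prec recf_comp1[OF pred] recf_var)
  moreover have "rec_nat a (\<lambda>i r. r - 1) b = a - b" for a b :: nat
    by (induction b) auto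
  ultimately show "recf 2 (\<lambda>xs. hd xs - hd (tl xs))" by simp
qed

lemma recf_sum:
  assumes "recf k n" "recf (Suc k) (\<lambda>ys. g (hd ys) (tl ys))"
  shows "recf k (\<lambda>xs. \<Sum>i<n xs. g i xs)"
proof -
  have "recf k (\<lambda>xs. rec_nat 0 (\<lambda>i r. r + g i xs) (n xs))"
    by (intro recf_prec recf_plus recf_var recf_const recf_skip assms)
  moreover have "rec_nat 0 (\<lambda>i r. r + g i xs) m = (\<Sum>i<m. g i xs)" for xs m
    by (induction m) auto
  ultimately show ?thesis by simp
qed

lemma recp_not: "recp k P \<Longrightarrow> recp k (\<lambda>xs. \<not> P xs)"
  unfolding recp_def
  by (drule recf_minus[OF recf_const[of k 1]], erule recf_cong) auto

lemma recp_conj: "recp k P \<Longrightarrow> recp k Q \<Longrightarrow> recp k (\<lambda>xs. P xs \<and> Q xs)"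
  unfolding recp_def by (drule (1) recf_mult, erule recf_cong) auto

lemma recp_imp: "recp k P \<Longrightarrow> recp k Q \<Longrightarrow> recp k (\<lambda>xs. P xs \<longrightarrow> Q xs)"
  using recp_not[OF recp_conj[OF _ recp_not, of k P Q]] by simp

lemma recp_le: "recf k f \<Longrightarrow> recf k g \<Longrightarrow> recp k (\<lambda>xs. f xs \<le> g xs)"
  unfolding recp_def
  by (drule (1) recf_minus, drule recf_minus[OF recf_const[of k 1]], erule recf_cong) auto

lemma recp_less: "recf k f \<Longrightarrow> recf k g \<Longrightarrow> recp k (\<lambda>xs. f xs < g xs)"
  using recp_le[OF recf_Suc, of k f g] by (simp add: Suc_le_eq)

lemma recp_eq: "recf k f \<Longrightarrow> recf k g \<Longrightarrow> recp k (\<lambda>xs. f xs = g xs)"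
  using recp_conj[OF recp_le[of k f g] recp_le[of k g f]] by (simp add: eq_iff)

lemma recf_if: "recp k P \<Longrightarrow> recf k f \<Longrightarrow> recf k g \<Longrightarrow> recf k (\<lambda>xs. if P xs then f xs else g xs)"
proof -
  assume *: "recp k P" "recf k f" "recf k g"
  have "recf k (\<lambda>xs. (if P xs then 1 else 0) * f xs + (if \<not> P xs then 1 else 0) * g xs)"
    by (intro recf_plus recf_mult * *(1)[unfolded recp_def] recp_not[unfolded recp_def])
  then show ?thesis by (rule recf_cong) auto
qed

lemma recp_all:
  assumes "recf k n" "recp (Suc k) (\<lambda>ys. P (hd ys) (tl ys))"
  shows "recp k (\<lambda>xs. \<forall>i<n xs. P i xs)"
proof -
  have "recp k (\<lambda>xs. (\<Sum>i<n xs. if \<not> P i xs then 1 else 0) = (0::nat))"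
    by (intro recp_eq recf_sum recf_const recp_not[unfolded recp_def] assms assms[unfolded recp_def])
  moreover have "(\<Sum>i<n xs. if \<not> P i xs then 1 else 0) = (0::nat) \<longleftrightarrow> (\<forall>i<n xs. P i xs)" for xs
    by auto
  ultimately show ?thesis by simp
qed

lemma recp_ex:
  assumes "recf k n" "recp (Suc k) (\<lambda>ys. P (hd ys) (tl ys))"
  shows "recp k (\<lambda>xs. \<exists>i<n xs. P i xs)"
  using recp_not[OF recp_all[OF assms(1) recp_not[OF assms(2)]]] by simp

text \<open>Bounded search is written as a sum in which at most one term is nonzero. For divisor 0
  no term survives, in agreement with \<open>a div 0 = 0\<close>. The components of a pair are found
  by the same device.\<close>

lemma recf_div: "recf k f \<Longrightarrow> recf k g \<Longrightarrow> recf k (\<lambda>xs. f xs div g xs)"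
proof (rule recf_comp2[where F = "(div)"])
  have "recf 2 (\<lambda>xs. \<Sum>q<Suc (hd xs). if q * hd (tl xs) \<le> hd xs \<and> hd xs < Suc q * hd (tl xs) then q else 0)"
    unfolding numeral_2_eq_2
    by (intro recf_sum recf_if recp_conj recp_le recp_less recf_mult recf_Suc recf_var recf_const)
  moreover have "(\<Sum>q<Suc a. if q * b \<le> a \<and> a < Suc q * b then q else 0) = a div b" for a b :: nat
  proof (cases "b = 0")
    case False
    have "(\<Sum>q<Suc a. if q * b \<le> a \<and> a < Suc q * b then q else 0) = (\<Sum>q<Suc a. if q = a div b then q else 0)"
    proof (intro sum.cong refl if_cong)
      show "(q * b \<le> a \<and> a < Suc q * b) = (q = a div b)" for q
        using False by (metis div_nat_eqI dividend_less_div_times mult.commute mult_Suc neq0_conv times_div_less_eq_dividend add.commute)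
    qed
    also have "\<dots> = a div b"
      using div_le_dividend[of a b] by (subst sum.delta) (auto simp: less_Suc_eq_le)
    finally show ?thesis .
  qed auto
  ultimately show "recf 2 (\<lambda>xs. hd xs div hd (tl xs))" by simp
qed

lemma recf_mod: "recf k f \<Longrightarrow> recf k g \<Longrightarrow> recf k (\<lambda>xs. f xs mod g xs)"
  unfolding minus_div_mult_eq_mod[symmetric] by (intro recf_minus recf_mult recf_div)

lemma recp_dvd: "recf k f \<Longrightarrow> recf k g \<Longrightarrow> recp k (\<lambda>xs. f xs dvd g xs)"
  unfolding dvd_eq_mod_eq_0 by (intro recp_eq recf_mod recf_const)

lemma recf_prod_encode: "recf k f \<Longrightarrow> recf k g \<Longrightarrow> recf k (\<lambda>xs. prod_encode (f xs, g xs))"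
  unfolding prod_encode_def triangle_def split_conv
  by (intro recf_plus recf_div recf_mult recf_Suc recf_const)

lemma recf_fst_decode: "recf k f \<Longrightarrow> recf k (\<lambda>xs. fst (prod_decode (f xs)))"
proof (rule recf_comp1[where F = "\<lambda>n. fst (prod_decode n)"])
  have "recf 1 (\<lambda>xs. \<Sum>x<Suc (hd xs). \<Sum>y<Suc (hd xs). if prod_encode (x, y) = hd xs then x else 0)"
    unfolding One_nat_def
    by (intro recf_sum recf_if recp_eq recf_prod_encode recf_Suc recf_var recf_const)
  moreover have "(\<Sum>x<Suc n. \<Sum>y<Suc n. if prod_encode (x, y) = n then x else 0) = fst (prod_decode n)" for n
  proof -
    obtain a b where ab: "n = prod_encode (a, b)" by (metis prod_decode_inverse surj_pair)
    then have "a < Suc n" "b < Suc n"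
      by (simp_all add: le_prod_encode_1 le_prod_encode_2 less_Suc_eq_le)
    moreover have "(\<Sum>y<Suc n. if prod_encode (x, y) = n then x else 0) = (if x = a then a else 0)" for x
      using ab \<open>b < Suc n\<close> by auto
    ultimately show ?thesis using ab by simp
  qed
  ultimately show "recf 1 (\<lambda>xs. fst (prod_decode (hd xs)))" by simp
qed

lemma recf_snd_decode: "recf k f \<Longrightarrow> recf k (\<lambda>xs. snd (prod_decode (f xs)))"
proof (rule recf_comp1[where F = "\<lambda>n. snd (prod_decode n)"])
  have "recf 1 (\<lambda>xs. \<Sum>x<Suc (hd xs). \<Sum>y<Suc (hd xs). if prod_encode (y, x) = hd xs then x else 0)"
    unfolding One_nat_def
    by (intro recf_sum recf_if recp_eq recf_prod_encode recf_Suc recf_var recf_const)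
  moreover have "(\<Sum>x<Suc n. \<Sum>y<Suc n. if prod_encode (y, x) = n then x else 0) = snd (prod_decode n)" for n
  proof -
    obtain a b where ab: "n = prod_encode (b, a)" by (metis prod_decode_inverse surj_pair)
    then have "a < Suc n" "b < Suc n"
      by (simp_all add: le_prod_encode_1 le_prod_encode_2 less_Suc_eq_le)
    moreover have "(\<Sum>y<Suc n. if prod_encode (y, x) = n then x else 0) = (if x = a then a else 0)" for x
      using ab \<open>b < Suc n\<close> by auto
    ultimately show ?thesis using ab by simp
  qed
  ultimately show "recf 1 (\<lambda>xs. snd (prod_decode (hd xs)))" by simp
qed

section \<open>Codes of lists\<close>

definition code_nth :: "nat \<Rightarrow> nat \<Rightarrow> nat" where
  "code_nth c i = (let r = rec_nat c (\<lambda>_ r. if r = 0 then 0 else snd (prod_decode (r - 1))) i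
     in if r = 0 then 0 else fst (prod_decode (r - 1)))"

lemma recf_code_nth: "recf k f \<Longrightarrow> recf k g \<Longrightarrow> recf k (\<lambda>xs. code_nth (f xs) (g xs))"
proof (rule recf_comp2[where F = "code_nth"])
  show "recf 2 (\<lambda>xs. code_nth (hd xs) (hd (tl xs)))"
    unfolding numeral_2_eq_2 code_nth_def Let_def
    by (intro recf_if recp_eq recf_prec recf_var recf_const recf_fst_decode recf_snd_decode recf_minus)
qed

text \<open>The tail is iterated on codes; the empty list has code 0, which is its own tail. The
  default 0 past the end agrees with the trailing zeros of a coefficient list.\<close>

lemma code_nth_eq: "code_nth c i = (if i < length (list_decode c) then list_decode c ! i else 0)"
proof -
  define t where "t = (\<lambda>r::nat. if r = 0 then 0 else snd (prod_decode (r - 1)))"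
  have t: "t (list_encode xs) = list_encode (tl xs)" for xs
    by (cases xs) (auto simp: t_def)
  have "rec_nat (list_encode xs) (\<lambda>_ r. t r) i = list_encode (drop i xs)" for xs
    by (induction i) (auto simp: t drop_Suc tl_drop)
  from this[of "list_decode c"] have *: "rec_nat c (\<lambda>_ r. t r) i = list_encode (drop i (list_decode c))"
    by simp
  show ?thesis
    unfolding code_nth_def t_def[symmetric] fun_cong[OF t_def, symmetric] * Let_def
    by (cases "drop i (list_decode c)") (auto simp: hd_drop_conv_nth[symmetric])
qed

lemma length_list_decode_le: "length (list_decode c) \<le> c"
proof -
  have "length xs \<le> list_encode xs" for xs
    by (induction xs) (auto intro: order.trans[OF _ le_prod_encode_2])
  from this[of "list_decode c"] show ?thesis by simp
qed

text \<open>\<open>list_encode\<close> adds entries at the front, so the recursion builds the list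
  from its last entry; hence the reversed index \<open>n xs - Suc i\<close>.\<close>

lemma recf_tabulate:
  assumes "recf k n" "recf (Suc k) (\<lambda>ys. g (hd ys) (tl ys))"
  shows "recf k (\<lambda>xs. list_encode (map (\<lambda>i. g i xs) [0..<n xs]))"
proof -
  have "recf (Suc k) (\<lambda>ys. g (n (tl ys) - Suc (hd ys)) (tl ys))"
    by (rule recf_subst[of "Suc k" "\<lambda>m ys. g m (tl ys)" "\<lambda>ys. n (tl ys) - Suc (hd ys)"])
      (intro recf_skip assms recf_minus recf_weaken recf_Suc recf_var)+
  then have *: "recf (Suc (Suc k)) (\<lambda>ys. g (n (tl (tl ys)) - Suc (hd ys)) (tl (tl ys)))"
    by (rule recf_skip[where g = "\<lambda>i xs. g (n xs - Suc i) xs"])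
  have "recf k (\<lambda>xs. rec_nat 0 (\<lambda>i r. Suc (prod_encode (g (n xs - Suc i) xs, r))) (n xs))"
    by (intro recf_prec recf_Suc recf_prod_encode * recf_var recf_const assms)
  moreover have "m \<le> n xs \<Longrightarrow> rec_nat 0 (\<lambda>i r. Suc (prod_encode (g (n xs - Suc i) xs, r))) m
      = list_encode (map (\<lambda>i. g i xs) [n xs - m..<n xs])" for xs m
  proof (induction m)
    case (Suc m)
    then have "[n xs - Suc m..<n xs] = (n xs - Suc m) # [n xs - m..<n xs]"
      by (simp add: upt_conv_Cons Suc_diff_Suc)
    then show ?case using Suc by simp
  qed auto
  ultimately show ?thesis by simp
qed

section \<open>Integer-valued recursive functions\<close>

lemma reciI: "recf k p \<Longrightarrow> recf k m \<Longrightarrow> (\<And>xs. f xs = int (p xs) - int (m xs)) \<Longrightarrow> reci k f"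
  unfolding reci_def by blast

lemma reciE:
  assumes "reci k f"
  obtains p m where "recf k p" "recf k m" "f = (\<lambda>xs. int (p xs) - int (m xs))"
  using assms unfolding reci_def by blast

lemma reci_nat: "recf k f \<Longrightarrow> reci k (\<lambda>xs. int (f xs))"
  by (rule reciI[OF _ recf_const[of _ 0]]) auto

lemma reci_minus: "reci k f \<Longrightarrow> reci k (\<lambda>xs. - f xs)"
  by (elim reciE) (rule reciI, auto)

lemma reci_plus: "reci k f \<Longrightarrow> reci k g \<Longrightarrow> reci k (\<lambda>xs. f xs + g xs)"
proof (elim reciE)
  fix p m q n assume *: "recf k p" "recf k m" "recf k q" "recf k n"
    and "f = (\<lambda>xs. int (p xs) - int (m xs))" "g = (\<lambda>xs. int (q xs) - int (n xs))"
  then show ?thesis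
    by (intro reciI[of k "\<lambda>xs. p xs + q xs" "\<lambda>xs. m xs + n xs"] recf_plus *) simp
qed

lemma reci_mult: "reci k f \<Longrightarrow> reci k g \<Longrightarrow> reci k (\<lambda>xs. f xs * g xs)"
proof (elim reciE)
  fix p m q n assume *: "recf k p" "recf k m" "recf k q" "recf k n"
    and "f = (\<lambda>xs. int (p xs) - int (m xs))" "g = (\<lambda>xs. int (q xs) - int (n xs))"
  then show ?thesis
    by (intro reciI[of k "\<lambda>xs. p xs * q xs + m xs * n xs" "\<lambda>xs. p xs * n xs + m xs * q xs"] recf_plus recf_mult *)
      (simp add: algebra_simps)
qed

lemma reci_if: "recp k P \<Longrightarrow> reci k f \<Longrightarrow> reci k g \<Longrightarrow> reci k (\<lambda>xs. if P xs then f xs else g xs)"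
proof (elim reciE)
  fix p m q n assume *: "recp k P" "recf k p" "recf k m" "recf k q" "recf k n"
    and "f = (\<lambda>xs. int (p xs) - int (m xs))" "g = (\<lambda>xs. int (q xs) - int (n xs))"
  then show ?thesis
    by (intro reciI[of k "\<lambda>xs. if P xs then p xs else q xs" "\<lambda>xs. if P xs then m xs else n xs"] recf_if *) simp
qed

lemma reci_sum:
  assumes "recf k n" "reci (Suc k) (\<lambda>ys. g (hd ys) (tl ys))"
  shows "reci k (\<lambda>xs. \<Sum>i<n xs. g i xs)"
proof -
  obtain p m where *: "recf (Suc k) p" "recf (Suc k) m"
    "(\<lambda>ys. g (hd ys) (tl ys)) = (\<lambda>xs. int (p xs) - int (m xs))"
    using assms(2) by (rule reciE)
  have "g i xs = int (p (i # xs)) - int (m (i # xs))" for i xs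
    using fun_cong[OF *(3), of "i # xs"] by simp
  moreover have "recf k (\<lambda>xs. \<Sum>i<n xs. q (i # xs))" if "recf (Suc k) q" for q
  proof (rule recf_sum[OF assms(1)])
    show "recf (Suc k) (\<lambda>ys. q (hd ys # tl ys))"
      by (rule recf_cong[OF that]) (metis length_Suc_conv list.sel(1,3))
  qed
  ultimately show ?thesis
    using *(1,2) by (intro reciI[of k "\<lambda>xs. \<Sum>i<n xs. p (i # xs)" "\<lambda>xs. \<Sum>i<n xs. m (i # xs)"])
      (auto simp: sum_subtractf)
qed

lemma reci_decode: "recf k f \<Longrightarrow> reci k (\<lambda>xs. int_decode (f xs))"
proof (rule reciI)
  assume "recf k f"
  then show "recf k (\<lambda>xs. if 2 dvd f xs then f xs div 2 else 0)"
    "recf k (\<lambda>xs. if 2 dvd f xs then 0 else Suc (f xs div 2))"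
    by (intro recf_if recp_dvd recf_div recf_Suc recf_const; assumption)+
qed (auto simp: int_decode_def sum_decode_def)

lemma recf_int_encode: "reci k f \<Longrightarrow> recf k (\<lambda>xs. int_encode (f xs))"
proof (elim reciE)
  fix p m assume *: "recf k p" "recf k m" "f = (\<lambda>xs. int (p xs) - int (m xs))"
  then have "recf k (\<lambda>xs. if m xs \<le> p xs then 2 * (p xs - m xs) else Suc (2 * (m xs - p xs - 1)))"
    by (intro recf_if recp_le recf_mult recf_minus recf_Suc recf_const)
  moreover have "(if m xs \<le> p xs then 2 * (p xs - m xs) else Suc (2 * (m xs - p xs - 1))) = int_encode (f xs)" for xs
    by (auto simp: *(3) int_encode_def sum_encode_def nat_diff_distrib)
  ultimately show ?thesis by simp
qed

lemma recp_eq_int: "reci k f \<Longrightarrow> reci k g \<Longrightarrow> recp k (\<lambda>xs. f xs = g xs)"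
  using recp_eq[OF recf_int_encode recf_int_encode, of k f g] by (simp add: int_encode_eq)

lemma reci_comp1:
  assumes "reci 1 (\<lambda>xs. F (hd xs))" "recf k f"
  shows "reci k (\<lambda>xs. F (f xs))"
  using reci_decode[OF recf_comp1[OF recf_int_encode[OF assms(1)] assms(2)]] by simp

lemma reci_comp2:
  assumes "reci 2 (\<lambda>xs. F (hd xs) (hd (tl xs)))" "recf k f" "recf k g"
  shows "reci k (\<lambda>xs. F (f xs) (g xs))"
  using reci_decode[OF recf_comp2[OF recf_int_encode[OF assms(1)] assms(2,3)]] by simp

lemma reci_comp3:
  assumes "reci 3 (\<lambda>xs. F (hd xs) (hd (tl xs)) (hd (tl (tl xs))))" "recf k f" "recf k g" "recf k h"
  shows "reci k (\<lambda>xs. F (f xs) (g xs) (h xs))"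
  using reci_decode[OF recf_comp3[OF recf_int_encode[OF assms(1)] assms(2-4)]] by simp

text \<open>Coefficient n of a power depends only on coefficients up to n. The recursion on the
  exponent therefore carries the finite table \<open>T\<close> of these coefficients, coded as one
  number, and each step is a convolution.\<close>

lemma reci_fps_power:
  assumes "reci 1 (\<lambda>xs. \<alpha> (hd xs))"
  shows "reci 2 (\<lambda>xs. fps_nth (Abs_fps \<alpha> ^ hd xs) (hd (tl xs)))"
proof -
  define T where "T = (\<lambda>(k::nat) n. rec_nat (list_encode (map (\<lambda>m. if m = 0 then int_encode 1 else int_encode 0) [0..<Suc n]))
    (\<lambda>_ r. list_encode (map (\<lambda>m. int_encode (\<Sum>s<Suc m. \<alpha> s * int_decode (code_nth r (m - s)))) [0..<Suc n])) k)"
  have "T k n = list_encode (map (\<lambda>m. int_encode (fps_nth (Abs_fps \<alpha> ^ k) m)) [0..<Suc n])" for k n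
  proof (induction k)
    case 0
    then show ?case by (auto simp: T_def if_distrib simp del: upt_Suc intro!: map_cong)
  next
    case (Suc k)
    have "T (Suc k) n = list_encode (map (\<lambda>m. int_encode (\<Sum>s<Suc m. \<alpha> s * int_decode (code_nth (T k n) (m - s)))) [0..<Suc n])"
      by (simp add: T_def)
    also have "\<dots> = list_encode (map (\<lambda>m. int_encode (fps_nth (Abs_fps \<alpha> ^ Suc k) m)) [0..<Suc n])"
    proof (intro arg_cong[of _ _ list_encode] map_cong refl arg_cong[of _ _ int_encode])
      fix m assume m: "m \<in> set [0..<Suc n]"
      have "(\<Sum>s<Suc m. \<alpha> s * int_decode (code_nth (T k n) (m - s)))
          = (\<Sum>s<Suc m. \<alpha> s * fps_nth (Abs_fps \<alpha> ^ k) (m - s))"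
        unfolding Suc using m by (intro sum.cong refl) (auto simp: code_nth_eq simp del: upt_Suc)
      then show "(\<Sum>s<Suc m. \<alpha> s * int_decode (code_nth (T k n) (m - s))) = fps_nth (Abs_fps \<alpha> ^ Suc k) m"
        by (simp add: fps_mult_nth atLeast0AtMost lessThan_Suc_atMost)
    qed
    finally show ?case .
  qed
  then have *: "fps_nth (Abs_fps \<alpha> ^ k) n = int_decode (code_nth (T k n) n)" for k n
    by (simp add: code_nth_eq del: upt_Suc)
  show ?thesis
    unfolding * T_def numeral_2_eq_2
    by (intro reci_decode recf_code_nth recf_prec recf_tabulate recf_if recp_eq recf_int_encode
        reci_sum reci_mult reci_comp1[OF assms] recf_minus recf_Suc recf_var recf_const)
qed

text \<open>Minimisation looks for a zero, whereas a characteristic function is 1 where its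
  predicate holds; hence the negation. The second assumption makes the minimisation regular.\<close>

lemma computable_least:
  assumes "recp 2 (\<lambda>xs. P (hd xs) (hd (tl xs)))" "\<And>n. \<exists>c. P c n"
  shows "computable (\<lambda>n. LEAST c. P c n)"
proof -
  obtain g where g: "recursive_fn 2 g"
    "\<And>xs. length xs = 2 \<Longrightarrow> (if \<not> P (hd xs) (hd (tl xs)) then 1 else 0) = g xs"
    using recp_not[OF assms(1)] unfolding recp_def recf_def by blast
  have *: "g [c, n] = 0 \<longleftrightarrow> P c n" for c n
    using g(2)[of "[c, n]"] by (auto split: if_splits)
  have "recursive_fn 1 (\<lambda>xs. LEAST n. g (n # xs) = 0)"
  proof (rule recursive_fn.mini)
    show "recursive_fn (Suc 1) g" using g(1) by (simp add: numeral_2_eq_2)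
    show "\<exists>n. g (n # xs) = 0" if "length xs = 1" for xs
      using that * assms(2) by (auto simp: length_Suc_conv)
  qed
  then show ?thesis unfolding computable_def by (intro exI[of _ "\<lambda>xs. LEAST n. g (n # xs) = 0"]) (simp add: *)
qed

section \<open>A decidable certificate for rational relations\<close>

lemma coeff_decode_poly: "dec 0 = 0 \<Longrightarrow> coeff (decode_poly dec n) i = dec (code_nth n i)"
  by (simp add: decode_poly_def coeff_Poly_eq nth_default_def code_nth_eq)

lemma decode_poly_0: "decode_poly dec 0 = 0"
  by (simp add: decode_poly_def)

lemma decode_rat_0: "decode_rat 0 = 0"
  using prod_encode_inverse[of "(0, 0)"] by (simp add: decode_rat_def prod_encode_def int_decode_def sum_decode_def)

definition code_nth4 :: "nat \<Rightarrow> nat \<Rightarrow> nat \<Rightarrow> nat \<Rightarrow> nat \<Rightarrow> nat" where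
  "code_nth4 c j i l k = code_nth (code_nth (code_nth (code_nth c j) i) l) k"

text \<open>In \<open>decode_rat\<close> the denominator is \<open>Suc y\<close>, so for second
  component 0 this numerator is the coefficient itself.\<close>

definition code_num :: "nat \<Rightarrow> nat \<Rightarrow> nat \<Rightarrow> nat \<Rightarrow> nat \<Rightarrow> int" where
  "code_num c j i l k = int_decode (fst (prod_decode (code_nth4 c j i l k)))"

lemma coeff_decode_poly4:
  "coeff (coeff (coeff (coeff (decode_poly4 c) j) i) l) k = decode_rat (code_nth4 c j i l k)"
  by (simp add: decode_poly4_def coeff_decode_poly decode_poly_0 decode_rat_0 code_nth4_def)

lemma coeff_embed_poly4:
  "coeff (coeff (fps_nth (fps_nth (embed_poly4 P) j) i) l) k = of_rat (coeff (coeff (coeff (coeff P j) i) l) k)"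
  by (simp add: embed_poly4_def coeff_map_poly map_poly_0)

lemma code_nth_less: "code_nth c i \<noteq> 0 \<Longrightarrow> i < c" "code_nth c i \<le> c"
proof -
  show "i < c" if "code_nth c i \<noteq> 0"
    using that length_list_decode_le[of c] by (auto simp: code_nth_eq split: if_splits)
  have "x \<in> set xs \<Longrightarrow> x \<le> list_encode xs" for x xs
  proof (induction xs)
    case (Cons y ys)
    then show ?case
      using le_prod_encode_1[of y "list_encode ys"] le_prod_encode_2[of "list_encode ys" y] by fastforce
  qed simp
  from this[of _ "list_decode c"] show "code_nth c i \<le> c"
    by (auto simp: code_nth_eq)
qed

lemma code_nth_zero: "code_nth 0 i = 0"
  by (simp add: code_nth_eq)

lemma code_nth4_less:
  assumes "code_nth4 c j i l k \<noteq> 0"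
  shows "j < c \<and> i < c \<and> l < c \<and> k < c"
proof -
  let ?c1 = "code_nth c j" and ?c2 = "code_nth (code_nth c j) i" and ?c3 = "code_nth (code_nth (code_nth c j) i) l"
  have "?c3 \<noteq> 0" "?c2 \<noteq> 0" "?c1 \<noteq> 0"
    using assms unfolding code_nth4_def by (metis code_nth_zero)+
  then have "j < c" "i < ?c1" "l < ?c2" "k < ?c3"
    using assms code_nth_less(1) unfolding code_nth4_def by auto
  moreover have "?c1 \<le> c" "?c2 \<le> ?c1" "?c3 \<le> ?c2" by (rule code_nth_less)+
  ultimately show ?thesis by linarith
qed

lemma code_num_eq_0: "code_nth4 c j i l k = 0 \<Longrightarrow> code_num c j i l k = 0"
  using prod_encode_inverse[of "(0, 0)"] by (simp add: code_num_def prod_encode_def int_decode_def sum_decode_def)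

lemma code_num_less: "code_num c j i l k \<noteq> 0 \<Longrightarrow> j < c \<and> i < c \<and> l < c \<and> k < c"
  using code_num_eq_0 code_nth4_less by blast

text \<open>The substitution \<open>a \<mapsto> 3\<^sup>4 a\<close>, \<open>b \<mapsto> 3\<^sup>6 b\<close> makes all Fourier coefficients integral.\<close>

definition int_fps_a :: "int fps" where
  "int_fps_a = Abs_fps (\<lambda>n. if n = 0 then - 27 else - (6480 * int (\<Sum>d<Suc n. if d dvd n then d ^ 3 else 0)))"

definition int_fps_b :: "int fps" where
  "int_fps_b = Abs_fps (\<lambda>n. if n = 0 then 54 else - (27216 * int (\<Sum>d<Suc n. if d dvd n then d ^ 5 else 0)))"

definition int_mono :: "nat \<Rightarrow> nat \<Rightarrow> nat \<Rightarrow> int" where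
  "int_mono k l n = (\<Sum>m<Suc n. fps_nth (int_fps_a ^ k) m * fps_nth (int_fps_b ^ l) (n - m))"

text \<open>The factor N clears the division in the Hecke operator, also in weight 0, where N^(k -
  1) is not an integer.\<close>

definition int_hecke :: "nat \<Rightarrow> nat \<Rightarrow> nat \<Rightarrow> nat \<Rightarrow> int" where
  "int_hecke N i j n = int N * int_mono i j (N * n) + (if N dvd n then int (N ^ (4 * i + 6 * j)) * int_mono i j (n div N) else 0)"

definition int_conv :: "nat \<Rightarrow> nat \<Rightarrow> nat \<Rightarrow> nat \<Rightarrow> nat \<Rightarrow> nat \<Rightarrow> int" where
  "int_conv N k l i j n = (\<Sum>m<Suc n. int_mono k l m * int_hecke N i j (n - m))"

text \<open>These restrictions keep the search successful by \<open>certifies_complete\<close>. A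
  zero second component means denominator 1; the weight condition puts each coefficient of a
  relation into a single weight, as \<open>modular_form_vanishes\<close> requires.\<close>

definition code_integral :: "nat \<Rightarrow> bool" where
  "code_integral c \<longleftrightarrow> (\<forall>j<c. \<forall>i<c. \<forall>l<c. \<forall>k<c. snd (prod_decode (code_nth4 c j i l k)) = 0 \<and>
     (code_num c j i l k \<noteq> 0 \<longrightarrow> 4 * k + 6 * l = 4 * i + 6 * j))"

definition code_nonzero :: "nat \<Rightarrow> bool" where
  "code_nonzero c \<longleftrightarrow> (\<exists>j<c. \<exists>i<c. \<exists>l<c. \<exists>k<c. code_num c j i l k \<noteq> 0)"

text \<open>
  All index ranges may be cut off at \<open>c + N + 2\<close>: for \<open>i\<close> and \<open>j\<close> by \<open>hecke_gf_relation_truncation\<close>, and for the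
  Fourier coefficients by \<open>modular_form_vanishes\<close>, since the weight \<open>4 i + 6 j\<close> is at most \<open>10 (c + N + 1)\<close>. A code is at
  least as large as the lengths of all lists that it encodes, so \<open>l, k < c\<close> covers all coefficients.
\<close>

definition code_relation :: "nat \<Rightarrow> nat \<Rightarrow> nat \<Rightarrow> nat \<Rightarrow> bool" where
  "code_relation N c p q \<longleftrightarrow> (\<forall>j<c + N + 2. \<forall>i<c + N + 2. \<forall>n<c + N + 2.
     (\<Sum>j'<Suc j. \<Sum>i'<Suc i. \<Sum>l<c. \<Sum>k<c. code_num q j' i' l k * int_conv N k l (i - i') (j - j') n) =
     int N * (\<Sum>l<c. \<Sum>k<c. code_num p j i l k * int_mono k l n))"

text \<open>The code \<open>c\<close> of the pair dominates both components, so it serves as their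
  common bound.\<close>

definition certifies :: "nat \<Rightarrow> nat \<Rightarrow> bool" where
  "certifies c N \<longleftrightarrow> (let p = fst (prod_decode c); q = snd (prod_decode c) in
     code_integral p \<and> code_integral q \<and> code_nonzero q \<and> code_relation N c p q)"

section \<open>Decidability of the certificate\<close>

lemma recp_prime: "recf k f \<Longrightarrow> recp k (\<lambda>xs. prime (f xs))"
proof -
  assume f: "recf k f"
  have "recp k (\<lambda>xs. 1 < f xs \<and> (\<forall>m<Suc (f xs). m dvd f xs \<longrightarrow> \<not> (\<not> m = 1 \<and> \<not> m = f xs)))"
    by (intro recp_conj recp_less recp_all recp_imp recp_not recp_dvd recp_eq recf_Suc recf_const recf_weaken recf_var f)
  moreover have "prime n \<longleftrightarrow> 1 < n \<and> (\<forall>m<Suc n. m dvd n \<longrightarrow> \<not> (\<not> m = 1 \<and> \<not> m = n))" for n :: nat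
  proof -
    have "m < Suc n" if "m dvd n" "1 < n" for m using dvd_imp_le[OF that(1)] that(2) by simp
    then show ?thesis unfolding prime_nat_iff by blast
  qed
  ultimately show ?thesis by simp
qed

lemmas rec_intros = recp_conj recp_imp recp_not recp_all recp_ex recp_le recp_less recp_eq recp_eq_int recp_dvd
  recf_sum recf_plus recf_mult recf_minus recf_power recf_div recf_if recf_Suc recf_var recf_const
  recf_fst_decode recf_snd_decode recf_code_nth
  reci_sum reci_plus reci_mult reci_minus reci_if reci_nat reci_decode

lemma reci_const: "reci k (\<lambda>xs. c)"
  using reci_decode[OF recf_const, of k "int_encode c"] by simp

lemma reci_int_fps_a_power: "reci 2 (\<lambda>xs. fps_nth (int_fps_a ^ hd xs) (hd (tl xs)))"
  unfolding int_fps_a_def by (rule reci_fps_power) (unfold One_nat_def, intro rec_intros reci_const)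

lemma reci_int_fps_b_power: "reci 2 (\<lambda>xs. fps_nth (int_fps_b ^ hd xs) (hd (tl xs)))"
  unfolding int_fps_b_def by (rule reci_fps_power) (unfold One_nat_def, intro rec_intros reci_const)

lemma reci_int_mono: "reci 3 (\<lambda>xs. int_mono (hd xs) (hd (tl xs)) (hd (tl (tl xs))))"
  unfolding int_mono_def numeral_3_eq_3
  by (intro rec_intros reci_comp2[OF reci_int_fps_a_power] reci_comp2[OF reci_int_fps_b_power])

text \<open>The premise on N makes the predicate satisfiable for every N, so that the search is
  total; for N not prime it stops at 0.\<close>

lemma recp_certifies: "recp 2 (\<lambda>xs. prime (hd (tl xs)) \<longrightarrow> certifies (hd xs) (hd (tl xs)))"
  unfolding numeral_2_eq_2 certifies_def code_integral_def code_nonzero_def code_relation_def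
    int_conv_def int_hecke_def code_num_def code_nth4_def Let_def
  by (intro rec_intros recp_prime reci_comp3[OF reci_int_mono] reci_const)

section \<open>Fourier coefficients of a relation as integer equations\<close>

lemma sum_square_cong:
  fixes f :: "nat \<Rightarrow> nat \<Rightarrow> 'a :: comm_monoid_add"
  assumes "\<And>l k. f l k \<noteq> 0 \<Longrightarrow> l < B \<and> k < B \<and> l < C \<and> k < C"
  shows "(\<Sum>l<B. \<Sum>k<B. f l k) = (\<Sum>l<C. \<Sum>k<C. f l k)"
proof -
  have "(\<Sum>l<B. \<Sum>k<B. f l k) = (\<Sum>(l, k)\<in>{..<B} \<times> {..<B}. f l k)" "(\<Sum>l<C. \<Sum>k<C. f l k) = (\<Sum>(l, k)\<in>{..<C} \<times> {..<C}. f l k)"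
    by (simp_all add: sum.cartesian_product)
  moreover have "(\<Sum>(l, k)\<in>{..<B} \<times> {..<B}. f l k) = (\<Sum>(l, k)\<in>{..<C} \<times> {..<C}. f l k)"
    by (rule sum.mono_neutral_cong) (auto, (metis assms)+)
  ultimately show ?thesis by simp
qed

definition index_bound :: "nat \<Rightarrow> complex poly poly \<Rightarrow> bool" where
  "index_bound B r \<longleftrightarrow> (\<forall>l k. coeff (coeff r l) k \<noteq> 0 \<longrightarrow> l < B \<and> k < B)"

lemma poly_eq_sum:
  fixes p :: "'a :: comm_ring_1 poly"
  shows "(\<And>i. i \<ge> B \<Longrightarrow> coeff p i = 0) \<Longrightarrow> poly p x = (\<Sum>i<B. coeff p i * x ^ i)"
proof -
  assume *: "\<And>i. i \<ge> B \<Longrightarrow> coeff p i = 0"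
  have "(\<Sum>i\<le>degree p. coeff p i * x ^ i) = (\<Sum>i<B. coeff p i * x ^ i)"
    by (rule sum.mono_neutral_cong) (use * in \<open>auto simp: coeff_eq_0 not_le not_less\<close>)
  then show ?thesis by (simp add: poly_altdef)
qed

lemma form_of_eq_sum:
  assumes "index_bound B r"
  shows "form_of r \<tau> = (\<Sum>l<B. \<Sum>k<B. coeff (coeff r l) k * (form_a \<tau> ^ k * form_b \<tau> ^ l))"
proof -
  have 1: "coeff r l = 0" if "l \<ge> B" for l
    using assms that unfolding index_bound_def by (metis coeff_0 poly_eqI not_le)
  have 2: "coeff (coeff r l) k = 0" if "k \<ge> B" for l k
    using assms that unfolding index_bound_def by (metis not_le)
  have "form_of r \<tau> = (\<Sum>l<B. poly (coeff r l) (form_a \<tau>) * form_b \<tau> ^ l)"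
  proof -
    have "poly r [:form_b \<tau>:] = (\<Sum>l<B. coeff r l * [:form_b \<tau>:] ^ l)"
      by (rule poly_eq_sum[OF 1])
    then show ?thesis by (simp add: form_of_def poly_sum poly_power)
  qed
  also have "\<dots> = (\<Sum>l<B. \<Sum>k<B. coeff (coeff r l) k * (form_a \<tau> ^ k * form_b \<tau> ^ l))"
    by (intro sum.cong refl) (simp add: poly_eq_sum[OF 2] sum_distrib_right mult.assoc)
  finally show ?thesis .
qed

lemma index_bound_exists: "\<exists>B. index_bound B r"
proof -
  let ?B = "Suc (degree r + (\<Sum>l\<le>degree r. degree (coeff r l)))"
  have "l < ?B \<and> k < ?B" if "coeff (coeff r l) k \<noteq> 0" for l k
  proof -
    have l: "l \<le> degree r" using that by (metis coeff_0 coeff_eq_0 not_le)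
    have "k \<le> degree (coeff r l)" using that by (rule le_degree)
    also have "\<dots> \<le> (\<Sum>l\<le>degree r. degree (coeff r l))"
      by (rule member_le_sum) (use l in auto)
    finally show ?thesis using l by simp
  qed
  then show ?thesis unfolding index_bound_def by blast
qed

lemma modular_form_form_of:
  assumes "homogeneous k r"
  shows "modular_form k (form_of r)"
  unfolding modular_form_def
proof (intro conjI ballI q_expansion_form_of)
  fix \<tau> assume \<tau>: "\<tau> \<in> \<H>"
  obtain B where B: "index_bound B r" using index_bound_exists by blast
  have *: "coeff (coeff r l) i * ((\<tau> ^ 4 * form_a \<tau>) ^ i * (\<tau> ^ 6 * form_b \<tau>) ^ l) =
      \<tau> ^ k * (coeff (coeff r l) i * (form_a \<tau> ^ i * form_b \<tau> ^ l))" for i l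
  proof (cases "coeff (coeff r l) i = 0")
    case False
    then have "k = 4 * i + 6 * l" using assms by (auto simp: homogeneous_def)
    then show ?thesis by (simp add: power_mult_distrib power_add power_mult)
  qed simp
  then show "form_of r (- 1 / \<tau>) = \<tau> ^ k * form_of r \<tau>"
    unfolding form_of_eq_sum[OF B] modular_formD(1)[OF modular_form_a \<tau>] modular_formD(1)[OF modular_form_b \<tau>]
    unfolding sum_distrib_left by (intro sum.cong refl *)
qed

definition q_conv :: "nat \<Rightarrow> nat \<Rightarrow> nat \<Rightarrow> nat \<Rightarrow> nat \<Rightarrow> complex fps" where
  "q_conv N k l i j = (fps_a ^ k * fps_b ^ l) * hecke_fps N (4 * i + 6 * j) (fps_a ^ i * fps_b ^ j)"

text \<open>Expresses a coefficient of \<open>Q * hecke_gf N\<close> through the Fourier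
  coefficients of monomials, so the polynomials \<open>hecke_ring\<close> need never be known
  explicitly.\<close>

definition q_lhs :: "nat \<Rightarrow> nat \<Rightarrow> complex poly poly fps fps \<Rightarrow> nat \<Rightarrow> nat \<Rightarrow> complex fps" where
  "q_lhs N B Q j i = (\<Sum>j'<Suc j. \<Sum>i'<Suc i. \<Sum>l<B. \<Sum>k<B.
     fps_const (coeff (coeff (fps_nth (fps_nth Q j') i') l) k) * q_conv N k l (i - i') (j - j'))"

definition q_rhs :: "nat \<Rightarrow> complex poly poly fps fps \<Rightarrow> nat \<Rightarrow> nat \<Rightarrow> complex fps" where
  "q_rhs B P j i = (\<Sum>l<B. \<Sum>k<B. fps_const (coeff (coeff (fps_nth (fps_nth P j) i) l) k) * (fps_a ^ k * fps_b ^ l))"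

lemma q_expansion_relation:
  assumes "prime N" "\<And>i j. index_bound B (fps_nth (fps_nth Q j) i)" "\<And>i j. index_bound B (fps_nth (fps_nth P j) i)"
  shows "q_expansion (form_of (fps_nth (fps_nth (Q * hecke_gf N - P) j) i)) (q_lhs N B Q j i - q_rhs B P j i)"
proof -
  have N: "N > 0" using assms(1) prime_gt_0_nat by blast
  have mono: "q_expansion (\<lambda>\<tau>. form_a \<tau> ^ k * form_b \<tau> ^ l) (fps_a ^ k * fps_b ^ l)" for k l
    by (intro q_expansion_mult q_expansion_power q_expansion_form_a q_expansion_form_b)
  have "q_expansion (\<lambda>\<tau>. (\<Sum>j'<Suc j. \<Sum>i'<Suc i. \<Sum>l<B. \<Sum>k<B. coeff (coeff (fps_nth (fps_nth Q j') i') l) k *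
        ((form_a \<tau> ^ k * form_b \<tau> ^ l) * hecke N (4 * (i - i') + 6 * (j - j')) (form_of (var_a ^ (i - i') * var_b ^ (j - j'))) \<tau>)) -
      (\<Sum>l<B. \<Sum>k<B. coeff (coeff (fps_nth (fps_nth P j) i) l) k * (form_a \<tau> ^ k * form_b \<tau> ^ l)))
     (q_lhs N B Q j i - q_rhs B P j i)"
    unfolding q_lhs_def q_rhs_def q_conv_def
    by (intro q_expansion_diff q_expansion_sum q_expansion_cmult q_expansion_mult mono q_expansion_hecke[OF q_expansion_monomial N])
  then show ?thesis
  proof (rule q_expansion_cong)
    fix \<tau> assume \<tau>: "\<tau> \<in> \<H>"
    have "form_of (fps_nth (fps_nth (Q * hecke_gf N) j) i) \<tau> = (\<Sum>j'<Suc j. \<Sum>i'<Suc i. \<Sum>l<B. \<Sum>k<B. coeff (coeff (fps_nth (fps_nth Q j') i') l) k *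
        ((form_a \<tau> ^ k * form_b \<tau> ^ l) * hecke N (4 * (i - i') + 6 * (j - j')) (form_of (var_a ^ (i - i') * var_b ^ (j - j'))) \<tau>))"
      unfolding fps_fps_mult_nth hecke_gf_nth form_of_sum form_of_simps(5) hecke_ring_monomial(1)[OF assms(1) \<tau>]
        form_of_eq_sum[OF assms(2)] lessThan_Suc_atMost sum_distrib_right
      by (intro sum.cong refl) (simp only: mult.assoc)
    then show "form_of (fps_nth (fps_nth (Q * hecke_gf N - P) j) i) \<tau> = (\<Sum>j'<Suc j. \<Sum>i'<Suc i. \<Sum>l<B. \<Sum>k<B. coeff (coeff (fps_nth (fps_nth Q j') i') l) k *
        ((form_a \<tau> ^ k * form_b \<tau> ^ l) * hecke N (4 * (i - i') + 6 * (j - j')) (form_of (var_a ^ (i - i') * var_b ^ (j - j'))) \<tau>)) -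
      (\<Sum>l<B. \<Sum>k<B. coeff (coeff (fps_nth (fps_nth P j) i) l) k * (form_a \<tau> ^ k * form_b \<tau> ^ l))"
      unfolding fps_sub_nth form_of_simps(4) form_of_eq_sum[OF assms(3)] by (simp only:)
  qed
qed

definition of_int_fps :: "int fps \<Rightarrow> complex fps" where
  "of_int_fps F = Abs_fps (\<lambda>n. of_int (fps_nth F n))"

lemma of_int_fps_mult: "of_int_fps (F * G) = of_int_fps F * of_int_fps G"
  by (rule fps_ext) (simp add: of_int_fps_def fps_mult_nth)

lemma of_int_fps_power: "of_int_fps (F ^ n) = of_int_fps F ^ n"
proof (induction n)
  case 0
  show ?case by (rule fps_ext) (simp add: of_int_fps_def fps_one_nth)
qed (simp add: of_int_fps_mult)

lemma divisor_sum_bounded: "n > 0 \<Longrightarrow> (\<Sum>d<Suc n. if d dvd n then d ^ j else 0) = divisor_sum j n"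
  unfolding divisor_sum_def
  by (rule sum.mono_neutral_cong_right[of "{..<Suc n}", symmetric, THEN sym])
    (auto simp: less_Suc_eq_le dvd_imp_le)

lemma of_int_fps_a: "of_int_fps int_fps_a = fps_const 81 * fps_a"
  by (rule fps_ext) (simp add: of_int_fps_def int_fps_a_def fps_a_def divisor_sum_bounded del: sum.lessThan_Suc)

lemma of_int_fps_b: "of_int_fps int_fps_b = fps_const 729 * fps_b"
  by (rule fps_ext) (simp add: of_int_fps_def int_fps_b_def fps_b_def divisor_sum_bounded del: sum.lessThan_Suc)

lemma of_int_int_mono: "of_int (int_mono k l n) = (3 :: complex) ^ (4 * k + 6 * l) * fps_nth (fps_a ^ k * fps_b ^ l) n"
proof -
  have "int_mono k l n = fps_nth (int_fps_a ^ k * int_fps_b ^ l) n"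
    by (simp only: int_mono_def fps_mult_nth lessThan_Suc_atMost atLeast0AtMost)
  then have "of_int (int_mono k l n) = fps_nth (of_int_fps (int_fps_a ^ k * int_fps_b ^ l)) n"
    by (simp add: of_int_fps_def)
  also have "of_int_fps (int_fps_a ^ k * int_fps_b ^ l) = fps_const (81 ^ k * 729 ^ l) * (fps_a ^ k * fps_b ^ l)"
    by (simp add: of_int_fps_mult of_int_fps_power of_int_fps_a of_int_fps_b power_mult_distrib fps_const_power mult_ac
        flip: fps_const_mult)
  finally show ?thesis by (simp add: power_add power_mult)
qed

lemma of_int_int_hecke:
  assumes "N > 0"
  shows "of_int (int_hecke N i j n) = of_nat N * (3 :: complex) ^ (4 * i + 6 * j) *
    fps_nth (hecke_fps N (4 * i + 6 * j) (fps_a ^ i * fps_b ^ j)) n"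
  using assms by (simp add: int_hecke_def of_int_int_mono hecke_fps_def algebra_simps)

lemma of_int_int_conv:
  assumes "N > 0"
  shows "of_int (int_conv N k l i j n) = of_nat N * (3 :: complex) ^ ((4 * k + 6 * l) + (4 * i + 6 * j)) * fps_nth (q_conv N k l i j) n"
  unfolding int_conv_def q_conv_def fps_mult_nth[of "fps_a ^ k * fps_b ^ l"] of_int_sum of_int_mult of_int_int_mono
    of_int_int_hecke[OF assms] sum_distrib_left atLeast0AtMost lessThan_Suc_atMost power_add
  by (intro sum.cong refl) (simp only: mult_ac)

text \<open>By homogeneity of \<open>Q\<close> the weights of the two monomials in every nonzero
  term add up to 4 i + 6 j, so the scaling by powers of 3 is one common factor.\<close>

lemma scaled_lhs:
  assumes "N > 0" "\<And>i j. homogeneous (4 * i + 6 * j) (fps_nth (fps_nth Q j) i)"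
  shows "(\<Sum>j'<Suc j. \<Sum>i'<Suc i. \<Sum>l<B. \<Sum>k<B. coeff (coeff (fps_nth (fps_nth Q j') i') l) k * of_int (int_conv N k l (i - i') (j - j') n)) =
    of_nat N * 3 ^ (4 * i + 6 * j) * fps_nth (q_lhs N B Q j i) n"
  unfolding q_lhs_def fps_sum_nth sum_distrib_left fps_mult_left_const_nth
proof (intro sum.cong refl)
  fix j' i' l k assume "j' \<in> {..<Suc j}" "i' \<in> {..<Suc i}"
  show "coeff (coeff (fps_nth (fps_nth Q j') i') l) k * of_int (int_conv N k l (i - i') (j - j') n) =
      of_nat N * 3 ^ (4 * i + 6 * j) * (coeff (coeff (fps_nth (fps_nth Q j') i') l) k * fps_nth (q_conv N k l (i - i') (j - j')) n)"
  proof (cases "coeff (coeff (fps_nth (fps_nth Q j') i') l) k = 0")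
    case False
    then have "4 * k + 6 * l = 4 * i' + 6 * j'" using assms(2) by (auto simp: homogeneous_def)
    then have "(4 * k + 6 * l) + (4 * (i - i') + 6 * (j - j')) = 4 * i + 6 * j"
      using \<open>j' \<in> _\<close> \<open>i' \<in> _\<close> by auto
    then show ?thesis unfolding of_int_int_conv[OF assms(1)] by simp
  qed simp
qed

lemma scaled_rhs:
  assumes "\<And>i j. homogeneous (4 * i + 6 * j) (fps_nth (fps_nth P j) i)"
  shows "(\<Sum>l<B. \<Sum>k<B. coeff (coeff (fps_nth (fps_nth P j) i) l) k * of_int (int_mono k l n)) =
    3 ^ (4 * i + 6 * j) * fps_nth (q_rhs B P j i) n"
  unfolding q_rhs_def fps_sum_nth sum_distrib_left fps_mult_left_const_nth
proof (intro sum.cong refl)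
  fix l k
  show "coeff (coeff (fps_nth (fps_nth P j) i) l) k * of_int (int_mono k l n) =
      3 ^ (4 * i + 6 * j) * (coeff (coeff (fps_nth (fps_nth P j) i) l) k * fps_nth (fps_a ^ k * fps_b ^ l) n)"
  proof (cases "coeff (coeff (fps_nth (fps_nth P j) i) l) k = 0")
    case False
    then have "4 * k + 6 * l = 4 * i + 6 * j" using assms by (auto simp: homogeneous_def)
    then show ?thesis unfolding of_int_int_mono by simp
  qed simp
qed

lemma homogeneous_diff: "homogeneous k r \<Longrightarrow> homogeneous k s \<Longrightarrow> homogeneous k (r - s)"
  unfolding homogeneous_def by (metis coeff_diff diff_self)

text \<open>The difference of the two sides is a modular form of weight 4 i + 6 j, so its first m
  Fourier coefficients decide. The integer equations are these coefficients up to the nonzero factor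
  N 3^(4 i + 6 j).\<close>

lemma hecke_gf_relation_coeff:
  assumes "prime N" "\<And>i j. index_bound B (fps_nth (fps_nth Q j) i)" "\<And>i j. index_bound B (fps_nth (fps_nth P j) i)"
    "\<And>i j. homogeneous (4 * i + 6 * j) (fps_nth (fps_nth Q j) i)"
    "\<And>i j. homogeneous (4 * i + 6 * j) (fps_nth (fps_nth P j) i)"
    "4 * i + 6 * j \<le> 10 * m" "m \<ge> 1"
    "\<And>n. n < m \<Longrightarrow> (\<Sum>j'<Suc j. \<Sum>i'<Suc i. \<Sum>l<B. \<Sum>k<B. coeff (coeff (fps_nth (fps_nth Q j') i') l) k * of_int (int_conv N k l (i - i') (j - j') n)) =
      of_nat N * (\<Sum>l<B. \<Sum>k<B. coeff (coeff (fps_nth (fps_nth P j) i) l) k * of_int (int_mono k l n))"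
  shows "fps_nth (fps_nth (Q * hecke_gf N) j) i = fps_nth (fps_nth P j) i"
proof -
  have N: "N > 0" using assms(1) prime_gt_0_nat by blast
  let ?X = "fps_nth (fps_nth (Q * hecke_gf N - P) j) i"
  have "homogeneous (4 * i + 6 * j) (fps_nth (fps_nth (Q * hecke_gf N) j) i)"
    by (rule homogeneous_mult_hecke_gf[OF assms(1,4)])
  then have "homogeneous (4 * i + 6 * j) ?X"
    using homogeneous_diff assms(5) by (simp add: fps_sub_nth)
  then have mf: "modular_form (4 * i + 6 * j) (form_of ?X)" by (rule modular_form_form_of)
  have "fps_nth (q_lhs N B Q j i - q_rhs B P j i) n = 0" if "n < m" for n
  proof -
    have "of_nat N * 3 ^ (4 * i + 6 * j) * fps_nth (q_lhs N B Q j i) n = of_nat N * (3 ^ (4 * i + 6 * j) * fps_nth (q_rhs B P j i) n)"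
      using assms(8)[OF that] unfolding scaled_lhs[OF N assms(4)] scaled_rhs[OF assms(5)] .
    then show ?thesis using N by simp
  qed
  then have "form_of ?X \<tau> = 0" if "\<tau> \<in> \<H>" for \<tau>
    using modular_form_vanishes[OF mf q_expansion_relation[OF assms(1-3)] _ assms(7,6) that] by blast
  then have "?X = 0" by (rule form_of_eq_0)
  then show ?thesis by (simp add: fps_sub_nth)
qed

section \<open>Soundness of the certificate\<close>

lemma coeff_decode_integral:
  assumes "code_integral c"
  shows "coeff (coeff (fps_nth (fps_nth (embed_poly4 (decode_poly4 c)) j) i) l) k = of_int (code_num c j i l k)"
proof (cases "j < c \<and> i < c \<and> l < c \<and> k < c")
  case True
  then have "snd (prod_decode (code_nth4 c j i l k)) = 0" using assms by (auto simp: code_integral_def)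
  then show ?thesis
    by (simp add: coeff_embed_poly4 coeff_decode_poly4 decode_rat_def code_num_def case_prod_unfold)
next
  case False
  then have "code_nth4 c j i l k = 0" using code_nth4_less by blast
  then show ?thesis
    by (simp add: coeff_embed_poly4 coeff_decode_poly4 decode_rat_0 code_num_eq_0)
qed

lemma decode_integral_bounds:
  assumes "code_integral c" "c \<le> C"
  shows "index_bound C (fps_nth (fps_nth (embed_poly4 (decode_poly4 c)) j) i)"
    "homogeneous (4 * i + 6 * j) (fps_nth (fps_nth (embed_poly4 (decode_poly4 c)) j) i)"
    "bounded_support C (embed_poly4 (decode_poly4 c))"
proof -
  show "index_bound C (fps_nth (fps_nth (embed_poly4 (decode_poly4 c)) j) i)"
    unfolding index_bound_def coeff_decode_integral[OF assms(1)] of_int_eq_0_iff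
    using code_num_less assms(2) by (meson less_le_trans)
  show "homogeneous (4 * i + 6 * j) (fps_nth (fps_nth (embed_poly4 (decode_poly4 c)) j) i)"
    unfolding homogeneous_def coeff_decode_integral[OF assms(1)] of_int_eq_0_iff
    using code_num_less assms(1) unfolding code_integral_def by blast
  show "bounded_support C (embed_poly4 (decode_poly4 c))"
    unfolding bounded_support_def
  proof (intro allI impI poly_eqI)
    fix i j l k assume "C < i \<or> C < j"
    then have "code_num c j i l k = 0" using code_num_less[of c j i l k] assms(2) by linarith
    then show "coeff (coeff (fps_nth (fps_nth (embed_poly4 (decode_poly4 c)) j) i) l) k = coeff (coeff 0 l) k"
      by (simp add: coeff_decode_integral[OF assms(1)])
  qed
qed

theorem certifies_sound:
  assumes "prime N" "certifies c N"
  defines "P \<equiv> decode_poly4 (fst (prod_decode c))" and "Q \<equiv> decode_poly4 (snd (prod_decode c))"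
  shows "Q \<noteq> 0" "embed_poly4 Q * hecke_gf N = embed_poly4 P"
proof -
  define p q where "p = fst (prod_decode c)" and "q = snd (prod_decode c)"
  have cert: "code_integral p" "code_integral q" "code_nonzero q" "code_relation N c p q"
    using assms(2) by (auto simp: certifies_def Let_def p_def q_def)
  have "prod_encode (p, q) = c" by (simp add: p_def q_def)
  then have le: "p \<le> c" "q \<le> c" using le_prod_encode_1 le_prod_encode_2 by metis+
  have PQ: "P = decode_poly4 p" "Q = decode_poly4 q" by (simp_all add: P_def Q_def p_def q_def)
  show "Q \<noteq> 0"
  proof
    assume "Q = 0"
    then have "embed_poly4 (decode_poly4 q) = 0" by (simp add: PQ embed_poly4_def map_poly_0)
    moreover obtain j i l k where "code_num q j i l k \<noteq> 0" using cert(3) unfolding code_nonzero_def by blast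
    ultimately show False using coeff_decode_integral[OF cert(2), of j i l k] by simp
  qed
  note bp = decode_integral_bounds[OF cert(1) le(1)] and bq = decode_integral_bounds[OF cert(2) le(2)]
  show "embed_poly4 Q * hecke_gf N = embed_poly4 P"
    unfolding PQ
  proof (rule hecke_gf_relation_truncation[OF assms(1) bq(3) bp(3)])
    fix i j assume ij: "i \<le> c + N + 1" "j \<le> c + N + 1"
    show "fps_nth (fps_nth (embed_poly4 (decode_poly4 q) * hecke_gf N) j) i = fps_nth (fps_nth (embed_poly4 (decode_poly4 p)) j) i"
    proof (rule hecke_gf_relation_coeff[OF assms(1) bq(1) bp(1) bq(2) bp(2), where m = "c + N + 2"])
      fix n assume "n < c + N + 2"
      then have "(\<Sum>j'<Suc j. \<Sum>i'<Suc i. \<Sum>l<c. \<Sum>k<c. code_num q j' i' l k * int_conv N k l (i - i') (j - j') n) =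
         int N * (\<Sum>l<c. \<Sum>k<c. code_num p j i l k * int_mono k l n)"
        using cert(4) ij unfolding code_relation_def by simp
      then have "(of_int (\<Sum>j'<Suc j. \<Sum>i'<Suc i. \<Sum>l<c. \<Sum>k<c. code_num q j' i' l k * int_conv N k l (i - i') (j - j') n) :: complex) =
         of_int (int N * (\<Sum>l<c. \<Sum>k<c. code_num p j i l k * int_mono k l n))"
        by (simp only:)
      then show "(\<Sum>j'<Suc j. \<Sum>i'<Suc i. \<Sum>l<c. \<Sum>k<c. coeff (coeff (fps_nth (fps_nth (embed_poly4 (decode_poly4 q)) j') i') l) k * of_int (int_conv N k l (i - i') (j - j') n)) =
        of_nat N * (\<Sum>l<c. \<Sum>k<c. coeff (coeff (fps_nth (fps_nth (embed_poly4 (decode_poly4 p)) j) i) l) k * of_int (int_mono k l n))"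
        unfolding coeff_decode_integral[OF cert(1)] coeff_decode_integral[OF cert(2)] of_int_sum of_int_mult of_int_of_nat_eq .
    qed (use ij in auto)
  qed
qed

section \<open>Existence of a certificate\<close>

lemma rational_projection:
  obtains \<phi> :: "complex \<Rightarrow> rat" where "\<And>x y. \<phi> (x + y) = \<phi> x + \<phi> y" "\<And>r x. \<phi> (of_rat r * x) = r * \<phi> x" "\<phi> 1 = 1"
proof -
  interpret vector_space_pair "\<lambda>r z. of_rat r * z :: complex" "(*) :: rat \<Rightarrow> rat \<Rightarrow> rat"
    by unfold_locales (auto simp: algebra_simps of_rat_add of_rat_mult)
  have "vs1.independent {1 :: complex}" by simp
  \<comment> \<open>A basis of \<complex> over \<rat> that contains 1 provides the functional. It is
    not explicit, but only the existence of a solution rests on it.\<close>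
  then obtain g where g: "Vector_Spaces.linear (\<lambda>r z. of_rat r * z :: complex) ((*) :: rat \<Rightarrow> rat \<Rightarrow> rat) g" "\<forall>x\<in>{1}. g x = (1 :: rat)"
    using linear_independent_extend[of "{1}" "\<lambda>_. 1"] by blast
  interpret g: Vector_Spaces.linear "\<lambda>r z. of_rat r * z :: complex" "(*) :: rat \<Rightarrow> rat \<Rightarrow> rat" g
    by (rule g(1))
  show ?thesis using that[of g] g.add g.scale g(2) by auto
qed

lemma common_denominator:
  assumes "finite (S :: rat set)"
  shows "\<exists>M :: nat. M > 0 \<and> (\<forall>r\<in>S. \<exists>z :: int. of_int z = of_nat M * r)"
  using assms
proof (induction S rule: finite_induct)
  case (insert r S)
  then obtain M :: nat where M: "M > 0" "\<And>s. s \<in> S \<Longrightarrow> \<exists>z :: int. of_int z = of_nat M * s" by blast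
  obtain a b where ab: "quotient_of r = (a, b)" by (cases "quotient_of r")
  then have b: "b > 0" "r = of_int a / of_int b" using quotient_of_denom_pos quotient_of_div by auto
  have "\<exists>z :: int. of_int z = of_nat (M * nat b) * s" if "s \<in> insert r S" for s
  proof (cases "s = r")
    case True
    have "of_int (int M * a) = of_nat (M * nat b) * r" using b by simp
    then show ?thesis using True by metis
  next
    case False
    then obtain z where "of_int z = of_nat M * s" using M(2) \<open>s \<in> insert r S\<close> by blast
    then have "of_int (z * b) = of_nat (M * nat b) * s" using b by simp
    then show ?thesis by blast
  qed
  then show ?case using M(1) b(1) by (intro exI[of _ "M * nat b"]) auto
qed (use exI[of _ 1] in auto)

lemma code_exists:
  fixes f :: "nat \<Rightarrow> nat \<Rightarrow> nat \<Rightarrow> nat \<Rightarrow> int"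
  assumes "\<And>j i l k. f j i l k \<noteq> 0 \<Longrightarrow> j < B \<and> i < B \<and> l < B \<and> k < B"
  obtains c where "\<And>j i l k. code_num c j i l k = f j i l k" "\<And>j i l k. snd (prod_decode (code_nth4 c j i l k)) = 0"
proof
  define tab where "tab g = list_encode (map g [0..<B])" for g :: "nat \<Rightarrow> nat"
  have tab: "code_nth (tab g) i = (if i < B then g i else 0)" for g i
    by (simp add: code_nth_eq tab_def)
  define c where "c = tab (\<lambda>j. tab (\<lambda>i. tab (\<lambda>l. tab (\<lambda>k. prod_encode (int_encode (f j i l k), 0)))))"
  have "code_nth4 c j i l k = (if j < B \<and> i < B \<and> l < B \<and> k < B then prod_encode (int_encode (f j i l k), 0) else 0)" for j i l k
    by (simp add: code_nth4_def c_def tab code_nth_zero)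
  \<comment> \<open>The code of a zero coefficient coincides with the default value 0 outside the
    box.\<close>
  moreover have "prod_encode (int_encode 0, 0) = 0"
    by (simp add: prod_encode_def int_encode_def sum_encode_def)
  ultimately have "code_nth4 c j i l k = prod_encode (int_encode (f j i l k), 0)" for j i l k
    using assms[of j i l k] by (cases "f j i l k = 0") auto
  then show "code_num c j i l k = f j i l k" "snd (prod_decode (code_nth4 c j i l k)) = 0" for j i l k
    by (simp_all add: code_num_def)
qed

text \<open>The equations for the coefficients of \<open>D\<close> and \<open>P\<close> are linear
  with integer coefficients, so applying the projection to all unknowns preserves them. It also
  preserves zeros, hence the weights and the supports. Clearing denominators finally gives
  integers.\<close>

theorem certifies_complete:
  assumes "prime N"
  shows "\<exists>c. certifies c N"
proof -
  have N: "N > 0" using assms prime_gt_0_nat by blast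
  obtain D P where D: "D * hecke_gf N = P" "fps_nth (fps_nth D 0) 0 = 1" "bounded_support (N + 1) D" "bounded_support N P"
    "\<And>i j. homogeneous (4 * i + 6 * j) (fps_nth (fps_nth D j) i)"
    "\<And>i j. homogeneous (4 * i + 6 * j) (fps_nth (fps_nth P j) i)"
    using hecke_gf_complex_denominator[OF assms] by metis
  \<comment> \<open>The weights that occur are at most 10 (N + 1), which bounds the exponents of
    \<open>a\<close> and \<open>b\<close>; i and j are at most N + 1.\<close>
  define B where "B = 10 * (N + 2)"
  have bound: "j < B \<and> i < B \<and> l < B \<and> k < B \<and> 4 * k + 6 * l = 4 * i + 6 * j"
    if X: "bounded_support (N + 1) X" "\<And>i j. homogeneous (4 * i + 6 * j) (fps_nth (fps_nth X j) i)"
      and nz: "coeff (coeff (fps_nth (fps_nth X j) i) l) k \<noteq> 0" for X i j k l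
  proof -
    have "4 * k + 6 * l = 4 * i + 6 * j" using X(2) nz by (auto simp: homogeneous_def)
    moreover have "i \<le> N + 1" "j \<le> N + 1"
      using X(1) nz unfolding bounded_support_def by (metis coeff_0 not_le)+
    ultimately show ?thesis by (simp add: B_def)
  qed
  have P': "bounded_support (N + 1) P" by (rule bounded_support_mono[OF D(4)]) simp
  note bD = bound[OF D(3,5)] and bP = bound[OF P' D(6)]
  have ib: "index_bound B (fps_nth (fps_nth D j) i)" "index_bound B (fps_nth (fps_nth P j) i)" for i j
    unfolding index_bound_def using bD bP by blast+
  obtain \<phi> :: "complex \<Rightarrow> rat" where \<phi>: "\<And>x y. \<phi> (x + y) = \<phi> x + \<phi> y" "\<And>r x. \<phi> (of_rat r * x) = r * \<phi> x" "\<phi> 1 = 1"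
    using rational_projection by blast
  have \<phi>0: "\<phi> 0 = 0" using \<phi>(2)[of 0 0] by simp
  have \<phi>_sum: "\<phi> (sum f A) = (\<Sum>x\<in>A. \<phi> (f x))" for f and A :: "nat set"
    by (induction A rule: infinite_finite_induct) (auto simp: \<phi> \<phi>0)
  have \<phi>_int: "\<phi> (x * of_int z) = \<phi> x * of_int z" for x z
    using \<phi>(2)[of "of_int z" x] by (simp add: mult.commute)
  have \<phi>_nat: "\<phi> (of_nat n * x) = of_nat n * \<phi> x" for x n
    using \<phi>(2)[of "of_nat n" x] by simp
  define d where "d j i l k = \<phi> (coeff (coeff (fps_nth (fps_nth D j) i) l) k)" for j i l k
  define e where "e j i l k = \<phi> (coeff (coeff (fps_nth (fps_nth P j) i) l) k)" for j i l k
  have de: "(\<Sum>j'<Suc j. \<Sum>i'<Suc i. \<Sum>l<B. \<Sum>k<B. d j' i' l k * of_int (int_conv N k l (i - i') (j - j') n)) =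
      of_nat N * (\<Sum>l<B. \<Sum>k<B. e j i l k * of_int (int_mono k l n))" for i j n
  proof -
    have "q_expansion (form_of (fps_nth (fps_nth (D * hecke_gf N - P) j) i)) (q_lhs N B D j i - q_rhs B P j i)"
      by (rule q_expansion_relation[OF assms ib])
    then have "q_expansion (\<lambda>\<tau>. 0) (q_lhs N B D j i - q_rhs B P j i)"
      by (rule q_expansion_cong) (simp add: D(1))
    then have "q_lhs N B D j i = q_rhs B P j i"
      using q_expansion_unique[OF _ q_expansion_const[of 0]] by (metis eq_iff_diff_eq_0 fps_const_0_eq_0)
    then have "(\<Sum>j'<Suc j. \<Sum>i'<Suc i. \<Sum>l<B. \<Sum>k<B. coeff (coeff (fps_nth (fps_nth D j') i') l) k * of_int (int_conv N k l (i - i') (j - j') n)) =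
      of_nat N * (\<Sum>l<B. \<Sum>k<B. coeff (coeff (fps_nth (fps_nth P j) i) l) k * of_int (int_mono k l n))"
      unfolding scaled_lhs[OF N D(5)] scaled_rhs[OF D(6)] by simp
    from arg_cong[OF this, of \<phi>] show ?thesis
      unfolding \<phi>_nat \<phi>_sum \<phi>_int d_def e_def .
  qed
  let ?box = "{..<B} \<times> {..<B} \<times> {..<B} \<times> {..<B}"
  \<comment> \<open>0 is inserted for the indices outside the box, where all coefficients
    vanish.\<close>
  let ?S = "insert 0 ((\<lambda>(j, i, l, k). d j i l k) ` ?box \<union> (\<lambda>(j, i, l, k). e j i l k) ` ?box)"
  have "finite ?S" by simp
  then obtain M :: nat where M0: "M > 0 \<and> (\<forall>r\<in>?S. \<exists>z :: int. of_int z = of_nat M * r)"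
    using common_denominator by blast
  have M: "M > 0" using M0 by (rule conjunct1)
  have M_mult: "\<exists>z :: int. of_int z = of_nat M * r" if "r \<in> ?S" for r
    using conjunct2[OF M0] that by (rule bspec)
  have d0: "j < B \<and> i < B \<and> l < B \<and> k < B \<and> 4 * k + 6 * l = 4 * i + 6 * j" if "d j i l k \<noteq> 0" for j i l k
  proof (rule bD)
    show "coeff (coeff (fps_nth (fps_nth D j) i) l) k \<noteq> 0"
      using that \<phi>0 unfolding d_def by metis
  qed
  have e0: "j < B \<and> i < B \<and> l < B \<and> k < B \<and> 4 * k + 6 * l = 4 * i + 6 * j" if "e j i l k \<noteq> 0" for j i l k
  proof (rule bP)
    show "coeff (coeff (fps_nth (fps_nth P j) i) l) k \<noteq> 0"
      using that \<phi>0 unfolding e_def by metis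
  qed
  have "\<exists>z :: int. of_int z = of_nat M * d j i l k" for j i l k
  proof (cases "d j i l k = 0")
    case False
    then have "d j i l k \<in> (\<lambda>(j, i, l, k). d j i l k) ` ?box"
      using d0 by (intro image_eqI[of _ _ "(j, i, l, k)"]) auto
    then show ?thesis by (intro M_mult) blast
  qed (intro M_mult, simp)
  then obtain zd where zd: "\<And>j i l k. of_int (zd j i l k) = of_nat M * d j i l k" by metis
  have "\<exists>z :: int. of_int z = of_nat M * e j i l k" for j i l k
  proof (cases "e j i l k = 0")
    case False
    then have "e j i l k \<in> (\<lambda>(j, i, l, k). e j i l k) ` ?box"
      using e0 by (intro image_eqI[of _ _ "(j, i, l, k)"]) auto
    then show ?thesis by (intro M_mult) blast
  qed (intro M_mult, simp)
  then obtain ze where ze: "\<And>j i l k. of_int (ze j i l k) = of_nat M * e j i l k" by metis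
  have zd0: "j < B \<and> i < B \<and> l < B \<and> k < B \<and> 4 * k + 6 * l = 4 * i + 6 * j" if "zd j i l k \<noteq> 0" for j i l k
    using that zd[of j i l k] d0[of j i l k] by (cases "d j i l k = 0") auto
  have ze0: "j < B \<and> i < B \<and> l < B \<and> k < B \<and> 4 * k + 6 * l = 4 * i + 6 * j" if "ze j i l k \<noteq> 0" for j i l k
    using that ze[of j i l k] e0[of j i l k] by (cases "e j i l k = 0") auto
  have rel: "(\<Sum>j'<Suc j. \<Sum>i'<Suc i. \<Sum>l<B. \<Sum>k<B. zd j' i' l k * int_conv N k l (i - i') (j - j') n) =
      int N * (\<Sum>l<B. \<Sum>k<B. ze j i l k * int_mono k l n)" for i j n
  proof -
    have "(of_int (\<Sum>j'<Suc j. \<Sum>i'<Suc i. \<Sum>l<B. \<Sum>k<B. zd j' i' l k * int_conv N k l (i - i') (j - j') n) :: rat) =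
       of_nat M * (\<Sum>j'<Suc j. \<Sum>i'<Suc i. \<Sum>l<B. \<Sum>k<B. d j' i' l k * of_int (int_conv N k l (i - i') (j - j') n))"
      unfolding of_int_sum of_int_mult zd sum_distrib_left by (simp only: mult.assoc)
    also have "\<dots> = of_int (int N * (\<Sum>l<B. \<Sum>k<B. ze j i l k * int_mono k l n))"
      unfolding de of_int_sum of_int_mult ze sum_distrib_left of_int_of_nat_eq by (simp only: mult_ac)
    finally show ?thesis by (simp only: of_int_eq_iff)
  qed
  obtain q where q: "\<And>j i l k. code_num q j i l k = zd j i l k" "\<And>j i l k. snd (prod_decode (code_nth4 q j i l k)) = 0"
    using code_exists[of zd B] zd0 by metis
  obtain p where p: "\<And>j i l k. code_num p j i l k = ze j i l k" "\<And>j i l k. snd (prod_decode (code_nth4 p j i l k)) = 0"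
    using code_exists[of ze B] ze0 by metis
  define c where "c = prod_encode (p, q)"
  have le: "p \<le> c" "q \<le> c" unfolding c_def by (rule le_prod_encode_1, rule le_prod_encode_2)
  have "code_integral p" "code_integral q"
    unfolding code_integral_def using p q zd0 ze0 by auto
  \<comment> \<open>The constant coefficient of \<open>D\<close> is 1 and is fixed by the
    projection, so the denominator does not become 0.\<close>
  moreover have "zd 0 0 0 0 \<noteq> 0"
    using zd[of 0 0 0 0] M by (auto simp: d_def D(2) \<phi>(3))
  then have "code_nonzero q"
    unfolding code_nonzero_def using q(1) code_num_less[of q 0 0 0 0] by metis
  moreover have "code_relation N c p q"
    unfolding code_relation_def
  proof (intro allI impI)
    fix j i n
    \<comment> \<open>The ranges given by \<open>B\<close> and by \<open>c\<close> are not compared;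
      each of them contains the support.\<close>
    have "(\<Sum>l<B. \<Sum>k<B. zd j' i' l k * int_conv N k l (i - i') (j - j') n) =
        (\<Sum>l<c. \<Sum>k<c. zd j' i' l k * int_conv N k l (i - i') (j - j') n)" for i' j'
      by (rule sum_square_cong) (use zd0 code_num_less[of q] q(1) le(2) in \<open>fastforce\<close>)
    moreover have "(\<Sum>l<B. \<Sum>k<B. ze j i l k * int_mono k l n) = (\<Sum>l<c. \<Sum>k<c. ze j i l k * int_mono k l n)"
      by (rule sum_square_cong) (use ze0 code_num_less[of p] p(1) le(1) in \<open>fastforce\<close>)
    ultimately show "(\<Sum>j'<Suc j. \<Sum>i'<Suc i. \<Sum>l<c. \<Sum>k<c. code_num q j' i' l k * int_conv N k l (i - i') (j - j') n) =
         int N * (\<Sum>l<c. \<Sum>k<c. code_num p j i l k * int_mono k l n)"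
      using rel[of i j n] unfolding q(1) p(1) by (simp only:)
  qed
  ultimately have "certifies c N"
    by (simp add: certifies_def c_def)
  then show ?thesis ..
qed

theorem theorem4p3:
  "(\<forall>N::nat. prime N \<longrightarrow>
      (\<exists>P Q :: rat_poly4. Q \<noteq> 0 \<and> embed_poly4 Q * hecke_gf N = embed_poly4 P)) \<and>
   (\<exists>alg :: nat \<Rightarrow> nat. computable alg \<and>
      (\<forall>N. prime N \<longrightarrow>
         (\<exists>P Q. decode_poly4_pair (alg N) = (P, Q) \<and>
            Q \<noteq> 0 \<and> embed_poly4 Q * hecke_gf N = embed_poly4 P)))"
proof -
  define alg where "alg N = (LEAST c. prime N \<longrightarrow> certifies c N)" for N
  have "\<exists>c. prime N \<longrightarrow> certifies c N" for N
    using certifies_complete by blast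
  then have comp: "computable alg"
    unfolding alg_def[abs_def] by (intro computable_least recp_certifies)
  have alg: "\<exists>P Q. decode_poly4_pair (alg N) = (P, Q) \<and> Q \<noteq> 0 \<and> embed_poly4 Q * hecke_gf N = embed_poly4 P"
    if "prime N" for N
  proof -
    have "prime N \<longrightarrow> certifies (alg N) N"
      unfolding alg_def by (rule LeastI_ex) (use certifies_complete in blast)
    then have "certifies (alg N) N" using that by blast
    moreover have "decode_poly4_pair (alg N) = (decode_poly4 (fst (prod_decode (alg N))), decode_poly4 (snd (prod_decode (alg N))))"
      by (simp add: decode_poly4_pair_def map_prod_def case_prod_unfold)
    ultimately show ?thesis
      using certifies_sound[OF that] by blast
  qed
  show ?thesis
  proof (intro conjI allI impI exI[of _ alg] comp alg)
    fix N :: nat assume "prime N"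
    from alg[OF this] show "\<exists>P Q :: rat_poly4. Q \<noteq> 0 \<and> embed_poly4 Q * hecke_gf N = embed_poly4 P"
      by (elim ex_forward) (erule conjunct2)
  qed
qed

end
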